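(* Let $R$ be a commutative ring, and let $(\Sigma,w)$ be an $R$-balanced fan of dimension one. Then $(\Sigma,w)$ satisfies tropical Poincaré duality over $R$ if and only if it is uniquely $R$-balanced and all the weights $w(\alpha)$ ($\alpha\in\Sigma^1$) are units in $R$.
   Context: **Fans.** Let $N\cong\mathbb{Z}^n$ be a lattice, $N_{\mathbb{R}}=N\otimes\mathbb{R}$. A rational polyhedral cone is a strictly convex cone generated by finitely many vectors of $N$; for a cone $\sigma$, $L_{\mathbb{Z}}(\sigma)=N\cap\mathrm{span}(\sigma)$ and $\dim\sigma=\mathrm{rank}\,L_{\mathbb{Z}}(\sigma)$. A (rational polyhedral) fan $\Sigma$ is a finite nonempty collection of such cones, closed under taking faces, any two meeting in a common face; fans are assumed pure dimensional (all maximal cones have the same dimension $d=\dim\Sigma$). Cones are also called faces. $\Sigma^i$ is the set of $i$-dimensional cones, $\tau\preceq\sigma$ means $\tau$ is a face of $\sigma$, and $v=\{0\}\in\Sigma$ is the vertex, the only compact cone. Fix an orientation of each cone; for $\tau\prec\sigma$ with $\dim\tau=\dim\sigma-1$ let $\mathcal{O}(\tau,\sigma)=\pm1$ be the relative orientation sign. **Tropical (co)homology.** $F_p^{\mathbb{Z}}(\sigma)=\sum_{\gamma\succeq\sigma}\bigwedge^pL_{\mathbb{Z}}(\gamma)\subseteq\bigwedge^pN$ (with $F_0^{\mathbb{Z}}(\sigma)=\mathbb{Z}$), $F_p^R(\sigma)=F_p^{\mathbb{Z}}(\sigma)\otimes_{\mathbb{Z}}R$, and for $\tau\preceq\sigma$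 the map $\iota_{\sigma,\tau}:F_p^R(\sigma)\to F_p^R(\tau)$ is induced by inclusion. $F^p_R(\sigma)=\mathrm{Hom}_R(F_p^R(\sigma),R)$ with $\rho_{\tau,\sigma}:F_R^p(\tau)\to F_R^p(\sigma)$ dual to $\iota_{\sigma,\tau}$. $C_q^{BM}(\Sigma,F_p^R)=\bigoplus_{\sigma\in\Sigma^q}F_p^R(\sigma)$, with boundary having components $\mathcal{O}(\tau,\sigma)\iota_{\sigma,\tau}$; its homology is $H_q^{BM}(\Sigma,F_p^R)$. $C^q(\Sigma,F_R^p)=\bigoplus F_R^p(\sigma)$ over compact $\sigma\in\Sigma^q$, with coboundary having components $\mathcal{O}(\tau,\sigma)\rho_{\tau,\sigma}$; its cohomology is $H^q(\Sigma,F_R^p)$ (so $C^0=F_R^p(v)$ and $C^q=0$ for $q>0$). **Balancing.** For $\alpha\in\Sigma^d$, $\Lambda_\alpha\in F_d^R(\alpha)=\bigwedge^dL_{\mathbb{Z}}(\alpha)\otimes R\cong R$ is the image of the generator of $\bigwedge^dL_{\mathbb{Z}}(\alpha)$ compatible with the orientation of $\alpha$. An $R$-weight function is $w:\Sigma^d\to R$ with no $w(\alpha)$ a zero-divisor. $(\Sigma,w)$ is $R$-balanced if the fundamental chain $\mathrm{Ch}(\Sigma,w)=(w(\alpha)\Lambda_\alpha)_\alpha\in C_d^{BM}(\Sigma,F_d^R)$ is a cycle; its class is the fundamental class $[\Sigma,w]\in H_d^{BM}(\Sigma,F_d^R)$. It is uniquely $R$-balanced (by $w$) if moreover $H_d^{BM}(\Sigma,F_d^R)=\langle[\Sigma,w]\rangle\cong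 R$. **Cap product and duality.** For $y=y_1\wedge\dots\wedge y_m$ in $\bigwedge^mM$ ($M$ free of finite rank) and $x=x_1\wedge\dots\wedge x_p\in\bigwedge^pM^*$, $p\le m$, the contraction is $x\lrcorner y=(-1)^{p(p-1)/2}\sum_a\mathrm{sign}(a)\left(\prod_{i=1}^px_i(y_{a(i)})\right)y_{a(p+1)}\wedge\dots\wedge y_{a(m)}\in\bigwedge^{m-p}M$, summing over permutations $a\in S_m$ increasing on $1,\dots,p$ and on $p+1,\dots,m$. The cap product $\frown[\Sigma,w]:H^q(\Sigma,F_R^p)\to H_{d-q}^{BM}(\Sigma,F_{d-p}^R)$ is induced by $(u_\gamma)_{\gamma\in\Sigma^q}\mapsto\left(\sum_{\alpha\in\Sigma^d,\ \gamma,\tau\preceq\alpha}w(\alpha)\,\iota_{\alpha,\tau}(\rho_{\gamma,\alpha}(u_\gamma)\lrcorner\Lambda_\alpha)\right)_{\tau\in\Sigma^{d-q}}$; for $q=0$ it is $u\mapsto(\rho_{v,\alpha}(u)\lrcorner w(\alpha)\Lambda_\alpha)_{\alpha\in\Sigma^d}$. An $R$-balanced $(\Sigma,w)$ satisfies tropical Poincaré duality (TPD) over $R$ if $\frown[\Sigma,w]:H^q(\Sigma,F_R^p)\to H_{d-q}^{BM}(\Sigma,F_{d-p}^R)$ is an isomorphism for all $p,q\in\{0,\dots,d\}$. *)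

theory Defs
  imports "HOL-Analysis.Analysis" "HOL-Library.Function_Algebras"
    "HOL-Algebra.Module" "HOL-Algebra.AbelCoset"
begin

section \<open>Fans\<close>

text \<open>The lattice \<open>N\<close> is the integer lattice in \<open>real ^ 'n\<close>; its rank is \<open>CARD('n)\<close>.\<close>

definition lattice :: "(real ^ 'n) set" where
  "lattice = {x. \<forall>i. x $ i \<in> \<int>}"

definition rational_cone :: "(real ^ 'n) set \<Rightarrow> bool" where
  "rational_cone \<sigma> \<longleftrightarrow>
     (\<exists>V. finite V \<and> V \<subseteq> lattice \<and> \<sigma> = convex_cone hull V) \<and>
     (\<forall>x. x \<in> \<sigma> \<and> - x \<in> \<sigma> \<longrightarrow> x = 0)"

definition LZ :: "(real ^ 'n) set \<Rightarrow> (real ^ 'n) set" where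
  "LZ \<sigma> = lattice \<inter> span \<sigma>"

text \<open>For a subgroup of the integer lattice, \<open>dim\<close> (the dimension of the real span) is its rank.\<close>

definition cone_dim :: "(real ^ 'n) set \<Rightarrow> nat" where
  "cone_dim \<sigma> = dim (LZ \<sigma>)"

text \<open>\<open>face_of\<close> also admits the empty set, which is not a face of a cone.\<close>

definition fan :: "(real ^ 'n) set set \<Rightarrow> bool" where
  "fan \<Sigma> \<longleftrightarrow>
     finite \<Sigma> \<and> \<Sigma> \<noteq> {} \<and>
     (\<forall>\<sigma>\<in>\<Sigma>. rational_cone \<sigma>) \<and>
     (\<forall>\<sigma>\<in>\<Sigma>. \<forall>\<tau>. \<tau> face_of \<sigma> \<and> \<tau> \<noteq> {} \<longrightarrow> \<tau> \<in> \<Sigma>) \<and>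
     (\<forall>\<sigma>\<in>\<Sigma>. \<forall>\<tau>\<in>\<Sigma>. (\<sigma> \<inter> \<tau>) face_of \<sigma> \<and> (\<sigma> \<inter> \<tau>) face_of \<tau>)"

definition fan_dim :: "(real ^ 'n) set set \<Rightarrow> nat" where
  "fan_dim \<Sigma> = Max (cone_dim ` \<Sigma>)"

definition pure_fan :: "(real ^ 'n) set set \<Rightarrow> bool" where
  "pure_fan \<Sigma> \<longleftrightarrow> fan \<Sigma> \<and>
     (\<forall>\<sigma>\<in>\<Sigma>. (\<forall>\<gamma>\<in>\<Sigma>. \<sigma> face_of \<gamma> \<longrightarrow> \<gamma> = \<sigma>) \<longrightarrow> cone_dim \<sigma> = fan_dim \<Sigma>)"

definition faces :: "(real ^ 'n) set set \<Rightarrow> nat \<Rightarrow> (real ^ 'n) set set" where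
  "faces \<Sigma> q = {\<sigma> \<in> \<Sigma>. cone_dim \<sigma> = q}"


section \<open>Exterior powers of lattices\<close>

text \<open>
  The exterior power \<open>\<And>\<^sup>p(\<real>\<^sup>n)\<close> is realised by Plucker coordinates: the coordinate of
  \<open>v\<^sub>1 \<and> \<dots> \<and> v\<^sub>p\<close> at a list \<open>is\<close> of \<open>p\<close> indices is the determinant of the
  matrix \<open>(v\<^sub>a $ is\<^sub>b)\<close>, and its coordinate at a list of any other length is \<open>0\<close>.
  The left multiplication \<open>lwedge v \<omega> = v \<and> \<omega>\<close> is then the Laplace expansion of this determinant
  along its first row. Subgroups of \<open>\<And>\<^sup>pN\<close> are subsets of the type \<open>'n list \<Rightarrow> real\<close>.
\<close>

definition lwedge :: "real ^ 'n \<Rightarrow> ('n list \<Rightarrow> real) \<Rightarrow> 'n list \<Rightarrow> real" where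
  "lwedge v \<omega> = (\<lambda>is. \<Sum>k<length is. (- 1) ^ k * v $ (is ! k) * \<omega> (take k is @ drop (Suc k) is))"

definition wedge :: "(real ^ 'n) list \<Rightarrow> 'n list \<Rightarrow> real" where
  "wedge vs = foldr lwedge vs (\<lambda>is. if is = [] then 1 else 0)"

definition additive_subgroup :: "'a::ab_group_add set \<Rightarrow> bool" where
  "additive_subgroup H \<longleftrightarrow> 0 \<in> H \<and> (\<forall>x\<in>H. \<forall>y\<in>H. x - y \<in> H)"

definition ext_power :: "nat \<Rightarrow> (real ^ 'n) set \<Rightarrow> ('n list \<Rightarrow> real) set" where
  "ext_power p L = additive_subgroup hull {wedge vs |vs. length vs = p \<and> set vs \<subseteq> L}"

definition FZ :: "(real ^ 'n) set set \<Rightarrow> nat \<Rightarrow> (real ^ 'n) set \<Rightarrow> ('n list \<Rightarrow> real) set" where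
  "FZ \<Sigma> p \<sigma> = additive_subgroup hull (\<Union>\<gamma>\<in>{\<gamma> \<in> \<Sigma>. \<sigma> face_of \<gamma>}. ext_power p (LZ \<gamma>))"


section \<open>Orientations\<close>

text \<open>An orientation of \<open>\<sigma>\<close> is given as a generator of the top exterior power of \<open>LZ \<sigma>\<close>.\<close>

definition orientation ::
    "(real ^ 'n) set set \<Rightarrow> ((real ^ 'n) set \<Rightarrow> 'n list \<Rightarrow> real) \<Rightarrow> bool" where
  "orientation \<Sigma> \<omega> \<longleftrightarrow>
     (\<forall>\<sigma>\<in>\<Sigma>. ext_power (cone_dim \<sigma>) (LZ \<sigma>) = range (\<lambda>k::int. \<lambda>is. of_int k * \<omega> \<sigma> is))"

text \<open>
  Relative orientation of a facet \<open>\<tau>\<close> of \<open>\<sigma>\<close>, with the boundary convention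
  \<open>outward normal first\<close>: for \<open>u \<in> \<sigma>\<close> outside \<open>span \<tau>\<close>, the vector \<open>-u\<close> points out of \<open>\<sigma>\<close>
  across \<open>\<tau>\<close>.
\<close>

definition rel_orient ::
    "((real ^ 'n) set \<Rightarrow> 'n list \<Rightarrow> real) \<Rightarrow> (real ^ 'n) set \<Rightarrow> (real ^ 'n) set \<Rightarrow> int" where
  "rel_orient \<omega> \<tau> \<sigma> =
     (if \<exists>u\<in>\<sigma> - span \<tau>. \<exists>c>0. lwedge (- u) (\<omega> \<tau>) = (\<lambda>is. c * \<omega> \<sigma> is) then 1 else - 1)"


section \<open>Modules over a commutative ring\<close>

text \<open>The ring multiplication and unit that the record type of modules carries are irrelevant.\<close>

definition ring_module :: "('r, 'k) ring_scheme \<Rightarrow> ('r, 'r) module" where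
  "ring_module R = \<lparr>carrier = carrier R, mult = undefined, one = undefined,
     zero = \<zero>\<^bsub>R\<^esub>, add = add R, smult = mult R\<rparr>"

definition linear_maps ::
    "('r, 'k) ring_scheme \<Rightarrow> ('r, 'a, 'l) module_scheme \<Rightarrow> ('r, 'b, 'm) module_scheme \<Rightarrow> ('a \<Rightarrow> 'b) set" where
  "linear_maps R M M' = {f \<in> carrier M \<rightarrow>\<^sub>E carrier M'.
     (\<forall>x\<in>carrier M. \<forall>y\<in>carrier M. f (x \<oplus>\<^bsub>M\<^esub> y) = f x \<oplus>\<^bsub>M'\<^esub> f y) \<and>
     (\<forall>r\<in>carrier R. \<forall>x\<in>carrier M. f (r \<odot>\<^bsub>M\<^esub> x) = r \<odot>\<^bsub>M'\<^esub> f x)}"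

definition module_isos ::
    "('r, 'k) ring_scheme \<Rightarrow> ('r, 'a, 'l) module_scheme \<Rightarrow> ('r, 'b, 'm) module_scheme \<Rightarrow> ('a \<Rightarrow> 'b) set" where
  "module_isos R M M' = {f \<in> linear_maps R M M'. bij_betw f (carrier M) (carrier M')}"

definition dual_module ::
    "('r, 'k) ring_scheme \<Rightarrow> ('r, 'a, 'l) module_scheme \<Rightarrow> ('r, 'a \<Rightarrow> 'r) module" where
  "dual_module R M = \<lparr>carrier = linear_maps R M (ring_module R), mult = undefined, one = undefined,
     zero = (\<lambda>x\<in>carrier M. \<zero>\<^bsub>R\<^esub>), add = (\<lambda>f g. \<lambda>x\<in>carrier M. f x \<oplus>\<^bsub>R\<^esub> g x),
     smult = (\<lambda>r f. \<lambda>x\<in>carrier M. r \<otimes>\<^bsub>R\<^esub> f x)\<rparr>"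

text \<open>The index sets below are finite, so that direct sums are products.\<close>

definition sum_module :: "'i set \<Rightarrow> ('i \<Rightarrow> ('r, 'a, 'l) module_scheme) \<Rightarrow> ('r, 'i \<Rightarrow> 'a) module" where
  "sum_module I M = \<lparr>carrier = (\<Pi>\<^sub>E i\<in>I. carrier (M i)), mult = undefined, one = undefined,
     zero = (\<lambda>i\<in>I. \<zero>\<^bsub>M i\<^esub>), add = (\<lambda>x y. \<lambda>i\<in>I. x i \<oplus>\<^bsub>M i\<^esub> y i),
     smult = (\<lambda>r x. \<lambda>i\<in>I. r \<odot>\<^bsub>M i\<^esub> x i)\<rparr>"

definition quot_module :: "('r, 'a, 'l) module_scheme \<Rightarrow> 'a set \<Rightarrow> ('r, 'a set) module" where
  "quot_module M H = \<lparr>carrier = a_rcosets\<^bsub>M\<^esub> H, mult = undefined, one = undefined,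
     zero = H, add = set_add M, smult = (\<lambda>r X. \<Union>x\<in>X. H +>\<^bsub>M\<^esub> (r \<odot>\<^bsub>M\<^esub> x))\<rparr>"

text \<open>
  The map of quotients \<open>M / H \<rightarrow> M' / H'\<close> induced by \<open>f\<close>: if \<open>f\<close> is linear and maps \<open>H\<close> into
  \<open>H'\<close>, then all cosets in the union coincide.
\<close>

definition induced_map ::
    "('r, 'a, 'l) module_scheme \<Rightarrow> 'a set \<Rightarrow> ('r, 'b, 'm) module_scheme \<Rightarrow> 'b set \<Rightarrow> ('a \<Rightarrow> 'b) \<Rightarrow>
     'a set \<Rightarrow> 'b set" where
  "induced_map M H M' H' f = (\<lambda>X\<in>carrier (quot_module M H). \<Union>x\<in>X. H' +>\<^bsub>M'\<^esub> f x)"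


subsection \<open>Extension of scalars\<close>

text \<open>
  For an additive group \<open>A\<close>, the tensor product of \<open>A\<close> with \<open>R\<close> over the integers, as an \<open>R\<close>-module:
  the free \<open>R\<close>-module on the symbols \<open>[a]\<close> (for \<open>a \<otimes> 1\<close>, \<open>a \<in> A\<close>) modulo the submodule generated
  by all \<open>[a + b] - [a] - [b]\<close>.
\<close>

definition free_module :: "('r, 'k) ring_scheme \<Rightarrow> 'a set \<Rightarrow> ('r, 'a \<Rightarrow> 'r) module" where
  "free_module R A = \<lparr>carrier = {f. (\<forall>a. f a \<in> carrier R) \<and> (\<forall>a. a \<notin> A \<longrightarrow> f a = \<zero>\<^bsub>R\<^esub>) \<and>
       finite {a. f a \<noteq> \<zero>\<^bsub>R\<^esub>}}, mult = undefined, one = undefined,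
     zero = (\<lambda>a. \<zero>\<^bsub>R\<^esub>), add = (\<lambda>f g a. f a \<oplus>\<^bsub>R\<^esub> g a), smult = (\<lambda>r f a. r \<otimes>\<^bsub>R\<^esub> f a)\<rparr>"

definition symb :: "('r, 'k) ring_scheme \<Rightarrow> 'a \<Rightarrow> 'a \<Rightarrow> 'r" where
  "symb R a = (\<lambda>x. if x = a then \<one>\<^bsub>R\<^esub> else \<zero>\<^bsub>R\<^esub>)"

definition tensor_rel :: "('r, 'k) ring_scheme \<Rightarrow> 'a::ab_group_add set \<Rightarrow> ('a \<Rightarrow> 'r) set" where
  "tensor_rel R A = (\<lambda>H. submodule H R (free_module R A)) hull
     {symb R (a + b) \<ominus>\<^bsub>free_module R A\<^esub> symb R a \<ominus>\<^bsub>free_module R A\<^esub> symb R b |a b. a \<in> A \<and> b \<in> A}"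

definition tensor :: "('r, 'k) ring_scheme \<Rightarrow> 'a::ab_group_add set \<Rightarrow> ('r, ('a \<Rightarrow> 'r) set) module" where
  "tensor R A = quot_module (free_module R A) (tensor_rel R A)"

text \<open>\<open>pure_tensor R A a\<close> is \<open>a \<otimes> 1\<close>.\<close>

definition pure_tensor :: "('r, 'k) ring_scheme \<Rightarrow> 'a::ab_group_add set \<Rightarrow> 'a \<Rightarrow> ('a \<Rightarrow> 'r) set" where
  "pure_tensor R A a = tensor_rel R A +>\<^bsub>free_module R A\<^esub> symb R a"

definition tensor_incl ::
    "('r, 'k) ring_scheme \<Rightarrow> 'a::ab_group_add set \<Rightarrow> 'a set \<Rightarrow> ('a \<Rightarrow> 'r) set \<Rightarrow> ('a \<Rightarrow> 'r) set" where
  "tensor_incl R A B =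
     induced_map (free_module R A) (tensor_rel R A) (free_module R B) (tensor_rel R B) (\<lambda>x. x)"


section \<open>Tropical homology and cohomology\<close>

type_synonym 'n cone = "(real ^ 'n) set"
type_synonym 'n multivec = "'n list \<Rightarrow> real"
type_synonym ('n, 'r) coeff = "('n multivec \<Rightarrow> 'r) set"
type_synonym ('n, 'r) chain = "'n cone \<Rightarrow> ('n, 'r) coeff"
type_synonym ('n, 'r) cochain = "'n cone \<Rightarrow> ('n, 'r) coeff \<Rightarrow> 'r"

definition F_lower ::
    "('r, 'k) ring_scheme \<Rightarrow> 'n::finite cone set \<Rightarrow> nat \<Rightarrow> 'n cone \<Rightarrow> ('r, ('n, 'r) coeff) module" where
  "F_lower R \<Sigma> p \<sigma> = tensor R (FZ \<Sigma> p \<sigma>)"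

definition iota ::
    "('r, 'k) ring_scheme \<Rightarrow> 'n::finite cone set \<Rightarrow> nat \<Rightarrow> 'n cone \<Rightarrow> 'n cone \<Rightarrow> ('n, 'r) coeff \<Rightarrow> ('n, 'r) coeff" where
  "iota R \<Sigma> p \<sigma> \<tau> = tensor_incl R (FZ \<Sigma> p \<sigma>) (FZ \<Sigma> p \<tau>)"

definition F_upper ::
    "('r, 'k) ring_scheme \<Rightarrow> 'n::finite cone set \<Rightarrow> nat \<Rightarrow> 'n cone \<Rightarrow> ('r, ('n, 'r) coeff \<Rightarrow> 'r) module" where
  "F_upper R \<Sigma> p \<sigma> = dual_module R (F_lower R \<Sigma> p \<sigma>)"

definition rho ::
    "('r, 'k) ring_scheme \<Rightarrow> 'n::finite cone set \<Rightarrow> nat \<Rightarrow> 'n cone \<Rightarrow> 'n cone \<Rightarrow>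
     (('n, 'r) coeff \<Rightarrow> 'r) \<Rightarrow> ('n, 'r) coeff \<Rightarrow> 'r" where
  "rho R \<Sigma> p \<tau> \<sigma> f = (\<lambda>x\<in>carrier (F_lower R \<Sigma> p \<sigma>). f (iota R \<Sigma> p \<sigma> \<tau> x))"


subsection \<open>Borel--Moore homology\<close>

definition BM_chains ::
    "('r, 'k) ring_scheme \<Rightarrow> 'n::finite cone set \<Rightarrow> nat \<Rightarrow> nat \<Rightarrow> ('r, ('n, 'r) chain) module" where
  "BM_chains R \<Sigma> p q = sum_module (faces \<Sigma> q) (F_lower R \<Sigma> p)"

text \<open>\<open>BM_boundary R \<Sigma> \<omega> p q\<close> is the boundary map from degree \<open>q + 1\<close> to degree \<open>q\<close>.\<close>

definition BM_boundary ::
    "('r, 'k) ring_scheme \<Rightarrow> 'n::finite cone set \<Rightarrow> ('n cone \<Rightarrow> 'n multivec) \<Rightarrow> nat \<Rightarrow> nat \<Rightarrow>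
     ('n, 'r) chain \<Rightarrow> ('n, 'r) chain" where
  "BM_boundary R \<Sigma> \<omega> p q c = (\<lambda>\<tau>\<in>faces \<Sigma> q.
     finsum (F_lower R \<Sigma> p \<tau>)
       (\<lambda>\<sigma>. add_pow (F_lower R \<Sigma> p \<tau>) (rel_orient \<omega> \<tau> \<sigma>) (iota R \<Sigma> p \<sigma> \<tau> (c \<sigma>)))
       {\<sigma> \<in> faces \<Sigma> (q + 1). \<tau> face_of \<sigma>})"

definition BM_cycles ::
    "('r, 'k) ring_scheme \<Rightarrow> 'n::finite cone set \<Rightarrow> ('n cone \<Rightarrow> 'n multivec) \<Rightarrow> nat \<Rightarrow> nat \<Rightarrow> ('n, 'r) chain set" where
  "BM_cycles R \<Sigma> \<omega> p q =
     (case q of 0 \<Rightarrow> carrier (BM_chains R \<Sigma> p 0)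
      | Suc q' \<Rightarrow> {c \<in> carrier (BM_chains R \<Sigma> p (Suc q')).
                    BM_boundary R \<Sigma> \<omega> p q' c = \<zero>\<^bsub>BM_chains R \<Sigma> p q'\<^esub>})"

definition BM_boundaries ::
    "('r, 'k) ring_scheme \<Rightarrow> 'n::finite cone set \<Rightarrow> ('n cone \<Rightarrow> 'n multivec) \<Rightarrow> nat \<Rightarrow> nat \<Rightarrow> ('n, 'r) chain set" where
  "BM_boundaries R \<Sigma> \<omega> p q = BM_boundary R \<Sigma> \<omega> p q ` carrier (BM_chains R \<Sigma> p (q + 1))"

definition BM_cycle_module ::
    "('r, 'k) ring_scheme \<Rightarrow> 'n::finite cone set \<Rightarrow> ('n cone \<Rightarrow> 'n multivec) \<Rightarrow> nat \<Rightarrow> nat \<Rightarrow>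
     ('r, ('n, 'r) chain) module" where
  "BM_cycle_module R \<Sigma> \<omega> p q = (BM_chains R \<Sigma> p q)\<lparr>carrier := BM_cycles R \<Sigma> \<omega> p q\<rparr>"

definition BM_homology ::
    "('r, 'k) ring_scheme \<Rightarrow> 'n::finite cone set \<Rightarrow> ('n cone \<Rightarrow> 'n multivec) \<Rightarrow> nat \<Rightarrow> nat \<Rightarrow>
     ('r, ('n, 'r) chain set) module" where
  "BM_homology R \<Sigma> \<omega> p q = quot_module (BM_cycle_module R \<Sigma> \<omega> p q) (BM_boundaries R \<Sigma> \<omega> p q)"


subsection \<open>Cohomology\<close>

definition compact_faces :: "'n::finite cone set \<Rightarrow> nat \<Rightarrow> 'n cone set" where
  "compact_faces \<Sigma> q = {\<sigma> \<in> faces \<Sigma> q. compact \<sigma>}"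

definition cochains ::
    "('r, 'k) ring_scheme \<Rightarrow> 'n::finite cone set \<Rightarrow> nat \<Rightarrow> nat \<Rightarrow> ('r, ('n, 'r) cochain) module" where
  "cochains R \<Sigma> p q = sum_module (compact_faces \<Sigma> q) (F_upper R \<Sigma> p)"

text \<open>\<open>coboundary R \<Sigma> \<omega> p q\<close> is the coboundary map from degree \<open>q\<close> to degree \<open>q + 1\<close>.\<close>

definition coboundary ::
    "('r, 'k) ring_scheme \<Rightarrow> 'n::finite cone set \<Rightarrow> ('n cone \<Rightarrow> 'n multivec) \<Rightarrow> nat \<Rightarrow> nat \<Rightarrow>
     ('n, 'r) cochain \<Rightarrow> ('n, 'r) cochain" where
  "coboundary R \<Sigma> \<omega> p q u = (\<lambda>\<sigma>\<in>compact_faces \<Sigma> (q + 1).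
     finsum (F_upper R \<Sigma> p \<sigma>)
       (\<lambda>\<tau>. add_pow (F_upper R \<Sigma> p \<sigma>) (rel_orient \<omega> \<tau> \<sigma>) (rho R \<Sigma> p \<tau> \<sigma> (u \<tau>)))
       {\<tau> \<in> compact_faces \<Sigma> q. \<tau> face_of \<sigma>})"

definition cocycles ::
    "('r, 'k) ring_scheme \<Rightarrow> 'n::finite cone set \<Rightarrow> ('n cone \<Rightarrow> 'n multivec) \<Rightarrow> nat \<Rightarrow> nat \<Rightarrow> ('n, 'r) cochain set" where
  "cocycles R \<Sigma> \<omega> p q =
     {u \<in> carrier (cochains R \<Sigma> p q). coboundary R \<Sigma> \<omega> p q u = \<zero>\<^bsub>cochains R \<Sigma> p (q + 1)\<^esub>}"

definition coboundaries ::
    "('r, 'k) ring_scheme \<Rightarrow> 'n::finite cone set \<Rightarrow> ('n cone \<Rightarrow> 'n multivec) \<Rightarrow> nat \<Rightarrow> nat \<Rightarrow> ('n, 'r) cochain set" where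
  "coboundaries R \<Sigma> \<omega> p q =
     (case q of 0 \<Rightarrow> {\<zero>\<^bsub>cochains R \<Sigma> p 0\<^esub>}
      | Suc q' \<Rightarrow> coboundary R \<Sigma> \<omega> p q' ` carrier (cochains R \<Sigma> p q'))"

definition cocycle_module ::
    "('r, 'k) ring_scheme \<Rightarrow> 'n::finite cone set \<Rightarrow> ('n cone \<Rightarrow> 'n multivec) \<Rightarrow> nat \<Rightarrow> nat \<Rightarrow>
     ('r, ('n, 'r) cochain) module" where
  "cocycle_module R \<Sigma> \<omega> p q = (cochains R \<Sigma> p q)\<lparr>carrier := cocycles R \<Sigma> \<omega> p q\<rparr>"

definition cohomology ::
    "('r, 'k) ring_scheme \<Rightarrow> 'n::finite cone set \<Rightarrow> ('n cone \<Rightarrow> 'n multivec) \<Rightarrow> nat \<Rightarrow> nat \<Rightarrow>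
     ('r, ('n, 'r) cochain set) module" where
  "cohomology R \<Sigma> \<omega> p q = quot_module (cocycle_module R \<Sigma> \<omega> p q) (coboundaries R \<Sigma> \<omega> p q)"


section \<open>Balanced fans\<close>

text \<open>With the usual convention that \<open>0\<close> is a zero-divisor of a nontrivial ring.\<close>

definition weight_function ::
    "('r, 'k) ring_scheme \<Rightarrow> 'n::finite cone set \<Rightarrow> ('n cone \<Rightarrow> 'r) \<Rightarrow> bool" where
  "weight_function R \<Sigma> w \<longleftrightarrow>
     (\<forall>\<alpha>\<in>faces \<Sigma> (fan_dim \<Sigma>). w \<alpha> \<in> carrier R \<and>
        (\<forall>b\<in>carrier R. w \<alpha> \<otimes>\<^bsub>R\<^esub> b = \<zero>\<^bsub>R\<^esub> \<longrightarrow> b = \<zero>\<^bsub>R\<^esub>))"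

definition Lam ::
    "('r, 'k) ring_scheme \<Rightarrow> 'n::finite cone set \<Rightarrow> ('n cone \<Rightarrow> 'n multivec) \<Rightarrow> 'n cone \<Rightarrow> ('n, 'r) coeff" where
  "Lam R \<Sigma> \<omega> \<alpha> = pure_tensor R (FZ \<Sigma> (fan_dim \<Sigma>) \<alpha>) (\<omega> \<alpha>)"

definition fund_chain ::
    "('r, 'k) ring_scheme \<Rightarrow> 'n::finite cone set \<Rightarrow> ('n cone \<Rightarrow> 'n multivec) \<Rightarrow> ('n cone \<Rightarrow> 'r) \<Rightarrow> ('n, 'r) chain" where
  "fund_chain R \<Sigma> \<omega> w = (\<lambda>\<alpha>\<in>faces \<Sigma> (fan_dim \<Sigma>).
     w \<alpha> \<odot>\<^bsub>F_lower R \<Sigma> (fan_dim \<Sigma>) \<alpha>\<^esub> Lam R \<Sigma> \<omega> \<alpha>)"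

definition balanced ::
    "('r, 'k) ring_scheme \<Rightarrow> 'n::finite cone set \<Rightarrow> ('n cone \<Rightarrow> 'n multivec) \<Rightarrow> ('n cone \<Rightarrow> 'r) \<Rightarrow> bool" where
  "balanced R \<Sigma> \<omega> w \<longleftrightarrow> weight_function R \<Sigma> w \<and>
     fund_chain R \<Sigma> \<omega> w \<in> BM_cycles R \<Sigma> \<omega> (fan_dim \<Sigma>) (fan_dim \<Sigma>)"

definition fund_class ::
    "('r, 'k) ring_scheme \<Rightarrow> 'n::finite cone set \<Rightarrow> ('n cone \<Rightarrow> 'n multivec) \<Rightarrow> ('n cone \<Rightarrow> 'r) \<Rightarrow>
     ('n, 'r) chain set" where
  "fund_class R \<Sigma> \<omega> w = (let d = fan_dim \<Sigma> in
     BM_boundaries R \<Sigma> \<omega> d d +>\<^bsub>BM_cycle_module R \<Sigma> \<omega> d d\<^esub> fund_chain R \<Sigma> \<omega> w)"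

definition uniquely_balanced ::
    "('r, 'k) ring_scheme \<Rightarrow> 'n::finite cone set \<Rightarrow> ('n cone \<Rightarrow> 'n multivec) \<Rightarrow> ('n cone \<Rightarrow> 'r) \<Rightarrow> bool" where
  "uniquely_balanced R \<Sigma> \<omega> w \<longleftrightarrow> (let H = BM_homology R \<Sigma> \<omega> (fan_dim \<Sigma>) (fan_dim \<Sigma>) in
     balanced R \<Sigma> \<omega> w \<and>
     carrier H = {r \<odot>\<^bsub>H\<^esub> fund_class R \<Sigma> \<omega> w |r. r \<in> carrier R} \<and>
     module_isos R H (ring_module R) \<noteq> {})"


section \<open>Cap product and tropical Poincare duality\<close>

definition shuffle_perms :: "nat \<Rightarrow> nat \<Rightarrow> (nat \<Rightarrow> nat) set" where
  "shuffle_perms p m =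
     {a. a permutes {..<m} \<and> strict_mono_on {..<p} a \<and> strict_mono_on {p..<m} a}"

text \<open>
  Contraction by \<open>u\<close>, a linear form on \<open>\<And>\<^sup>pL \<otimes> R\<close>, as the \<open>R\<close>-linear map from
  \<open>\<And>\<^sup>mL \<otimes> R\<close> to \<open>\<And>\<^sup>m\<^sup>-\<^sup>pL \<otimes> R\<close> with the prescribed values on decomposable
  elements. The form \<open>u\<close> is evaluated on the factor of \<open>y\<close> formed by the first \<open>p\<close> chosen vectors;
  for \<open>u\<close> decomposable this is the determinant of the pairings.
\<close>

definition contraction ::
    "('r, 'k) ring_scheme \<Rightarrow> (real ^ 'n) set \<Rightarrow> nat \<Rightarrow> nat \<Rightarrow> (('n, 'r) coeff \<Rightarrow> 'r) \<Rightarrow>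
     ('n, 'r) coeff \<Rightarrow> ('n, 'r) coeff" where
  "contraction R L p m u =
     (let T = tensor R (ext_power (m - p) L) in
      THE f. f \<in> linear_maps R (tensor R (ext_power m L)) T \<and>
        (\<forall>y. length y = m \<and> set y \<subseteq> L \<longrightarrow>
          f (pure_tensor R (ext_power m L) (wedge y)) =
            finsum T
              (\<lambda>a. add_pow T ((- 1) ^ (p * (p - 1) div 2) * sign a)
                 (u (pure_tensor R (ext_power p L) (wedge (map (\<lambda>i. y ! a i) [0..<p])))
                  \<odot>\<^bsub>T\<^esub> pure_tensor R (ext_power (m - p) L) (wedge (map (\<lambda>i. y ! a i) [p..<m]))))
              (shuffle_perms p m)))"

text \<open>
  For a maximal cone \<open>\<alpha>\<close>, \<open>FZ \<Sigma> p \<alpha>\<close> equals \<open>ext_power p (LZ \<alpha>)\<close>, so contraction acts on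
  the coefficient modules at \<open>\<alpha>\<close>.
\<close>

definition cap ::
    "('r, 'k) ring_scheme \<Rightarrow> 'n::finite cone set \<Rightarrow> ('n cone \<Rightarrow> 'n multivec) \<Rightarrow> ('n cone \<Rightarrow> 'r) \<Rightarrow> nat \<Rightarrow> nat \<Rightarrow>
     ('n, 'r) cochain \<Rightarrow> ('n, 'r) chain" where
  "cap R \<Sigma> \<omega> w p q u = (let d = fan_dim \<Sigma> in
     (\<lambda>\<tau>\<in>faces \<Sigma> (d - q). let M = F_lower R \<Sigma> (d - p) \<tau> in
       finsum M
         (\<lambda>(\<gamma>, \<alpha>). w \<alpha> \<odot>\<^bsub>M\<^esub> iota R \<Sigma> (d - p) \<alpha> \<tau>
            (contraction R (LZ \<alpha>) p d (rho R \<Sigma> p \<gamma> \<alpha> (u \<gamma>)) (Lam R \<Sigma> \<omega> \<alpha>)))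
         {(\<gamma>, \<alpha>). \<gamma> \<in> compact_faces \<Sigma> q \<and> \<alpha> \<in> faces \<Sigma> d \<and> \<gamma> face_of \<alpha> \<and> \<tau> face_of \<alpha>}))"

definition cap_map ::
    "('r, 'k) ring_scheme \<Rightarrow> 'n::finite cone set \<Rightarrow> ('n cone \<Rightarrow> 'n multivec) \<Rightarrow> ('n cone \<Rightarrow> 'r) \<Rightarrow> nat \<Rightarrow> nat \<Rightarrow>
     ('n, 'r) cochain set \<Rightarrow> ('n, 'r) chain set" where
  "cap_map R \<Sigma> \<omega> w p q = (let d = fan_dim \<Sigma> in
     induced_map (cocycle_module R \<Sigma> \<omega> p q) (coboundaries R \<Sigma> \<omega> p q)
       (BM_cycle_module R \<Sigma> \<omega> (d - p) (d - q)) (BM_boundaries R \<Sigma> \<omega> (d - p) (d - q))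
       (cap R \<Sigma> \<omega> w p q))"

definition TPD ::
    "('r, 'k) ring_scheme \<Rightarrow> 'n::finite cone set \<Rightarrow> ('n cone \<Rightarrow> 'n multivec) \<Rightarrow> ('n cone \<Rightarrow> 'r) \<Rightarrow> bool" where
  "TPD R \<Sigma> \<omega> w \<longleftrightarrow> (let d = fan_dim \<Sigma> in
     \<forall>p\<le>d. \<forall>q\<le>d. cap_map R \<Sigma> \<omega> w p q
       \<in> module_isos R (cohomology R \<Sigma> \<omega> p q) (BM_homology R \<Sigma> \<omega> (d - p) (d - q)))"

end

theory Submission
  imports Defs
begin

text \<open>
  A one-dimensional fan consists of the vertex \<open>v = {0}\<close> and finitely many rays. The vertex is its only
  compact cone, so \<open>H\<^sup>0\<close> is the module of linear forms on \<open>F\<^sub>p(v)\<close> and \<open>H\<^sup>1 = 0\<close>. Dually,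
  \<open>H\<^sub>0\<close> vanishes, because every coefficient at the vertex is a sum of coefficients on rays
  (\<open>boundaries_0\<close>), and \<open>H\<^sub>1\<close> is the module of cycles, because there are no two-dimensional cones.
  Duality is therefore automatic for \<open>q = 1\<close> (\<open>cap_map_top_iso\<close>), and only the two maps with
  \<open>q = 0\<close> matter.

  On a ray \<open>\<alpha>\<close> the coefficient groups are infinite cyclic for \<open>p = 0\<close> and \<open>p = 1\<close>, so a 1-chain is the
  same as a family \<open>a\<close> of scalars indexed by the rays. Let \<open>s\<^sub>\<alpha>\<close> be the sign of \<open>v\<close> in \<open>\<alpha>\<close>, and let
  \<open>l\<^sub>\<alpha>\<close> be the image in \<open>F\<^sub>1(v)\<close> of the generator of \<open>F\<^sub>1(\<alpha>)\<close>. The boundary of \<open>a\<close> is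
  \<open>\<Sum> s\<^sub>\<alpha> a\<^sub>\<alpha> l\<^sub>\<alpha>\<close> for \<open>F\<^sub>1\<close> and \<open>\<Sum> s\<^sub>\<alpha> a\<^sub>\<alpha>\<close> for \<open>F\<^sub>0\<close>. In these coordinates the cap product of a
  linear form \<open>u\<close> is the family \<open>w\<^sub>\<alpha> u(e\<^sub>\<alpha>)\<close>, where the \<open>e\<^sub>\<alpha>\<close> are the corresponding generators of
  \<open>F\<^sub>p(v)\<close> (\<open>cap_0\<close>). It is injective because the weights are not zero-divisors and the
  \<open>e\<^sub>\<alpha>\<close> generate, so only surjectivity onto the cycles is at stake (\<open>cap_map_iso_iff\<close>).

  For \<open>p = 0\<close> all \<open>e\<^sub>\<alpha>\<close> coincide and the image consists of the multiples of \<open>w\<close>. Surjectivity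
  says that every cycle is a multiple of the fundamental one, which is unique balancing
  (\<open>uniquely_balanced_iff\<close>).

  For \<open>p = 1\<close> assume unique balancing. It says that the relations among the generators
  \<open>s\<^sub>\<alpha> l\<^sub>\<alpha>\<close> of \<open>F\<^sub>1(v)\<close> are spanned by \<open>w\<close>. If the weights are units and \<open>\<Sum> s\<^sub>\<alpha> c\<^sub>\<alpha> = 0\<close>, then
  \<open>s\<^sub>\<alpha> l\<^sub>\<alpha> \<mapsto> s\<^sub>\<alpha> c\<^sub>\<alpha> / w\<^sub>\<alpha>\<close> respects this relation, and hence it defines a form whose cap product is
  \<open>c\<close>. Conversely, if every such \<open>c\<close> has the form \<open>w\<^sub>\<alpha> u(l\<^sub>\<alpha>)\<close>, then taking a cycle with value
  \<open>\<plusminus>1\<close> on \<open>\<alpha>\<close> and on one other ray shows that \<open>w\<^sub>\<alpha>\<close> is a unit. With a single ray there is no other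
  ray, but then balancing forces \<open>w\<^sub>\<alpha> = 0\<close>, so the ring is trivial and its
  only element is a unit. This is
  \<open>dual_surjective_iff_weights_units\<close>.
\<close>

section \<open>Modules, quotients and induced maps\<close>

text \<open>
  Additive inverses are multiples by \<open>-1\<close>. This replaces the existence of inverses by an equation,
  which is convenient for records given by explicit formulas.
\<close>

lemma module_by_fields:
  fixes R (structure) and M (structure)
  assumes "cring R"
    and "\<And>x y. x \<in> carrier M \<Longrightarrow> y \<in> carrier M \<Longrightarrow> x \<oplus>\<^bsub>M\<^esub> y \<in> carrier M"
    and "\<zero>\<^bsub>M\<^esub> \<in> carrier M"
    and "\<And>x y z. x \<in> carrier M \<Longrightarrow> y \<in> carrier M \<Longrightarrow> z \<in> carrier M \<Longrightarrow>
      (x \<oplus>\<^bsub>M\<^esub> y) \<oplus>\<^bsub>M\<^esub> z = x \<oplus>\<^bsub>M\<^esub> (y \<oplus>\<^bsub>M\<^esub> z)"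
    and "\<And>x y. x \<in> carrier M \<Longrightarrow> y \<in> carrier M \<Longrightarrow> x \<oplus>\<^bsub>M\<^esub> y = y \<oplus>\<^bsub>M\<^esub> x"
    and "\<And>x. x \<in> carrier M \<Longrightarrow> \<zero>\<^bsub>M\<^esub> \<oplus>\<^bsub>M\<^esub> x = x"
    and "\<And>x. x \<in> carrier M \<Longrightarrow> (\<ominus> \<one>) \<odot>\<^bsub>M\<^esub> x \<oplus>\<^bsub>M\<^esub> x = \<zero>\<^bsub>M\<^esub>"
    and "\<And>a x. a \<in> carrier R \<Longrightarrow> x \<in> carrier M \<Longrightarrow> a \<odot>\<^bsub>M\<^esub> x \<in> carrier M"
    and "\<And>a b x. a \<in> carrier R \<Longrightarrow> b \<in> carrier R \<Longrightarrow> x \<in> carrier M \<Longrightarrow>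
      (a \<oplus> b) \<odot>\<^bsub>M\<^esub> x = (a \<odot>\<^bsub>M\<^esub> x) \<oplus>\<^bsub>M\<^esub> (b \<odot>\<^bsub>M\<^esub> x)"
    and "\<And>a x y. a \<in> carrier R \<Longrightarrow> x \<in> carrier M \<Longrightarrow> y \<in> carrier M \<Longrightarrow>
      a \<odot>\<^bsub>M\<^esub> (x \<oplus>\<^bsub>M\<^esub> y) = (a \<odot>\<^bsub>M\<^esub> x) \<oplus>\<^bsub>M\<^esub> (a \<odot>\<^bsub>M\<^esub> y)"
    and "\<And>a b x. a \<in> carrier R \<Longrightarrow> b \<in> carrier R \<Longrightarrow> x \<in> carrier M \<Longrightarrow>
      (a \<otimes> b) \<odot>\<^bsub>M\<^esub> x = a \<odot>\<^bsub>M\<^esub> (b \<odot>\<^bsub>M\<^esub> x)"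
    and "\<And>x. x \<in> carrier M \<Longrightarrow> \<one> \<odot>\<^bsub>M\<^esub> x = x"
  shows "module R M"
proof (rule moduleI)
  interpret cring R by fact
  show "abelian_group M"
  proof (rule abelian_groupI)
    fix x assume x: "x \<in> carrier M"
    then have "(\<ominus> \<one>) \<odot>\<^bsub>M\<^esub> x \<in> carrier M" using assms(8) by simp
    then show "\<exists>y\<in>carrier M. y \<oplus>\<^bsub>M\<^esub> x = \<zero>\<^bsub>M\<^esub>" using assms(7) x by blast
  qed (rule assms; assumption)+
qed (rule assms; assumption)+

lemma module_ring_module:
  assumes "cring R"
  shows "module R (ring_module R)"
proof -
  interpret cring R by fact
  show ?thesis
    by (rule module_by_fields) (auto simp: ring_module_def a_ac m_ac l_distr r_distr r_minus r_neg assms)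
qed

lemma module_sum_module:
  assumes "cring R" "\<And>i. i \<in> I \<Longrightarrow> module R (M i)"
  shows "module R (sum_module I M)"
proof -
  interpret cring R by fact
  let ?S = "sum_module I M"
  note g = module.axioms(2)[OF assms(2)]
  note m = abelian_group.axioms(1)[OF g]
  have c: "x \<in> carrier ?S \<longleftrightarrow> x \<in> extensional I \<and> (\<forall>i\<in>I. x i \<in> carrier (M i))" for x
    by (auto simp: sum_module_def PiE_def)
  have ops: "x \<oplus>\<^bsub>?S\<^esub> y = (\<lambda>i\<in>I. x i \<oplus>\<^bsub>M i\<^esub> y i)" "r \<odot>\<^bsub>?S\<^esub> x = (\<lambda>i\<in>I. r \<odot>\<^bsub>M i\<^esub> x i)"
    "\<zero>\<^bsub>?S\<^esub> = (\<lambda>i\<in>I. \<zero>\<^bsub>M i\<^esub>)" for x y r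
    by (auto simp: sum_module_def)
  note laws = abelian_monoid.a_closed[OF m] abelian_monoid.zero_closed[OF m]
    module.smult_closed[OF assms(2)]
    abelian_monoid.l_zero[OF m] module.smult_l_distr[OF assms(2)]
    module.smult_r_distr[OF assms(2)] module.smult_assoc1[OF assms(2)] module.smult_one[OF assms(2)]
    abelian_monoid.a_assoc[OF m] module.smult_l_minus[OF assms(2)] abelian_group.l_neg[OF g]
  show ?thesis
    by (rule module_by_fields)
      (auto simp: c ops laws assms(1) abelian_monoid.a_comm[OF m] abelian_monoid.a_lcomm[OF m]
        abelian_monoid.r_zero[OF m] intro!: extensionalityI[of _ I])
qed

subsection \<open>Linear maps\<close>

lemma linear_mapsI:
  assumes "\<And>x. x \<in> carrier M \<Longrightarrow> f x \<in> carrier M'"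
    and "\<And>x y. x \<in> carrier M \<Longrightarrow> y \<in> carrier M \<Longrightarrow> f (x \<oplus>\<^bsub>M\<^esub> y) = f x \<oplus>\<^bsub>M'\<^esub> f y"
    and "\<And>r x. r \<in> carrier R \<Longrightarrow> x \<in> carrier M \<Longrightarrow> f (r \<odot>\<^bsub>M\<^esub> x) = r \<odot>\<^bsub>M'\<^esub> f x"
    and "f \<in> extensional (carrier M)"
  shows "f \<in> linear_maps R M M'"
  using assms by (auto simp: linear_maps_def PiE_def)

lemma restrict_linear_mapsI:
  assumes "module R M"
    and "\<And>x. x \<in> carrier M \<Longrightarrow> f x \<in> carrier M'"
    and "\<And>x y. x \<in> carrier M \<Longrightarrow> y \<in> carrier M \<Longrightarrow> f (x \<oplus>\<^bsub>M\<^esub> y) = f x \<oplus>\<^bsub>M'\<^esub> f y"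
    and "\<And>r x. r \<in> carrier R \<Longrightarrow> x \<in> carrier M \<Longrightarrow> f (r \<odot>\<^bsub>M\<^esub> x) = r \<odot>\<^bsub>M'\<^esub> f x"
  shows "(\<lambda>x\<in>carrier M. f x) \<in> linear_maps R M M'"
proof -
  interpret module R M by fact
  show ?thesis by (rule linear_mapsI) (use assms(2-) in \<open>auto\<close>)
qed

lemma linear_mapsD:
  assumes "f \<in> linear_maps R M M'"
  shows "x \<in> carrier M \<Longrightarrow> f x \<in> carrier M'"
    and "x \<in> carrier M \<Longrightarrow> y \<in> carrier M \<Longrightarrow> f (x \<oplus>\<^bsub>M\<^esub> y) = f x \<oplus>\<^bsub>M'\<^esub> f y"
    and "r \<in> carrier R \<Longrightarrow> x \<in> carrier M \<Longrightarrow> f (r \<odot>\<^bsub>M\<^esub> x) = r \<odot>\<^bsub>M'\<^esub> f x"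
    and "f \<in> extensional (carrier M)"
  using assms by (auto simp: linear_maps_def PiE_def)

lemma linear_maps_zero:
  assumes "module R M" "module R M'" "f \<in> linear_maps R M M'"
  shows "f \<zero>\<^bsub>M\<^esub> = \<zero>\<^bsub>M'\<^esub>"
proof -
  interpret M: module R M by fact
  interpret M': module R M' by fact
  have "f (\<zero>\<^bsub>R\<^esub> \<odot>\<^bsub>M\<^esub> \<zero>\<^bsub>M\<^esub>) = \<zero>\<^bsub>R\<^esub> \<odot>\<^bsub>M'\<^esub> f \<zero>\<^bsub>M\<^esub>"
    using linear_mapsD(3)[OF assms(3)] by blast
  then show ?thesis using linear_mapsD(1)[OF assms(3)] by simp
qed

lemma linear_maps_finsum:
  assumes "module R M" "module R M'" "f \<in> linear_maps R M M'"
    and "\<And>i. i \<in> I \<Longrightarrow> g i \<in> carrier M"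
  shows "f (finsum M g I) = finsum M' (\<lambda>i. f (g i)) I"
proof -
  interpret M: module R M by fact
  interpret M': module R M' by fact
  note l = linear_mapsD[OF assms(3)]
  show ?thesis using assms(4)
  proof (induction I rule: infinite_finite_induct)
    case (insert i I)
    then have "g i \<in> carrier M" "g \<in> I \<rightarrow> carrier M" by auto
    moreover then have "f (g i) \<in> carrier M'" "(\<lambda>i. f (g i)) \<in> I \<rightarrow> carrier M'" using l(1) by auto
    ultimately show ?case using insert l(2) by (simp add: M.finsum_insert M'.finsum_insert)
  qed (simp_all add: linear_maps_zero[OF assms(1-3)] M.finsum_infinite M'.finsum_infinite)
qed

lemma preimage_submodule:
  assumes "module R M" "module R M'" "f \<in> linear_maps R M M'" "submodule H' R M'"
  shows "submodule {x \<in> carrier M. f x \<in> H'} R M"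
proof -
  interpret M: module R M by fact
  interpret M': module R M' by fact
  note l = linear_mapsD[OF assms(3)]
  have z: "\<zero>\<^bsub>M'\<^esub> \<in> H'"
    using M'.submoduleE[OF assms(4)] by (metis M'.r_neg subsetD all_not_in_conv)
  have m: "\<ominus>\<^bsub>M\<^esub> x = (\<ominus>\<^bsub>R\<^esub> \<one>\<^bsub>R\<^esub>) \<odot>\<^bsub>M\<^esub> x" if "x \<in> carrier M" for x
    using that by (simp add: M.smult_l_minus)
  show ?thesis
    by (rule M.submoduleI)
      (use M'.submoduleE[OF assms(4)] l z in \<open>auto simp: linear_maps_zero[OF assms(1-3)] m\<close>)
qed

lemma submodule_zero:
  assumes "module R M"
  shows "submodule {\<zero>\<^bsub>M\<^esub>} R M"
proof -
  interpret M: module R M by fact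
  show ?thesis by (rule M.submoduleI) auto
qed

lemma module_dual_module:
  assumes "module R M"
  shows "module R (dual_module R M)"
proof -
  interpret M: module R M by fact
  let ?D = "dual_module R M"
  have c: "f \<in> carrier ?D \<longleftrightarrow> f \<in> extensional (carrier M) \<and> (\<forall>x\<in>carrier M. f x \<in> carrier R) \<and>
     (\<forall>x\<in>carrier M. \<forall>y\<in>carrier M. f (x \<oplus>\<^bsub>M\<^esub> y) = f x \<oplus>\<^bsub>R\<^esub> f y) \<and>
     (\<forall>r\<in>carrier R. \<forall>x\<in>carrier M. f (r \<odot>\<^bsub>M\<^esub> x) = r \<otimes>\<^bsub>R\<^esub> f x)" for f
    by (auto simp: dual_module_def linear_maps_def ring_module_def PiE_def)
  have ops: "f \<oplus>\<^bsub>?D\<^esub> g = (\<lambda>x\<in>carrier M. f x \<oplus>\<^bsub>R\<^esub> g x)" "r \<odot>\<^bsub>?D\<^esub> f = (\<lambda>x\<in>carrier M. r \<otimes>\<^bsub>R\<^esub> f x)"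
    "\<zero>\<^bsub>?D\<^esub> = (\<lambda>x\<in>carrier M. \<zero>\<^bsub>R\<^esub>)" for f g r
    by (auto simp: dual_module_def)
  show ?thesis
    by (rule module_by_fields)
      (auto simp: c ops M.R.a_ac M.R.m_ac M.R.l_distr M.R.r_distr M.R.r_minus M.R.r_neg M.R.is_cring
        intro!: extensionalityI[of _ "carrier M"])
qed

lemma finsum_ring_module:
  assumes "cring R" "f \<in> A \<rightarrow> carrier R"
  shows "finsum (ring_module R) f A = finsum R f A"
proof -
  interpret cring R by fact
  interpret M: module R "ring_module R" by (rule module_ring_module[OF assms(1)])
  have [simp]: "carrier (ring_module R) = carrier R" "\<zero>\<^bsub>ring_module R\<^esub> = \<zero>\<^bsub>R\<^esub>"
    "x \<oplus>\<^bsub>ring_module R\<^esub> y = x \<oplus>\<^bsub>R\<^esub> y" for x y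
    by (simp_all add: ring_module_def)
  show ?thesis using assms(2)
  proof (induction A rule: infinite_finite_induct)
    case (insert a A)
    then have f: "f \<in> A \<rightarrow> carrier R" "f a \<in> carrier R" by auto
    show ?case
      using M.M.finsum_insert[OF insert(1,2), of f] finsum_insert[OF insert(1,2), of f] f insert.IH[OF f(1)]
      by simp
  qed (simp_all add: M.M.finsum_empty M.M.finsum_infinite finsum_infinite)
qed

lemma form_finsum:
  assumes M: "module R M" and f: "f \<in> linear_maps R M (ring_module R)"
    and "\<And>i. i \<in> I \<Longrightarrow> c i \<in> carrier R" "\<And>i. i \<in> I \<Longrightarrow> x i \<in> carrier M"
  shows "f (\<Oplus>\<^bsub>M\<^esub>i\<in>I. c i \<odot>\<^bsub>M\<^esub> x i) = (\<Oplus>\<^bsub>R\<^esub>i\<in>I. c i \<otimes>\<^bsub>R\<^esub> f (x i))"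
proof -
  interpret M: module R M by fact
  have R: "cring R" by (rule M.R.is_cring)
  have cl: "f (x i) \<in> carrier R" if "i \<in> I" for i
    using linear_mapsD(1)[OF f assms(4)[OF that]] by (simp add: ring_module_def)
  have "f (\<Oplus>\<^bsub>M\<^esub>i\<in>I. c i \<odot>\<^bsub>M\<^esub> x i) = finsum (ring_module R) (\<lambda>i. f (c i \<odot>\<^bsub>M\<^esub> x i)) I"
    by (rule linear_maps_finsum[OF M module_ring_module[OF R] f]) (simp add: assms)
  also have "\<dots> = (\<Oplus>\<^bsub>R\<^esub>i\<in>I. f (c i \<odot>\<^bsub>M\<^esub> x i))"
  proof (rule finsum_ring_module[OF R], rule funcsetI)
    fix i assume "i \<in> I"
    then show "f (c i \<odot>\<^bsub>M\<^esub> x i) \<in> carrier R"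
      using linear_mapsD(1)[OF f, of "c i \<odot>\<^bsub>M\<^esub> x i"] assms by (simp add: ring_module_def)
  qed
  also have "\<dots> = (\<Oplus>\<^bsub>R\<^esub>i\<in>I. c i \<otimes>\<^bsub>R\<^esub> f (x i))"
  proof (rule M.R.finsum_cong'[OF refl])
    fix i assume "i \<in> I"
    then show "f (c i \<odot>\<^bsub>M\<^esub> x i) = c i \<otimes>\<^bsub>R\<^esub> f (x i)"
      using linear_mapsD(3)[OF f assms(3) assms(4)] by (simp add: ring_module_def)
  qed (use cl assms(3) in auto)
  finally show ?thesis .
qed

lemma module_isos_inverse:
  assumes "module R M" "f \<in> module_isos R M M'"
  shows "(\<lambda>y\<in>carrier M'. inv_into (carrier M) f y) \<in> module_isos R M' M"
proof -
  interpret M: module R M by fact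
  let ?g = "\<lambda>y\<in>carrier M'. inv_into (carrier M) f y"
  have l: "f \<in> linear_maps R M M'" and b: "bij_betw f (carrier M) (carrier M')"
    using assms(2) by (auto simp: module_isos_def)
  note l = linear_mapsD[OF l]
  have g: "?g (f x) = x" if "x \<in> carrier M" for x
    using b l(1) that by (auto simp: bij_betw_def)
  have ex: "\<exists>x\<in>carrier M. f x = y" if "y \<in> carrier M'" for y
    using b that by (metis bij_betw_def image_iff)
  have "?g \<in> linear_maps R M' M"
  proof (rule linear_mapsI)
    fix x y assume "x \<in> carrier M'" "y \<in> carrier M'"
    then obtain x' y' where "x' \<in> carrier M" "f x' = x" "y' \<in> carrier M" "f y' = y" using ex by metis
    then show "?g (x \<oplus>\<^bsub>M'\<^esub> y) = ?g x \<oplus>\<^bsub>M\<^esub> ?g y"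
      using g l(2)[of x' y'] by (metis M.a_closed)
  next
    fix r x assume r: "r \<in> carrier R" and "x \<in> carrier M'"
    then obtain x' where "x' \<in> carrier M" "f x' = x" using ex by metis
    then show "?g (r \<odot>\<^bsub>M'\<^esub> x) = r \<odot>\<^bsub>M\<^esub> ?g x"
      using r g l(3)[of r x'] by (metis M.smult_closed)
  qed (use ex g in force)+
  moreover have "bij_betw ?g (carrier M') (carrier M)"
    using bij_betw_inv_into[OF b] by (auto simp: bij_betw_def inj_on_def)
  ultimately show ?thesis by (simp add: module_isos_def)
qed

subsection \<open>Quotients\<close>

locale quotient = module R M for R :: "('r, 'k) ring_scheme" and M :: "('r, 'a, 'l) module_scheme" and H +
  assumes sub: "submodule H R M"
begin

sublocale ab: abelian_subgroup H M
  by (rule abelian_subgroupI3)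
    (auto intro: AbelCoset.additive_subgroup.intro submodule.axioms(1)[OF sub] M.abelian_group_axioms)

lemma coset_eq_iff:
  assumes "x \<in> carrier M" "y \<in> carrier M"
  shows "H +>\<^bsub>M\<^esub> x = H +>\<^bsub>M\<^esub> y \<longleftrightarrow> x \<ominus>\<^bsub>M\<^esub> y \<in> H"
proof -
  have s: "H \<subseteq> carrier M" by (rule ab.a_subset)
  show ?thesis
    by (metis M.a_coset_add_inv1 M.a_coset_add_inv2 M.a_coset_join1 M.a_coset_join2
        M.add.inv_closed M.add.m_closed M.minus_eq ab.a_subgroup assms s)
qed

lemma carrier_quot: "carrier (quot_module M H) = (\<lambda>x. H +>\<^bsub>M\<^esub> x) ` carrier M"
  by (auto simp: quot_module_def A_RCOSETS_def')

lemma zero_quot: "\<zero>\<^bsub>quot_module M H\<^esub> = H +>\<^bsub>M\<^esub> \<zero>\<^bsub>M\<^esub>"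
  by (simp add: quot_module_def ab.a_subset)

lemma add_quot:
  assumes "x \<in> carrier M" "y \<in> carrier M"
  shows "(H +>\<^bsub>M\<^esub> x) \<oplus>\<^bsub>quot_module M H\<^esub> (H +>\<^bsub>M\<^esub> y) = H +>\<^bsub>M\<^esub> (x \<oplus>\<^bsub>M\<^esub> y)"
  using ab.a_rcos_sum[OF assms] by (simp add: quot_module_def)

lemma in_coset:
  assumes "x \<in> carrier M" "y \<in> H +>\<^bsub>M\<^esub> x"
  shows "y \<in> carrier M" "y \<ominus>\<^bsub>M\<^esub> x \<in> H"
proof -
  show y: "y \<in> carrier M" using assms ab.a_subset M.a_r_coset_subset_G by blast
  show "y \<ominus>\<^bsub>M\<^esub> x \<in> H"
    using coset_eq_iff[OF y assms(1)] M.a_repr_independence[OF assms(2,1) ab.a_subgroup] by simp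
qed

text \<open>
  A map that is constant on a coset modulo \<open>K\<close> turns the union over the coset in the definition of
  an induced map into a single coset.
\<close>

lemma UN_coset:
  assumes N: "quotient R N K" and x: "x \<in> carrier M"
    and f: "\<And>y. y \<in> carrier M \<Longrightarrow> f y \<in> carrier N"
    and c: "\<And>y. y \<in> carrier M \<Longrightarrow> y \<ominus>\<^bsub>M\<^esub> x \<in> H \<Longrightarrow> f y \<ominus>\<^bsub>N\<^esub> f x \<in> K"
  shows "(\<Union>y\<in>H +>\<^bsub>M\<^esub> x. K +>\<^bsub>N\<^esub> f y) = K +>\<^bsub>N\<^esub> f x"
proof -
  interpret N: quotient R N K by fact
  have "K +>\<^bsub>N\<^esub> f y = K +>\<^bsub>N\<^esub> f x" if "y \<in> H +>\<^bsub>M\<^esub> x" for y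
    using in_coset[OF x that] c f x N.coset_eq_iff by blast
  moreover have "x \<in> H +>\<^bsub>M\<^esub> x" using ab.a_rcos_self x by blast
  ultimately show ?thesis by blast
qed

lemma smult_diff:
  assumes "r \<in> carrier R" "x \<in> carrier M" "y \<in> carrier M"
  shows "r \<odot>\<^bsub>M\<^esub> y \<ominus>\<^bsub>M\<^esub> r \<odot>\<^bsub>M\<^esub> x = r \<odot>\<^bsub>M\<^esub> (y \<ominus>\<^bsub>M\<^esub> x)"
  using assms by (simp add: M.minus_eq smult_r_distr smult_r_minus)

lemma smult_quot:
  assumes "r \<in> carrier R" "x \<in> carrier M"
  shows "r \<odot>\<^bsub>quot_module M H\<^esub> (H +>\<^bsub>M\<^esub> x) = H +>\<^bsub>M\<^esub> (r \<odot>\<^bsub>M\<^esub> x)"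
  unfolding quot_module_def module.simps
  by (rule UN_coset[OF quotient_axioms assms(2)])
    (use assms submoduleE(4)[OF sub] smult_diff in auto)

lemma module_quot: "module R (quot_module M H)"
proof (rule module_by_fields)
  show "\<And>x. x \<in> carrier (quot_module M H) \<Longrightarrow>
         (\<ominus>\<^bsub>R\<^esub> \<one>\<^bsub>R\<^esub>) \<odot>\<^bsub>quot_module M H\<^esub> x \<oplus>\<^bsub>quot_module M H\<^esub> x = \<zero>\<^bsub>quot_module M H\<^esub>"
    by (auto simp: carrier_quot zero_quot add_quot smult_quot smult_l_minus M.l_neg)
qed (auto simp: carrier_quot zero_quot add_quot smult_quot M.a_ac smult_l_distr smult_r_distr
      smult_assoc1 R.is_cring)

lemma proj_linear: "(\<lambda>x\<in>carrier M. H +>\<^bsub>M\<^esub> x) \<in> linear_maps R M (quot_module M H)"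
  by (rule restrict_linear_mapsI) (auto simp: module_axioms carrier_quot add_quot smult_quot)

lemma induced_map_coset:
  assumes "quotient R N K" and x: "x \<in> carrier M"
    and "\<And>x. x \<in> carrier M \<Longrightarrow> f x \<in> carrier N"
    and add: "\<And>x y. x \<in> carrier M \<Longrightarrow> y \<in> carrier M \<Longrightarrow> f (x \<oplus>\<^bsub>M\<^esub> y) = f x \<oplus>\<^bsub>N\<^esub> f y"
    and K: "\<And>x. x \<in> H \<Longrightarrow> f x \<in> K"
  shows "induced_map M H N K f (H +>\<^bsub>M\<^esub> x) = K +>\<^bsub>N\<^esub> f x"
proof -
  interpret N: quotient R N K by fact
  have "f y \<ominus>\<^bsub>N\<^esub> f x \<in> K" if y: "y \<in> carrier M" "y \<ominus>\<^bsub>M\<^esub> x \<in> H" for y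
  proof -
    have "y = (y \<ominus>\<^bsub>M\<^esub> x) \<oplus>\<^bsub>M\<^esub> x" using x y by (simp add: M.minus_eq M.a_assoc M.l_neg)
    then have "f y = f (y \<ominus>\<^bsub>M\<^esub> x) \<oplus>\<^bsub>N\<^esub> f x" using add x y by (metis M.minus_closed)
    then have "f y \<ominus>\<^bsub>N\<^esub> f x = f (y \<ominus>\<^bsub>M\<^esub> x)" using assms(3) x y
      by (simp add: N.M.minus_eq N.M.a_assoc N.M.r_neg)
    then show ?thesis using K y by simp
  qed
  moreover have "H +>\<^bsub>M\<^esub> x \<in> carrier (quot_module M H)" using x carrier_quot by blast
  ultimately show ?thesis
    unfolding induced_map_def using UN_coset[OF assms(1) x] assms(3) by simp
qed

lemma induced_map_linear:
  assumes "quotient R N K"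
    and f: "\<And>x. x \<in> carrier M \<Longrightarrow> f x \<in> carrier N"
    and add: "\<And>x y. x \<in> carrier M \<Longrightarrow> y \<in> carrier M \<Longrightarrow> f (x \<oplus>\<^bsub>M\<^esub> y) = f x \<oplus>\<^bsub>N\<^esub> f y"
    and smult: "\<And>r x. r \<in> carrier R \<Longrightarrow> x \<in> carrier M \<Longrightarrow> f (r \<odot>\<^bsub>M\<^esub> x) = r \<odot>\<^bsub>N\<^esub> f x"
    and K: "\<And>x. x \<in> H \<Longrightarrow> f x \<in> K"
  shows "induced_map M H N K f \<in> linear_maps R (quot_module M H) (quot_module N K)"
proof -
  interpret N: quotient R N K by fact
  note i = induced_map_coset[OF assms(1) _ f add K]
  show ?thesis
  proof (rule linear_mapsI)
    show "induced_map M H N K f \<in> extensional (carrier (quot_module M H))"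
      by (simp add: induced_map_def)
  qed (auto simp: carrier_quot N.carrier_quot i add_quot smult_quot N.add_quot N.smult_quot f add smult)
qed

end

text \<open>
  In cohomological degree \<open>0\<close> and in top homological degree one divides by the zero submodule; there the
  cosets are singletons and the induced map is the given map in disguise.
\<close>

lemma induced_map_zero_iso_iff:
  assumes M: "module R M" and N: "module R N"
    and f: "\<And>x. x \<in> carrier M \<Longrightarrow> f x \<in> carrier N"
    and add: "\<And>x y. x \<in> carrier M \<Longrightarrow> y \<in> carrier M \<Longrightarrow> f (x \<oplus>\<^bsub>M\<^esub> y) = f x \<oplus>\<^bsub>N\<^esub> f y"
    and smult: "\<And>r x. r \<in> carrier R \<Longrightarrow> x \<in> carrier M \<Longrightarrow> f (r \<odot>\<^bsub>M\<^esub> x) = r \<odot>\<^bsub>N\<^esub> f x"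
  shows "induced_map M {\<zero>\<^bsub>M\<^esub>} N {\<zero>\<^bsub>N\<^esub>} f
      \<in> module_isos R (quot_module M {\<zero>\<^bsub>M\<^esub>}) (quot_module N {\<zero>\<^bsub>N\<^esub>})
    \<longleftrightarrow> bij_betw f (carrier M) (carrier N)"
proof -
  interpret M: quotient R M "{\<zero>\<^bsub>M\<^esub>}"
    using M submodule_zero[OF M] by (simp add: quotient_def quotient_axioms_def)
  interpret N: quotient R N "{\<zero>\<^bsub>N\<^esub>}"
    using N submodule_zero[OF N] by (simp add: quotient_def quotient_axioms_def)
  have "(\<lambda>x\<in>carrier M. f x) \<in> linear_maps R M N"
    using restrict_linear_mapsI[OF M f add smult] by blast
  then have z: "f \<zero>\<^bsub>M\<^esub> = \<zero>\<^bsub>N\<^esub>"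
    using linear_maps_zero[OF M N] by fastforce
  let ?g = "induced_map M {\<zero>\<^bsub>M\<^esub>} N {\<zero>\<^bsub>N\<^esub>} f"
  have cM: "{\<zero>\<^bsub>M\<^esub>} +>\<^bsub>M\<^esub> x = {x}" if "x \<in> carrier M" for x
    using that by (simp add: a_r_coset_def')
  have cN: "{\<zero>\<^bsub>N\<^esub>} +>\<^bsub>N\<^esub> x = {x}" if "x \<in> carrier N" for x
    using that by (simp add: a_r_coset_def')
  have i: "?g {x} = {f x}" if "x \<in> carrier M" for x
    using M.induced_map_coset[OF N.quotient_axioms that f add] z cM cN that f by simp
  have l: "?g \<in> linear_maps R (quot_module M {\<zero>\<^bsub>M\<^esub>}) (quot_module N {\<zero>\<^bsub>N\<^esub>})"
    by (rule M.induced_map_linear[OF N.quotient_axioms f add smult]) (simp_all add: z)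
  have qM: "carrier (quot_module M {\<zero>\<^bsub>M\<^esub>}) = (\<lambda>x. {x}) ` carrier M"
    unfolding M.carrier_quot by (rule image_cong) (simp_all add: cM)
  have qN: "carrier (quot_module N {\<zero>\<^bsub>N\<^esub>}) = (\<lambda>x. {x}) ` carrier N"
    unfolding N.carrier_quot by (rule image_cong) (simp_all add: cN)
  have "bij_betw ?g ((\<lambda>x. {x}) ` carrier M) ((\<lambda>x. {x}) ` carrier N) \<longleftrightarrow>
      bij_betw f (carrier M) (carrier N)"
  proof -
    have "inj_on ?g ((\<lambda>x. {x}) ` carrier M) \<longleftrightarrow> inj_on f (carrier M)"
      by (auto simp: inj_on_def i)
    moreover have "?g ` (\<lambda>x. {x}) ` carrier M = (\<lambda>x. {x}) ` f ` carrier M"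
      by (auto simp: i image_iff)
    moreover have "(\<lambda>x. {x}) ` f ` carrier M = (\<lambda>x. {x}) ` carrier N \<longleftrightarrow> f ` carrier M = carrier N"
      by (rule inj_image_eq_iff) simp
    ultimately show ?thesis by (simp add: bij_betw_def)
  qed
  with l show ?thesis by (simp add: module_isos_def qM qN)
qed

lemma linear_map_singletons_iso:
  assumes "f \<in> linear_maps R M N" "carrier M = {x}" "carrier N = {y}"
  shows "f \<in> module_isos R M N"
  using assms linear_mapsD(1)[OF assms(1)] by (auto simp: module_isos_def bij_betw_def)

section \<open>Extension of scalars\<close>

lemma additive_subgroup_hull: "additive_subgroup (additive_subgroup hull S)"
  by (rule hull_in) (auto simp: additive_subgroup_def)

lemma additive_subgroup_add:
  assumes "additive_subgroup A" "a \<in> A" "b \<in> A"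
  shows "a + b \<in> A"
proof -
  have "0 - b \<in> A" using assms by (auto simp: additive_subgroup_def)
  then have "a - (0 - b) \<in> A" using assms by (metis additive_subgroup_def)
  then show ?thesis by simp
qed

lemma additive_subgroup_of_int:
  fixes g :: "'i \<Rightarrow> real"
  assumes "additive_subgroup A" "g \<in> A"
  shows "(\<lambda>i. of_int k * g i) \<in> A"
proof -
  have nat: "(\<lambda>i. of_nat m * g i) \<in> A" for m
  proof (induction m)
    case 0
    then show ?case using assms(1) by (simp add: additive_subgroup_def zero_fun_def)
  next
    case (Suc m)
    have "(\<lambda>i. of_nat (Suc m) * g i) = (\<lambda>i. of_nat m * g i) + g"
      by (auto simp: fun_eq_iff algebra_simps)
    then show ?case using additive_subgroup_add[OF assms(1) Suc assms(2)] by simp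
  qed
  show ?thesis
  proof (cases "k \<ge> 0")
    case True
    then show ?thesis using nat[of "nat k"] by simp
  next
    case False
    then have "(\<lambda>i. of_int k * g i) = 0 - (\<lambda>i. of_nat (nat (- k)) * g i)"
      by (auto simp: fun_eq_iff)
    then show ?thesis using assms(1) nat[of "nat (- k)"] by (metis additive_subgroup_def)
  qed
qed

lemma hull_singleton:
  fixes g :: "'i \<Rightarrow> real"
  shows "additive_subgroup hull {g} = range (\<lambda>k::int. \<lambda>i. of_int k * g i)" (is "?L = ?Z")
proof (rule hull_unique)
  have "g = (\<lambda>i. of_int 1 * g i)" by simp
  then show "{g} \<subseteq> ?Z" by blast
  have "(\<lambda>i. of_int 0 * g i) \<in> ?Z" by blast
  then have "0 \<in> ?Z" by (simp add: zero_fun_def)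
  moreover have "(\<lambda>i. of_int k * g i) - (\<lambda>i. of_int l * g i) = (\<lambda>i. of_int (k - l) * g i)" for k l
    by (auto simp: fun_eq_iff algebra_simps)
  ultimately show "additive_subgroup ?Z"
    unfolding additive_subgroup_def by (auto simp del: of_int_diff)
next
  fix T assume "{g} \<subseteq> T" "additive_subgroup T"
  then show "?Z \<subseteq> T" using additive_subgroup_of_int[of T g] by blast
qed

lemma free_module_simps:
  "f \<in> carrier (free_module R A) \<longleftrightarrow> (\<forall>a. f a \<in> carrier R) \<and> (\<forall>a. a \<notin> A \<longrightarrow> f a = \<zero>\<^bsub>R\<^esub>) \<and>
     finite {a. f a \<noteq> \<zero>\<^bsub>R\<^esub>}"
  "f \<oplus>\<^bsub>free_module R A\<^esub> g = (\<lambda>a. f a \<oplus>\<^bsub>R\<^esub> g a)"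
  "r \<odot>\<^bsub>free_module R A\<^esub> f = (\<lambda>a. r \<otimes>\<^bsub>R\<^esub> f a)"
  "\<zero>\<^bsub>free_module R A\<^esub> = (\<lambda>a. \<zero>\<^bsub>R\<^esub>)"
  by (auto simp: free_module_def)

lemma module_free_module:
  assumes "cring R"
  shows "module R (free_module R A)"
proof -
  interpret cring R by fact
  have fin: "finite {a. f a \<oplus>\<^bsub>R\<^esub> g a \<noteq> \<zero>\<^bsub>R\<^esub>}"
    if "finite {a. f a \<noteq> \<zero>\<^bsub>R\<^esub>}" "finite {a. g a \<noteq> \<zero>\<^bsub>R\<^esub>}" for f g :: "'c \<Rightarrow> 'a"
    by (rule finite_subset[OF _ finite_UnI[OF that]]) auto
  have fin': "finite {a. r \<otimes>\<^bsub>R\<^esub> f a \<noteq> \<zero>\<^bsub>R\<^esub>}"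
    if "finite {a. f a \<noteq> \<zero>\<^bsub>R\<^esub>}" "r \<in> carrier R" for f :: "'c \<Rightarrow> 'a" and r
    by (rule finite_subset[OF _ that(1)]) (use that(2) in auto)
  show ?thesis
    by (rule module_by_fields)
      (auto simp: free_module_simps fin fin' assms a_ac m_ac l_distr r_distr
        r_minus r_neg)
qed

lemma symb_in_free_module: "cring R \<Longrightarrow> a \<in> A \<Longrightarrow> symb R a \<in> carrier (free_module R A)"
proof -
  assume "cring R" "a \<in> A"
  interpret cring R by fact
  have "finite {x. symb R a x \<noteq> \<zero>\<^bsub>R\<^esub>}"
    by (rule finite_subset[of _ "{a}"]) (auto simp: symb_def)
  then show ?thesis using \<open>a \<in> A\<close> by (auto simp: free_module_simps symb_def)
qed

text \<open>
  A finitely supported function is a linear combination of symbols, by induction on its support.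
\<close>

lemma free_module_span:
  assumes R: "cring R" and W: "submodule W R (free_module R A)"
    and "\<And>a. a \<in> A \<Longrightarrow> symb R a \<in> W"
  shows "carrier (free_module R A) \<subseteq> W"
proof
  interpret cring R by fact
  interpret F: module R "free_module R A" by (rule module_free_module[OF R])
  note W = F.submoduleE[OF W]
  have *: "f \<in> W" if "finite S" "f \<in> carrier (free_module R A)" "{a. f a \<noteq> \<zero>\<^bsub>R\<^esub>} \<subseteq> S" for S f
    using that
  proof (induction S arbitrary: f)
    case empty
    then have "f = \<zero>\<^bsub>free_module R A\<^esub>" by (auto simp: free_module_simps)
    then show ?case using W(1,2,5,6) F.M.r_neg by (metis all_not_in_conv subsetD)
  next
    case (insert b S)
    let ?g = "f(b := \<zero>\<^bsub>R\<^esub>)"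
    have f: "\<And>a. f a \<in> carrier R" "\<And>a. a \<notin> A \<Longrightarrow> f a = \<zero>\<^bsub>R\<^esub>"
      using insert.prems(1) by (auto simp: free_module_simps)
    have "finite {a. ?g a \<noteq> \<zero>\<^bsub>R\<^esub>}"
      by (rule finite_subset[OF _ insert.hyps(1)]) (use insert.prems(2) in auto)
    then have "?g \<in> carrier (free_module R A)" using f by (auto simp: free_module_simps)
    moreover have "{a. ?g a \<noteq> \<zero>\<^bsub>R\<^esub>} \<subseteq> S" using insert.prems(2) by auto
    ultimately have g: "?g \<in> W" by (rule insert.IH)
    show ?case
    proof (cases "b \<in> A")
      case True
      then have "f b \<odot>\<^bsub>free_module R A\<^esub> symb R b \<in> W" using assms(3) W(4) f(1) by blast
      then have "?g \<oplus>\<^bsub>free_module R A\<^esub> (f b \<odot>\<^bsub>free_module R A\<^esub> symb R b) \<in> W" using g W(5) by blast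
      moreover have "?g \<oplus>\<^bsub>free_module R A\<^esub> (f b \<odot>\<^bsub>free_module R A\<^esub> symb R b) = f"
        by (auto simp: free_module_simps symb_def fun_eq_iff f(1))
      ultimately show ?thesis by simp
    next
      case False
      then have "?g = f" using f(2) by auto
      then show ?thesis using g by simp
    qed
  qed
  fix f assume "f \<in> carrier (free_module R A)"
  then show "f \<in> W" using *[of "{a. f a \<noteq> \<zero>\<^bsub>R\<^esub>}" f] by (simp add: free_module_simps)
qed

locale scalar_extension = cring R for R :: "('r, 'k) ring_scheme" and A :: "'a::ab_group_add set" +
  assumes subgroup: "additive_subgroup A"
begin

abbreviation "Free \<equiv> free_module R A"
abbreviation "Rel \<equiv> tensor_rel R A"
abbreviation "pure \<equiv> pure_tensor R A"

sublocale Free: module R Free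
  by (rule module_free_module) (rule is_cring)

lemma symb_closed: "a \<in> A \<Longrightarrow> symb R a \<in> carrier Free"
  using symb_in_free_module is_cring .

lemma Rel_gen: "a \<in> A \<Longrightarrow> b \<in> A \<Longrightarrow> symb R (a + b) \<ominus>\<^bsub>Free\<^esub> symb R a \<ominus>\<^bsub>Free\<^esub> symb R b \<in> Rel"
  unfolding tensor_rel_def by (rule subsetD[OF hull_subset]) blast

lemma Rel_minimal:
  assumes "submodule W R Free"
    and "\<And>a b. a \<in> A \<Longrightarrow> b \<in> A \<Longrightarrow> symb R (a + b) \<ominus>\<^bsub>Free\<^esub> symb R a \<ominus>\<^bsub>Free\<^esub> symb R b \<in> W"
  shows "Rel \<subseteq> W"
  unfolding tensor_rel_def by (rule hull_minimal) (use assms in auto)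

lemma submodule_Rel: "submodule Rel R Free"
proof (rule Free.submoduleI)
  show "Rel \<subseteq> carrier Free"
    by (rule Rel_minimal)
      (auto intro!: Free.M.minus_closed symb_closed additive_subgroup_add[OF subgroup]
        Free.carrier_is_submodule)
  have z: "\<zero>\<^bsub>Free\<^esub> \<in> W" if "submodule W R Free" for W
    using Free.submoduleE[OF that] Free.M.r_neg by (metis all_not_in_conv subsetD)
  show "\<zero>\<^bsub>Free\<^esub> \<in> Rel"
    unfolding tensor_rel_def hull_def by (auto intro: z)
qed (auto simp: tensor_rel_def hull_def dest: Free.submoduleE)

sublocale quotient R Free Rel
  by (simp add: quotient_def quotient_axioms_def submodule_Rel Free.module_axioms)

sublocale T: module R "tensor R A"
  using module_quot by (simp add: tensor_def)

lemma pure_closed: "a \<in> A \<Longrightarrow> pure a \<in> carrier (tensor R A)"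
  by (auto simp: tensor_def carrier_quot pure_tensor_def symb_closed)

lemma pure_add:
  assumes "a \<in> A" "b \<in> A"
  shows "pure (a + b) = pure a \<oplus>\<^bsub>tensor R A\<^esub> pure b"
proof -
  have c: "symb R (a + b) \<in> carrier Free" "symb R a \<in> carrier Free" "symb R b \<in> carrier Free"
    using assms symb_closed additive_subgroup_add[OF subgroup] by auto
  then have "symb R (a + b) \<ominus>\<^bsub>Free\<^esub> (symb R a \<oplus>\<^bsub>Free\<^esub> symb R b)
      = symb R (a + b) \<ominus>\<^bsub>Free\<^esub> symb R a \<ominus>\<^bsub>Free\<^esub> symb R b"
    by (simp add: Free.M.minus_eq Free.M.minus_add Free.M.a_assoc)
  then have "symb R (a + b) \<ominus>\<^bsub>Free\<^esub> (symb R a \<oplus>\<^bsub>Free\<^esub> symb R b) \<in> Rel"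
    using Rel_gen[OF assms] by simp
  then have "Rel +>\<^bsub>Free\<^esub> symb R (a + b) = Rel +>\<^bsub>Free\<^esub> (symb R a \<oplus>\<^bsub>Free\<^esub> symb R b)"
    using coset_eq_iff c by blast
  then show ?thesis using c by (simp add: pure_tensor_def tensor_def add_quot)
qed

lemma pure_zero: "pure 0 = \<zero>\<^bsub>tensor R A\<^esub>"
proof -
  have z: "0 \<in> A" using subgroup by (simp add: additive_subgroup_def)
  show ?thesis
    using pure_add[OF z z] pure_closed[OF z] by simp
qed

lemma pure_diff:
  assumes "a \<in> A" "b \<in> A"
  shows "pure (a - b) = pure a \<ominus>\<^bsub>tensor R A\<^esub> pure b"
proof -
  have "a - b \<in> A" using assms subgroup by (simp add: additive_subgroup_def)
  then show ?thesis
    using pure_add[of "a - b" b] assms pure_closed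
    by (simp add: T.M.minus_eq T.M.a_assoc T.M.r_neg)
qed

text \<open>
  The elements \<open>a \<otimes> 1\<close> with \<open>a\<close> in a generating set of the group generate the module: those
  \<open>a\<close> for which \<open>a \<otimes> 1\<close> lies in a given submodule form a subgroup.
\<close>

lemma tensor_span:
  assumes W: "submodule W R (tensor R A)" and "A = additive_subgroup hull S"
    and "\<And>a. a \<in> S \<Longrightarrow> pure a \<in> W"
  shows "carrier (tensor R A) \<subseteq> W"
proof -
  note E = T.submoduleE[OF W]
  have z: "\<zero>\<^bsub>tensor R A\<^esub> \<in> W"
    using E T.M.r_neg by (metis all_not_in_conv subsetD)
  have "additive_subgroup {a \<in> A. pure a \<in> W}"
    using subgroup E(5,6) by (auto simp: additive_subgroup_def pure_zero z pure_diff T.M.minus_eq)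
  moreover have "S \<subseteq> {a \<in> A. pure a \<in> W}" using assms(2,3) by (auto intro: hull_inc)
  ultimately have "A \<subseteq> {a \<in> A. pure a \<in> W}" unfolding assms(2)
    by (rule hull_minimal[rotated])
  then have p: "pure a \<in> W" if "a \<in> A" for a using that by blast
  let ?p = "\<lambda>x\<in>carrier Free. Rel +>\<^bsub>Free\<^esub> x"
  have "submodule {x \<in> carrier Free. ?p x \<in> W} R Free"
    by (rule preimage_submodule[OF Free.module_axioms T.module_axioms proj_linear[folded tensor_def] W])
  then have "carrier Free \<subseteq> {x \<in> carrier Free. ?p x \<in> W}"
    by (rule free_module_span[OF is_cring]) (use p symb_closed in \<open>auto simp: pure_tensor_def\<close>)
  then show ?thesis by (auto simp: tensor_def carrier_quot)
qed

lemma linear_maps_eqI: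
  assumes N: "module R N" and f: "f \<in> linear_maps R (tensor R A) N" and g: "g \<in> linear_maps R (tensor R A) N"
    and "A = additive_subgroup hull S" "\<And>a. a \<in> S \<Longrightarrow> f (pure a) = g (pure a)"
  shows "f = g"
proof -
  interpret N: module R N by fact
  let ?W = "{x \<in> carrier (tensor R A). f x = g x}"
  have neg: "\<ominus>\<^bsub>tensor R A\<^esub> x = (\<ominus>\<^bsub>R\<^esub> \<one>\<^bsub>R\<^esub>) \<odot>\<^bsub>tensor R A\<^esub> x" if "x \<in> carrier (tensor R A)" for x
    using that by (simp add: T.smult_l_minus)
  have "submodule ?W R (tensor R A)"
    by (rule T.submoduleI)
      (auto simp: linear_mapsD(1-3)[OF f] linear_mapsD(1-3)[OF g] neg
        linear_maps_zero[OF T.module_axioms N f] linear_maps_zero[OF T.module_axioms N g])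
  moreover have "S \<subseteq> A" unfolding assms(4) by (rule hull_subset)
  ultimately have "carrier (tensor R A) \<subseteq> ?W"
    by (intro tensor_span[OF _ assms(4)]) (use assms(5) pure_closed in auto)
  then show ?thesis
    using linear_mapsD(4)[OF f] linear_mapsD(4)[OF g] by (auto intro!: extensionalityI)
qed

text \<open>
  An additive map \<open>c\<close> to the integers gives the linear form on the free module that sends the
  symbol of \<open>a\<close> to \<open>c a\<close>. It vanishes on the relations. If \<open>r (g \<otimes> 1) = 0\<close>, then \<open>r\<close> times the symbol
  of \<open>g\<close> is a relation, and the form takes the value \<open>r c(g) = r\<close> on it.
\<close>

lemma pure_torsion_free:
  fixes c :: "'a \<Rightarrow> int"
  assumes c: "\<And>a b. a \<in> A \<Longrightarrow> b \<in> A \<Longrightarrow> c (a + b) = c a + c b"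
    and g: "g \<in> A" "c g = 1" and r: "r \<in> carrier R" "r \<odot>\<^bsub>tensor R A\<^esub> pure g = \<zero>\<^bsub>tensor R A\<^esub>"
  shows "r = \<zero>\<^bsub>R\<^esub>"
proof -
  define k where "k a = add_pow R (c a) \<one>\<^bsub>R\<^esub>" for a
  have k: "k a \<in> carrier R" for a by (simp add: k_def)
  have k_add: "k (a + b) = k a \<oplus>\<^bsub>R\<^esub> k b" if "a \<in> A" "b \<in> A" for a b
    using c[OF that] by (simp add: k_def add.int_pow_mult)
  define \<phi> where "\<phi> f = (\<Oplus>\<^bsub>R\<^esub>a\<in>{a. f a \<noteq> \<zero>\<^bsub>R\<^esub>}. f a \<otimes>\<^bsub>R\<^esub> k a)" for f :: "'a \<Rightarrow> 'r"
  have \<phi>_eq: "\<phi> f = (\<Oplus>\<^bsub>R\<^esub>a\<in>S. f a \<otimes>\<^bsub>R\<^esub> k a)"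
    if "f \<in> carrier Free" "finite S" "{a. f a \<noteq> \<zero>\<^bsub>R\<^esub>} \<subseteq> S" for f S
    unfolding \<phi>_def
    by (rule add.finprod_mono_neutral_cong_left)
      (use that k in \<open>auto simp: free_module_simps\<close>)
  have \<phi>: "\<phi> f \<in> carrier R" if "f \<in> carrier Free" for f
    unfolding \<phi>_def using that k by (intro finsum_closed) (auto simp: free_module_simps)
  have \<phi>_symb: "\<phi> (symb R a) = k a" if "a \<in> A" for a
  proof -
    have "{x. symb R a x \<noteq> \<zero>\<^bsub>R\<^esub>} \<subseteq> {a}" by (auto simp: symb_def)
    then show ?thesis using \<phi>_eq[OF symb_closed[OF that], of "{a}"] k[of a] by (simp add: symb_def)
  qed
  have "(\<lambda>f\<in>carrier Free. \<phi> f) \<in> linear_maps R Free (ring_module R)"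
  proof (rule restrict_linear_mapsI[OF Free.module_axioms])
    fix f h assume f: "f \<in> carrier Free" and h: "h \<in> carrier Free"
    let ?S = "{a. f a \<noteq> \<zero>\<^bsub>R\<^esub>} \<union> {a. h a \<noteq> \<zero>\<^bsub>R\<^esub>}"
    have fin: "finite ?S" using f h by (simp add: free_module_simps)
    have cl: "f a \<in> carrier R" "h a \<in> carrier R" for a using f h by (auto simp: free_module_simps)
    have "\<phi> (f \<oplus>\<^bsub>Free\<^esub> h) = (\<Oplus>\<^bsub>R\<^esub>a\<in>?S. (f \<oplus>\<^bsub>Free\<^esub> h) a \<otimes>\<^bsub>R\<^esub> k a)"
      by (rule \<phi>_eq[OF Free.M.a_closed[OF f h] fin]) (auto simp: free_module_simps(2))
    also have "\<dots> = (\<Oplus>\<^bsub>R\<^esub>a\<in>?S. f a \<otimes>\<^bsub>R\<^esub> k a \<oplus>\<^bsub>R\<^esub> h a \<otimes>\<^bsub>R\<^esub> k a)"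
      by (rule finsum_cong') (auto simp: free_module_simps(2) cl k l_distr)
    also have "\<dots> = (\<Oplus>\<^bsub>R\<^esub>a\<in>?S. f a \<otimes>\<^bsub>R\<^esub> k a) \<oplus>\<^bsub>R\<^esub> (\<Oplus>\<^bsub>R\<^esub>a\<in>?S. h a \<otimes>\<^bsub>R\<^esub> k a)"
      by (rule finsum_addf) (auto simp: cl k)
    also have "\<dots> = \<phi> f \<oplus>\<^bsub>R\<^esub> \<phi> h" using f h fin by (simp add: \<phi>_eq[of _ ?S])
    finally show "\<phi> (f \<oplus>\<^bsub>Free\<^esub> h) = \<phi> f \<oplus>\<^bsub>ring_module R\<^esub> \<phi> h" by (simp add: ring_module_def)
  next
    fix s f assume s: "s \<in> carrier R" and f: "f \<in> carrier Free"
    let ?S = "{a. f a \<noteq> \<zero>\<^bsub>R\<^esub>}"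
    have fin: "finite ?S" using f by (simp add: free_module_simps)
    have cl: "f a \<in> carrier R" for a using f by (auto simp: free_module_simps)
    have "\<phi> (s \<odot>\<^bsub>Free\<^esub> f) = (\<Oplus>\<^bsub>R\<^esub>a\<in>?S. (s \<odot>\<^bsub>Free\<^esub> f) a \<otimes>\<^bsub>R\<^esub> k a)"
      by (rule \<phi>_eq[OF Free.smult_closed[OF s f] fin]) (auto simp: free_module_simps(3) s)
    also have "\<dots> = (\<Oplus>\<^bsub>R\<^esub>a\<in>?S. s \<otimes>\<^bsub>R\<^esub> (f a \<otimes>\<^bsub>R\<^esub> k a))"
      by (rule finsum_cong') (auto simp: free_module_simps(3) cl k s m_assoc)
    also have "\<dots> = s \<otimes>\<^bsub>R\<^esub> \<phi> f" unfolding \<phi>_def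
      by (rule finsum_rdistr[symmetric]) (auto simp: fin s cl k)
    finally show "\<phi> (s \<odot>\<^bsub>Free\<^esub> f) = s \<odot>\<^bsub>ring_module R\<^esub> \<phi> f" by (simp add: ring_module_def)
  qed (simp add: \<phi> ring_module_def)
  note lin = this
  have R: "module R (ring_module R)" by (rule module_ring_module) (rule is_cring)
  let ?W = "{f \<in> carrier Free. (\<lambda>f\<in>carrier Free. \<phi> f) f \<in> {\<zero>\<^bsub>ring_module R\<^esub>}}"
  have W: "submodule ?W R Free"
    by (rule preimage_submodule[OF Free.module_axioms R lin submodule_zero[OF R]])
  have "Rel \<subseteq> ?W"
  proof (rule Rel_minimal[OF W])
    fix a b assume ab: "a \<in> A" "b \<in> A"
    then have cl: "symb R (a + b) \<in> carrier Free" "symb R a \<in> carrier Free" "symb R b \<in> carrier Free"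
      using symb_closed additive_subgroup_add[OF subgroup] by auto
    let ?x = "symb R (a + b) \<ominus>\<^bsub>Free\<^esub> symb R a \<ominus>\<^bsub>Free\<^esub> symb R b"
    have x: "?x \<in> carrier Free" using cl by simp
    have "?x \<oplus>\<^bsub>Free\<^esub> (symb R a \<oplus>\<^bsub>Free\<^esub> symb R b) = symb R (a + b)"
      using cl by (simp add: Free.M.minus_eq Free.M.a_ac Free.M.r_neg Free.M.r_neg1 Free.M.r_neg2)
    then have "\<phi> (symb R (a + b)) = \<phi> ?x \<oplus>\<^bsub>R\<^esub> (\<phi> (symb R a) \<oplus>\<^bsub>R\<^esub> \<phi> (symb R b))"
      using linear_mapsD(2)[OF lin] x cl
      by (metis (no_types, lifting) Free.M.a_closed restrict_apply' ring_module_def ring_record_simps(12))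
    then have "k a \<oplus>\<^bsub>R\<^esub> k b = \<phi> ?x \<oplus>\<^bsub>R\<^esub> (k a \<oplus>\<^bsub>R\<^esub> k b)"
      using ab by (simp add: \<phi>_symb k_add additive_subgroup_add[OF subgroup])
    then have "\<phi> ?x = \<zero>\<^bsub>R\<^esub>" using k \<phi>[OF x] by simp
    then show "?x \<in> ?W" using x by (simp add: ring_module_def)
  qed
  moreover have "r \<odot>\<^bsub>Free\<^esub> symb R g \<in> Rel"
  proof -
    have cl: "r \<odot>\<^bsub>Free\<^esub> symb R g \<in> carrier Free" using g r symb_closed by simp
    have "Rel +>\<^bsub>Free\<^esub> (r \<odot>\<^bsub>Free\<^esub> symb R g) = Rel"
      using r g symb_closed ab.a_subset by (simp add: tensor_def pure_tensor_def smult_quot zero_quot)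
    then show ?thesis using Free.M.a_coset_join1 cl ab.a_subgroup by blast
  qed
  ultimately have "\<phi> (r \<odot>\<^bsub>Free\<^esub> symb R g) = \<zero>\<^bsub>R\<^esub>" by (auto simp: ring_module_def)
  moreover have "\<phi> (r \<odot>\<^bsub>Free\<^esub> symb R g) = r \<otimes>\<^bsub>R\<^esub> k g"
    using linear_mapsD(3)[OF lin r(1) symb_closed[OF g(1)]] symb_closed[OF g(1)] r(1) \<phi>_symb[OF g(1)]
    by (simp add: ring_module_def)
  moreover have "k g = \<one>\<^bsub>R\<^esub>" by (simp add: k_def g(2))
  ultimately show ?thesis using r by simp
qed

end

text \<open>
  A relation between elements of the subgroup is also a relation in the larger group, so that the
  inclusion of free modules descends to the tensor products.
\<close>

lemma tensor_incl_linear: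
  assumes "scalar_extension R A" "scalar_extension R B" "A \<subseteq> B"
  shows "tensor_incl R A B \<in> linear_maps R (tensor R A) (tensor R B)"
    and "a \<in> A \<Longrightarrow> tensor_incl R A B (pure_tensor R A a) = pure_tensor R B a"
proof -
  interpret A: scalar_extension R A by fact
  interpret B: scalar_extension R B by fact
  have f: "x \<in> carrier A.Free \<Longrightarrow> x \<in> carrier B.Free" for x
    using assms(3) by (auto simp: free_module_simps)
  have "(\<lambda>x\<in>carrier A.Free. x) \<in> linear_maps R A.Free B.Free"
    by (rule restrict_linear_mapsI[OF A.Free.module_axioms]) (auto simp: f, auto simp: free_module_simps)
  from preimage_submodule[OF A.Free.module_axioms B.Free.module_axioms this B.submodule_Rel]
  have W: "submodule {x \<in> carrier A.Free. (\<lambda>x\<in>carrier A.Free. x) x \<in> B.Rel} R A.Free" .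
  have minus: "x \<ominus>\<^bsub>B.Free\<^esub> y = x \<ominus>\<^bsub>A.Free\<^esub> y" if "x \<in> carrier A.Free" "y \<in> carrier A.Free" for x y
  proof -
    have "\<ominus>\<^bsub>A.Free\<^esub> y = (\<ominus>\<^bsub>R\<^esub> \<one>\<^bsub>R\<^esub>) \<odot>\<^bsub>A.Free\<^esub> y" "\<ominus>\<^bsub>B.Free\<^esub> y = (\<ominus>\<^bsub>R\<^esub> \<one>\<^bsub>R\<^esub>) \<odot>\<^bsub>B.Free\<^esub> y"
      using that f by (simp_all add: A.Free.smult_l_minus B.Free.smult_l_minus)
    then show ?thesis by (simp add: A.Free.M.minus_eq B.Free.M.minus_eq free_module_simps)
  qed
  have "A.Rel \<subseteq> {x \<in> carrier A.Free. (\<lambda>x\<in>carrier A.Free. x) x \<in> B.Rel}"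
  proof (rule A.Rel_minimal[OF W])
    fix a b assume "a \<in> A" "b \<in> A"
    then have cl: "symb R (a + b) \<in> carrier A.Free" "symb R a \<in> carrier A.Free" "symb R b \<in> carrier A.Free"
      and "a \<in> B" "b \<in> B"
      using A.symb_closed additive_subgroup_add[OF A.subgroup] assms(3) by auto
    then show "symb R (a + b) \<ominus>\<^bsub>A.Free\<^esub> symb R a \<ominus>\<^bsub>A.Free\<^esub> symb R b
        \<in> {x \<in> carrier A.Free. (\<lambda>x\<in>carrier A.Free. x) x \<in> B.Rel}"
      using B.Rel_gen[of a b] by (simp add: minus)
  qed
  then have K: "x \<in> A.Rel \<Longrightarrow> x \<in> B.Rel" for x by auto
  have q: "quotient R B.Free B.Rel" by (rule B.quotient_axioms)
  show "tensor_incl R A B \<in> linear_maps R (tensor R A) (tensor R B)"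
    unfolding tensor_incl_def tensor_def
    by (rule A.induced_map_linear[OF q]) (auto simp: f K, auto simp: free_module_simps)
  show "tensor_incl R A B (pure_tensor R A a) = pure_tensor R B a" if "a \<in> A"
    unfolding tensor_incl_def pure_tensor_def
    by (rule A.induced_map_coset[OF q A.symb_closed[OF that]]) (auto simp: f K, auto simp: free_module_simps)
qed

lemma tensor_incl_self:
  assumes "scalar_extension R A" "x \<in> carrier (tensor R A)"
  shows "tensor_incl R A A x = x"
proof -
  interpret scalar_extension R A by fact
  have "tensor_incl R A A = (\<lambda>x\<in>carrier (tensor R A). x)"
  proof (rule linear_maps_eqI[OF T.module_axioms tensor_incl_linear(1)[OF assms(1,1) subset_refl]])
    show "(\<lambda>x\<in>carrier (tensor R A). x) \<in> linear_maps R (tensor R A) (tensor R A)"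
      by (rule restrict_linear_mapsI[OF T.module_axioms]) auto
    show "A = additive_subgroup hull A" using hull_same[of additive_subgroup A] subgroup by simp
  qed (auto simp: tensor_incl_linear(2)[OF assms(1,1)] pure_closed)
  then show ?thesis using assms(2) by simp
qed

text \<open>
  The multiples of \<open>g \<otimes> 1\<close> form a submodule, which is everything because \<open>g\<close> generates the group;
  freeness comes from the additive map \<open>k g \<mapsto> k\<close>.
\<close>

lemma tensor_cyclic:
  fixes g :: "'i \<Rightarrow> real"
  assumes "cring R" and A: "A = range (\<lambda>k::int. \<lambda>i. of_int k * g i)" and g: "g \<noteq> 0"
  shows "x \<in> carrier (tensor R A) \<Longrightarrow> \<exists>r\<in>carrier R. x = r \<odot>\<^bsub>tensor R A\<^esub> pure_tensor R A g"
    and "r \<in> carrier R \<Longrightarrow> r \<odot>\<^bsub>tensor R A\<^esub> pure_tensor R A g = \<zero>\<^bsub>tensor R A\<^esub> \<Longrightarrow> r = \<zero>\<^bsub>R\<^esub>"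
proof -
  have hull: "A = additive_subgroup hull {g}" by (simp add: A hull_singleton)
  interpret scalar_extension R A
    using assms(1) additive_subgroup_hull[of "{g}"] hull
    by (simp add: scalar_extension_def scalar_extension_axioms_def)
  have gA: "g \<in> A" unfolding hull using hull_subset by fastforce
  note p = pure_closed[OF gA]
  let ?W = "{r \<odot>\<^bsub>tensor R A\<^esub> pure g |r. r \<in> carrier R}"
  have W: "submodule ?W R (tensor R A)"
  proof (rule T.submoduleI)
    show "\<zero>\<^bsub>tensor R A\<^esub> \<in> ?W" using p T.smult_l_null[OF p] zero_closed
      by (metis (mono_tags, lifting) mem_Collect_eq)
    fix x assume "x \<in> ?W"
    then obtain r where r: "r \<in> carrier R" "x = r \<odot>\<^bsub>tensor R A\<^esub> pure g" by blast
    then have "\<ominus>\<^bsub>tensor R A\<^esub> x = (\<ominus>\<^bsub>R\<^esub> r) \<odot>\<^bsub>tensor R A\<^esub> pure g" using p by (simp add: T.smult_l_minus)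
    then show "\<ominus>\<^bsub>tensor R A\<^esub> x \<in> ?W" using r by blast
  next
    fix x y assume "x \<in> ?W" "y \<in> ?W"
    then obtain r s where r: "r \<in> carrier R" "x = r \<odot>\<^bsub>tensor R A\<^esub> pure g"
      and s: "s \<in> carrier R" "y = s \<odot>\<^bsub>tensor R A\<^esub> pure g" by blast
    then have "x \<oplus>\<^bsub>tensor R A\<^esub> y = (r \<oplus>\<^bsub>R\<^esub> s) \<odot>\<^bsub>tensor R A\<^esub> pure g" using p by (simp add: T.smult_l_distr)
    then show "x \<oplus>\<^bsub>tensor R A\<^esub> y \<in> ?W" using r s by blast
  next
    fix t x assume t: "t \<in> carrier R" and "x \<in> ?W"
    then obtain r where r: "r \<in> carrier R" "x = r \<odot>\<^bsub>tensor R A\<^esub> pure g" by blast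
    then have "t \<odot>\<^bsub>tensor R A\<^esub> x = (t \<otimes>\<^bsub>R\<^esub> r) \<odot>\<^bsub>tensor R A\<^esub> pure g" using p t by (simp add: T.smult_assoc1)
    then show "t \<odot>\<^bsub>tensor R A\<^esub> x \<in> ?W" using r t by blast
  qed (use p in auto)
  have "pure g \<in> ?W" using p T.smult_one one_closed by (metis (mono_tags, lifting) mem_Collect_eq)
  then have "carrier (tensor R A) \<subseteq> ?W"
    by (intro tensor_span[OF W hull]) auto
  then show "x \<in> carrier (tensor R A) \<Longrightarrow> \<exists>r\<in>carrier R. x = r \<odot>\<^bsub>tensor R A\<^esub> pure g" by blast
  define c where "c a = (THE k::int. a = (\<lambda>i. of_int k * g i))" for a
  obtain i where i: "g i \<noteq> 0" using g by (auto simp: fun_eq_iff)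
  have inj: "k = l" if "(\<lambda>i. of_int k * g i) = (\<lambda>i. of_int l * g i)" for k l :: int
    using fun_cong[OF that, of i] i by simp
  have c: "c (\<lambda>i. of_int k * g i) = k" for k
    unfolding c_def by (rule the_equality) (use inj in auto)
  have c1: "c g = 1" using c[of 1] by simp
  have "c (a + b) = c a + c b" if ab: "a \<in> A" "b \<in> A" for a b
  proof -
    obtain k l where "a = (\<lambda>i. of_int k * g i)" "b = (\<lambda>i. of_int l * g i)" using ab A by blast
    moreover have "(\<lambda>i. of_int k * g i) + (\<lambda>i. of_int l * g i) = (\<lambda>i. of_int (k + l) * g i)"
      by (auto simp: fun_eq_iff algebra_simps)
    ultimately show ?thesis by (simp add: c del: of_int_add)
  qed
  then show "r \<in> carrier R \<Longrightarrow> r \<odot>\<^bsub>tensor R A\<^esub> pure g = \<zero>\<^bsub>tensor R A\<^esub> \<Longrightarrow> r = \<zero>\<^bsub>R\<^esub>"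
    using pure_torsion_free[of c g r] gA c1 by blast
qed

section \<open>One-dimensional fans\<close>

lemma rational_cone_convex_cone: "rational_cone \<sigma> \<Longrightarrow> convex_cone \<sigma>"
  using convex_cone_convex_cone_hull by (auto simp: rational_cone_def)

text \<open>
  The generators of a rational cone are lattice points, so the lattice points in its span already span
  it.
\<close>

lemma cone_dim_eq_dim:
  assumes "rational_cone \<sigma>"
  shows "cone_dim \<sigma> = dim \<sigma>"
proof -
  obtain V where V: "V \<subseteq> lattice" "\<sigma> = convex_cone hull V"
    using assms by (auto simp: rational_cone_def)
  have "V \<subseteq> \<sigma>" unfolding V(2) by (rule hull_subset)
  then have "V \<subseteq> LZ \<sigma>" using V(1) span_superset by (auto simp: LZ_def)
  moreover have "\<sigma> \<subseteq> span V" unfolding V(2)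
    by (rule hull_minimal) (auto intro: span_base subspace_imp_convex_cone)
  ultimately have "\<sigma> \<subseteq> span (LZ \<sigma>)" using span_mono by blast
  then have "span \<sigma> \<subseteq> span (LZ \<sigma>)" by (simp add: span_minimal)
  moreover have "span (LZ \<sigma>) \<subseteq> span \<sigma>" by (rule span_minimal) (auto simp: LZ_def)
  ultimately show ?thesis unfolding cone_dim_def using span_eq_dim by blast
qed

text \<open>
  If \<open>0\<close> lay strictly between two points of the cone, positive multiples of them would be opposite
  to each other, which strict convexity forbids.
\<close>

lemma vertex_face_of:
  assumes "rational_cone \<sigma>"
  shows "{0} face_of \<sigma>"
  unfolding face_of_singleton extreme_point_of_def
proof (intro conjI ballI notI)
  have c: "convex_cone \<sigma>" by (rule rational_cone_convex_cone[OF assms])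
  then show "0 \<in> \<sigma>" by (rule convex_cone_contains_0)
  fix a b assume ab: "a \<in> \<sigma>" "b \<in> \<sigma>" and "0 \<in> open_segment a b"
  then obtain u where u: "0 < u" "u < 1" "0 = (1 - u) *\<^sub>R a + u *\<^sub>R b" and ne: "a \<noteq> b"
    by (auto simp: in_segment)
  have "- ((1 - u) *\<^sub>R a) = u *\<^sub>R b" using u(3) by (metis add.commute neg_eq_iff_add_eq_0)
  moreover have "(1 - u) *\<^sub>R a \<in> \<sigma>" "u *\<^sub>R b \<in> \<sigma>" using convex_cone_scaleR[OF c] ab u by auto
  ultimately have z: "(1 - u) *\<^sub>R a = 0" using assms by (auto simp: rational_cone_def)
  then have "u *\<^sub>R b = 0" using u(3) unfolding z by simp
  with z u ne show False by simp
qed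

lemma face_of_same_dim_eq:
  fixes \<gamma> :: "(real ^ 'n) set"
  assumes "rational_cone \<alpha>" "rational_cone \<gamma>" "\<alpha> face_of \<gamma>" "cone_dim \<gamma> \<le> cone_dim \<alpha>"
  shows "\<gamma> = \<alpha>"
proof (rule ccontr)
  assume "\<gamma> \<noteq> \<alpha>"
  have z: "0 \<in> \<alpha>" "0 \<in> \<gamma>" using assms(1,2) rational_cone_convex_cone convex_cone_contains_0 by blast+
  have "convex \<gamma>" using rational_cone_convex_cone[OF assms(2)] by (simp add: convex_cone_def)
  then have "aff_dim \<alpha> < aff_dim \<gamma>" using face_of_aff_dim_lt assms(3) \<open>\<gamma> \<noteq> \<alpha>\<close> by blast
  then show False using z assms
    by (simp add: aff_dim_zero hull_inc cone_dim_eq_dim)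
qed

text \<open>
  A nonzero point has arbitrarily long multiples in the cone.
\<close>

lemma compact_cone_trivial:
  fixes \<sigma> :: "(real ^ 'n) set"
  assumes "convex_cone \<sigma>" "compact \<sigma>"
  shows "\<sigma> \<subseteq> {0}"
proof
  fix x assume x: "x \<in> \<sigma>"
  obtain B where B: "\<And>y. y \<in> \<sigma> \<Longrightarrow> norm y \<le> B"
    using compact_imp_bounded[OF assms(2)] by (auto simp: bounded_iff)
  show "x \<in> {0}"
  proof (rule ccontr)
    assume "x \<notin> {0}"
    then have n: "norm x > 0" by simp
    let ?c = "(\<bar>B\<bar> + 1) / norm x"
    have "?c *\<^sub>R x \<in> \<sigma>" using convex_cone_scaleR[OF assms(1) _ x, of ?c] n by simp
    then have "norm (?c *\<^sub>R x) \<le> B" by (rule B)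
    then show False using n by simp
  qed
qed

lemma wedge_Nil: "wedge [] \<noteq> 0"
  by (auto simp: wedge_def fun_eq_iff)

lemma wedge_single_eval: "wedge [x] [i] = x $ i"
  by (simp add: wedge_def lwedge_def)

lemma wedge_single_zero: "wedge [0] = 0"
  by (auto simp: wedge_def lwedge_def fun_eq_iff)

lemma ext_power_0: "ext_power 0 L = range (\<lambda>k::int. \<lambda>i. of_int k * wedge [] i)"
proof -
  have "{wedge vs |vs. length vs = 0 \<and> set vs \<subseteq> L} = {wedge []}" by auto
  then show ?thesis by (simp add: ext_power_def hull_singleton)
qed

lemma LZ_zero: "LZ {0} = {0}"
  by (auto simp: LZ_def lattice_def)

lemma ext_power_1_zero: "ext_power 1 {0 :: real ^ 'n} = {0}"
proof -
  have "{wedge vs |vs. length vs = 1 \<and> set vs \<subseteq> {0 :: real ^ 'n}} = {wedge [0]}"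
    by (auto simp: length_Suc_conv)
  moreover have "additive_subgroup {0 :: 'n list \<Rightarrow> real}" by (simp add: additive_subgroup_def)
  ultimately show ?thesis by (simp add: ext_power_def wedge_single_zero hull_same)
qed

lemma additive_subgroup_FZ: "additive_subgroup (FZ \<Sigma> p \<sigma>)"
  unfolding FZ_def by (rule additive_subgroup_hull)

lemma FZ_of_maximal:
  assumes "{\<gamma> \<in> \<Sigma>. \<sigma> face_of \<gamma>} = {\<sigma>}"
  shows "FZ \<Sigma> p \<sigma> = ext_power p (LZ \<sigma>)"
  unfolding FZ_def assms by (simp add: ext_power_def hull_hull)

locale fan_curve =
  fixes \<Sigma> :: "(real ^ 'n) set set" and \<omega> :: "(real ^ 'n) set \<Rightarrow> 'n list \<Rightarrow> real"
  assumes pure: "pure_fan \<Sigma>" and dim_one: "fan_dim \<Sigma> = 1" and orient: "orientation \<Sigma> \<omega>"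
begin

abbreviation "rays \<equiv> faces \<Sigma> 1"

lemma fan: "fan \<Sigma>" using pure by (simp add: pure_fan_def)

lemma finite_fan: "finite \<Sigma>" and nonempty: "\<Sigma> \<noteq> {}"
  and rational: "\<sigma> \<in> \<Sigma> \<Longrightarrow> rational_cone \<sigma>"
  and face_closed: "\<sigma> \<in> \<Sigma> \<Longrightarrow> \<tau> face_of \<sigma> \<Longrightarrow> \<tau> \<noteq> {} \<Longrightarrow> \<tau> \<in> \<Sigma>"
  using fan unfolding fan_def by blast+

lemma dim_le:
  assumes "\<sigma> \<in> \<Sigma>"
  shows "cone_dim \<sigma> \<le> 1"
proof -
  have "cone_dim \<sigma> \<le> Max (cone_dim ` \<Sigma>)" using finite_fan assms by simp
  then show ?thesis using dim_one by (simp add: fan_dim_def)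
qed

lemma finite_rays: "finite rays"
  using finite_fan by (simp add: faces_def)

lemma rays_nonempty: "rays \<noteq> {}"
proof -
  have "Max (cone_dim ` \<Sigma>) \<in> cone_dim ` \<Sigma>" using finite_fan nonempty by (intro Max_in) auto
  then show ?thesis using dim_one by (auto simp: fan_dim_def faces_def)
qed

lemma vertex_face: "\<sigma> \<in> \<Sigma> \<Longrightarrow> {0} face_of \<sigma>"
  using rational vertex_face_of by blast

lemma vertex_in: "{0} \<in> \<Sigma>"
  using nonempty vertex_face face_closed by blast

lemma dim_0_iff:
  assumes "\<sigma> \<in> \<Sigma>"
  shows "cone_dim \<sigma> = 0 \<longleftrightarrow> \<sigma> = {0}"
  using convex_cone_contains_0[OF rational_cone_convex_cone[OF rational[OF assms]]]
  by (auto simp: cone_dim_eq_dim rational assms dim_eq_0)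

lemma faces_0: "faces \<Sigma> 0 = {{0}}"
  using vertex_in dim_0_iff by (auto simp: faces_def)

lemma faces_2: "faces \<Sigma> 2 = {}"
  using dim_le by (fastforce simp: faces_def)

lemma cone_cases: "\<sigma> \<in> \<Sigma> \<Longrightarrow> \<sigma> = {0} \<or> \<sigma> \<in> rays"
  using dim_le[of \<sigma>] dim_0_iff[of \<sigma>] by (auto simp: faces_def)

lemma rayD:
  assumes "\<alpha> \<in> rays"
  shows "\<alpha> \<in> \<Sigma>" "rational_cone \<alpha>" "cone_dim \<alpha> = 1" "\<alpha> \<noteq> {0}"
  using assms dim_0_iff[of \<alpha>] rational by (auto simp: faces_def)

lemma compact_faces_0: "compact_faces \<Sigma> 0 = {{0}}"
  by (auto simp: compact_faces_def faces_0)

lemma compact_faces_pos: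
  assumes "q > 0"
  shows "compact_faces \<Sigma> q = {}"
proof -
  have False if "\<sigma> \<in> \<Sigma>" "cone_dim \<sigma> = q" "compact \<sigma>" for \<sigma>
  proof -
    have c: "convex_cone \<sigma>" using rational_cone_convex_cone rational that(1) by blast
    then have "\<sigma> = {0}" using compact_cone_trivial[OF c that(3)] convex_cone_contains_0[OF c] by blast
    then show False using that(2) assms dim_0_iff[OF that(1)] by simp
  qed
  then show ?thesis by (auto simp: compact_faces_def faces_def)
qed

text \<open>
  A proper face has smaller dimension, and the rays have the maximal one.
\<close>

lemma ray_maximal:
  assumes "\<alpha> \<in> rays"
  shows "{\<gamma> \<in> \<Sigma>. \<alpha> face_of \<gamma>} = {\<alpha>}"
proof -
  have "\<gamma> = \<alpha>" if "\<gamma> \<in> \<Sigma>" "\<alpha> face_of \<gamma>" for \<gamma>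
    using face_of_same_dim_eq[of \<alpha> \<gamma>] rayD[OF assms] that rational dim_le by simp
  moreover have "\<alpha> face_of \<alpha>"
    using rational_cone_convex_cone[OF rayD(2)[OF assms]] by (simp add: face_of_refl convex_cone_def)
  ultimately show ?thesis using rayD(1)[OF assms] by blast
qed

lemma ext_power_ray:
  assumes "\<alpha> \<in> rays"
  shows "ext_power 1 (LZ \<alpha>) = range (\<lambda>k::int. \<lambda>i. of_int k * \<omega> \<alpha> i)"
proof -
  have "ext_power (cone_dim \<alpha>) (LZ \<alpha>) = range (\<lambda>k::int. \<lambda>i. of_int k * \<omega> \<alpha> i)"
    using bspec[OF orient[unfolded orientation_def] rayD(1)[OF assms]] .
  then show ?thesis by (simp only: rayD(3)[OF assms])
qed

lemma FZ_ray: "\<alpha> \<in> rays \<Longrightarrow> FZ \<Sigma> p \<alpha> = ext_power p (LZ \<alpha>)"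
  by (rule FZ_of_maximal[OF ray_maximal])

lemma FZ_0:
  assumes "\<sigma> \<in> \<Sigma>"
  shows "FZ \<Sigma> 0 \<sigma> = range (\<lambda>k::int. \<lambda>i. of_int k * wedge [] i)"
proof -
  have "\<sigma> face_of \<sigma>"
    using rational_cone_convex_cone[OF rational[OF assms]] by (simp add: face_of_refl convex_cone_def)
  then have "{\<gamma> \<in> \<Sigma>. \<sigma> face_of \<gamma>} \<noteq> {}" using assms by blast
  then have U: "(\<Union>\<gamma>\<in>{\<gamma> \<in> \<Sigma>. \<sigma> face_of \<gamma>}. ext_power 0 (LZ \<gamma>)) = additive_subgroup hull {wedge []}"
    unfolding ext_power_0 hull_singleton by (simp only: UN_constant if_False)
  show ?thesis unfolding FZ_def U hull_hull by (rule hull_singleton)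
qed

text \<open>
  The orientation generates the first exterior power of the lattice of the ray, which is not zero. This
  makes the coefficient group of the ray infinite cyclic.
\<close>

lemma orientation_nonzero:
  assumes "\<alpha> \<in> rays"
  shows "\<omega> \<alpha> \<noteq> 0"
proof
  assume z: "\<omega> \<alpha> = 0"
  have "dim (LZ \<alpha>) = 1" using rayD(3)[OF assms] by (simp add: cone_dim_def)
  then have "\<not> LZ \<alpha> \<subseteq> {0}" using dim_eq_0[of "LZ \<alpha>"] by simp
  then obtain x where x: "x \<in> LZ \<alpha>" "x \<noteq> 0" by blast
  have "wedge [x] \<in> {wedge vs |vs. length vs = 1 \<and> set vs \<subseteq> LZ \<alpha>}"
    using x(1) by (intro CollectI exI[of _ "[x]"]) simp
  then have "wedge [x] \<in> ext_power 1 (LZ \<alpha>)"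
    unfolding ext_power_def by (rule hull_inc)
  then obtain k where "wedge [x] = (\<lambda>i. of_int k * \<omega> \<alpha> i)"
    unfolding ext_power_ray[OF assms] by (elim rangeE)
  then have "wedge [x] = 0" using z by (simp add: zero_fun_def)
  then have "x $ i = 0" for i using wedge_single_eval[of x i] by simp
  then show False using x(2) by (simp add: vec_eq_iff)
qed

lemma ext_power_ray_hull:
  assumes "\<alpha> \<in> rays"
  shows "ext_power 1 (LZ \<alpha>) = additive_subgroup hull {\<omega> \<alpha>}"
  unfolding ext_power_ray[OF assms] by (rule hull_singleton[symmetric])

lemma orientation_in: "\<alpha> \<in> rays \<Longrightarrow> \<omega> \<alpha> \<in> ext_power 1 (LZ \<alpha>)"
  unfolding ext_power_ray_hull by (rule hull_inc) simp

text \<open>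
  Every cone other than the vertex is a ray, and the vertex itself contributes only \<open>0\<close>.
\<close>

lemma FZ_vertex: "FZ \<Sigma> 1 {0} = additive_subgroup hull (\<omega> ` rays)" (is "?L = ?H")
proof
  have "ext_power 1 (LZ \<gamma>) \<subseteq> ?H" if "\<gamma> \<in> \<Sigma>" for \<gamma>
    using cone_cases[OF that]
  proof
    assume g: "\<gamma> = {0}"
    have "0 \<in> ?H" using additive_subgroup_hull[of "\<omega> ` rays"] unfolding additive_subgroup_def by (rule conjunct1)
    then show ?thesis unfolding g LZ_zero ext_power_1_zero by (simp only: insert_subset empty_subsetI)
  next
    assume "\<gamma> \<in> rays"
    then show ?thesis unfolding ext_power_ray_hull[OF \<open>\<gamma> \<in> rays\<close>] by (intro hull_mono) auto
  qed
  then show "?L \<subseteq> ?H" unfolding FZ_def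
    by (intro hull_minimal additive_subgroup_hull) blast
  have "\<omega> \<alpha> \<in> ?L" if "\<alpha> \<in> rays" for \<alpha>
    unfolding FZ_def using orientation_in[OF that] vertex_face rayD(1)[OF that]
    by (intro hull_inc UN_I[of \<alpha>]) auto
  then show "?H \<subseteq> ?L" by (intro hull_minimal additive_subgroup_FZ) blast
qed

text \<open>
  In the case of one ray this transfers freeness of the coefficient module from the ray to the vertex.
\<close>

lemma FZ_vertex_single_ray: "rays = {\<alpha>} \<Longrightarrow> FZ \<Sigma> 1 {0} = FZ \<Sigma> 1 \<alpha>"
proof -
  assume r: "rays = {\<alpha>}"
  then have \<alpha>: "\<alpha> \<in> rays" by simp
  show ?thesis unfolding FZ_vertex FZ_ray[OF \<alpha>] ext_power_ray_hull[OF \<alpha>] by (simp only: r image_insert image_empty)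
qed

lemma FZ_ray_subset_vertex:
  assumes "\<alpha> \<in> rays"
  shows "FZ \<Sigma> p \<alpha> \<subseteq> FZ \<Sigma> p {0}"
proof -
  have "FZ \<Sigma> p \<alpha> \<subseteq> (\<Union>\<gamma>\<in>{\<gamma> \<in> \<Sigma>. {0} face_of \<gamma>}. ext_power p (LZ \<gamma>))"
    using vertex_face rayD(1)[OF assms] by (auto simp: FZ_ray[OF assms])
  then show ?thesis unfolding FZ_def[of _ _ "{0}"] by (rule order_trans[OF _ hull_subset])
qed

end

section \<open>Weights and linear forms\<close>

text \<open>
  The linear algebra behind the map of \<open>H\<^sup>0(F\<^sup>1)\<close> to \<open>H\<^sub>1(F\<^sub>0)\<close>. The module \<open>M\<close> is generated by the
  \<open>l\<^sub>\<alpha>\<close>, and by \<open>unique\<close> the kernel of \<open>\<pi> a = \<Sum> s\<^sub>\<alpha> a\<^sub>\<alpha> l\<^sub>\<alpha>\<close> is contained in the multiples of \<open>w\<close>. If the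
  weights are units, the form that is to take the value \<open>c\<^sub>\<alpha> / w\<^sub>\<alpha>\<close> on \<open>l\<^sub>\<alpha>\<close> is obtained by
  factoring \<open>\<phi> a = \<Sum> s\<^sub>\<alpha> a\<^sub>\<alpha> c\<^sub>\<alpha> / w\<^sub>\<alpha>\<close> through \<open>\<pi>\<close>; this is possible because
  \<open>\<phi> w = \<Sum> s\<^sub>\<alpha> c\<^sub>\<alpha> = 0\<close>. In the other direction, a family \<open>c\<close> that is \<open>s\<^sub>\<alpha>\<close> at \<open>\<alpha>\<close> and
  \<open>-s\<^sub>\<beta>\<close> at another index \<open>\<beta>\<close> exhibits an inverse of \<open>w\<^sub>\<alpha>\<close>.

  The hypothesis \<open>single\<close> concerns the case of one index, where no \<open>\<beta>\<close> exists: the balancing relation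
  then gives \<open>w\<^sub>\<alpha> = 0\<close>, and as a weight is not a zero-divisor the ring is trivial.
\<close>

lemma dual_surjective_iff_weights_units:
  fixes R (structure)
  assumes "module R M" and A: "finite A"
    and s: "\<And>\<alpha>. \<alpha> \<in> A \<Longrightarrow> s \<alpha> \<in> carrier R" "\<And>\<alpha>. \<alpha> \<in> A \<Longrightarrow> s \<alpha> \<otimes> s \<alpha> = \<one>"
    and l: "\<And>\<alpha>. \<alpha> \<in> A \<Longrightarrow> l \<alpha> \<in> carrier M"
    and gen: "\<And>x. x \<in> carrier M \<Longrightarrow> \<exists>a\<in>A \<rightarrow> carrier R. x = (\<Oplus>\<^bsub>M\<^esub>\<alpha>\<in>A. a \<alpha> \<odot>\<^bsub>M\<^esub> l \<alpha>)"
    and w: "\<And>\<alpha>. \<alpha> \<in> A \<Longrightarrow> w \<alpha> \<in> carrier R"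
      "\<And>\<alpha> b. \<alpha> \<in> A \<Longrightarrow> b \<in> carrier R \<Longrightarrow> w \<alpha> \<otimes> b = \<zero> \<Longrightarrow> b = \<zero>"
    and balanced: "(\<Oplus>\<^bsub>M\<^esub>\<alpha>\<in>A. (s \<alpha> \<otimes> w \<alpha>) \<odot>\<^bsub>M\<^esub> l \<alpha>) = \<zero>\<^bsub>M\<^esub>"
    and unique: "\<And>a. a \<in> A \<rightarrow> carrier R \<Longrightarrow> (\<Oplus>\<^bsub>M\<^esub>\<alpha>\<in>A. (s \<alpha> \<otimes> a \<alpha>) \<odot>\<^bsub>M\<^esub> l \<alpha>) = \<zero>\<^bsub>M\<^esub> \<Longrightarrow>
      \<exists>r\<in>carrier R. \<forall>\<alpha>\<in>A. a \<alpha> = r \<otimes> w \<alpha>"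
    and single: "\<And>\<alpha> r. A = {\<alpha>} \<Longrightarrow> r \<in> carrier R \<Longrightarrow> r \<odot>\<^bsub>M\<^esub> l \<alpha> = \<zero>\<^bsub>M\<^esub> \<Longrightarrow> r = \<zero>"
  shows "(\<forall>c\<in>A \<rightarrow> carrier R. (\<Oplus>\<alpha>\<in>A. s \<alpha> \<otimes> c \<alpha>) = \<zero> \<longrightarrow>
      (\<exists>u\<in>linear_maps R M (ring_module R). \<forall>\<alpha>\<in>A. c \<alpha> = w \<alpha> \<otimes> u (l \<alpha>)))
    \<longleftrightarrow> (\<forall>\<alpha>\<in>A. w \<alpha> \<in> Units R)" (is "?surj \<longleftrightarrow> ?units")
proof
  interpret M: module R M by fact
  assume surj: ?surj
  show ?units
  proof
    fix \<alpha> assume \<alpha>: "\<alpha> \<in> A"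
    show "w \<alpha> \<in> Units R"
    proof (cases "A = {\<alpha>}")
      case True
      have "s \<alpha> \<otimes> w \<alpha> = \<zero>"
        using single[OF True, of "s \<alpha> \<otimes> w \<alpha>"] balanced s(1)[OF \<alpha>] w(1)[OF \<alpha>] l[OF \<alpha>] by (simp add: True)
      then have "w \<alpha> \<otimes> s \<alpha> = \<zero>" using M.R.m_comm s(1)[OF \<alpha>] w(1)[OF \<alpha>] by simp
      then have "s \<alpha> = \<zero>" using w(2)[OF \<alpha> s(1)[OF \<alpha>]] by simp
      then have z: "\<one> = \<zero>" using s(2)[OF \<alpha>] by simp
      then have "w \<alpha> = \<zero>" using M.R.r_one[OF w(1)[OF \<alpha>]] M.R.r_null[OF w(1)[OF \<alpha>]] by simp
      then have "w \<alpha> \<otimes> w \<alpha> = \<one>" using z by simp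
      then show ?thesis using w(1)[OF \<alpha>] by (auto simp: Units_def)
    next
      case False
      then obtain \<beta> where \<beta>: "\<beta> \<in> A" "\<beta> \<noteq> \<alpha>" using \<alpha> by blast
      define c where "c \<gamma> = (if \<gamma> = \<alpha> then s \<alpha> else if \<gamma> = \<beta> then \<ominus> s \<beta> else \<zero>)" for \<gamma>
      have c: "c \<in> A \<rightarrow> carrier R" using s(1) \<alpha> \<beta> by (auto simp: c_def)
      have "(\<Oplus>\<gamma>\<in>A. s \<gamma> \<otimes> c \<gamma>) =
          (\<Oplus>\<gamma>\<in>A. (if \<gamma> = \<alpha> then \<one> else \<zero>) \<oplus> (if \<gamma> = \<beta> then \<ominus> \<one> else \<zero>))"
        by (rule M.R.finsum_cong') (use s \<alpha> \<beta> in \<open>auto simp: c_def M.R.r_minus\<close>)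
      also have "\<dots> = (\<Oplus>\<gamma>\<in>A. if \<gamma> = \<alpha> then \<one> else \<zero>) \<oplus> (\<Oplus>\<gamma>\<in>A. if \<gamma> = \<beta> then \<ominus> \<one> else \<zero>)"
        by (rule M.R.finsum_addf) auto
      also have "\<dots> = \<one> \<oplus> \<ominus> \<one>"
        using M.R.add.finprod_singleton_swap[OF \<alpha> A, of "\<lambda>_. \<one>"]
          M.R.add.finprod_singleton_swap[OF \<beta>(1) A, of "\<lambda>_. \<ominus> \<one>"] by simp
      finally have "(\<Oplus>\<gamma>\<in>A. s \<gamma> \<otimes> c \<gamma>) = \<zero>" by (simp add: M.R.r_neg)
      then obtain u where u: "u \<in> linear_maps R M (ring_module R)" "\<forall>\<gamma>\<in>A. c \<gamma> = w \<gamma> \<otimes> u (l \<gamma>)"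
        using surj c by blast
      have ul: "u (l \<alpha>) \<in> carrier R"
        using linear_mapsD(1)[OF u(1) l[OF \<alpha>]] by (simp add: ring_module_def)
      have "s \<alpha> = w \<alpha> \<otimes> u (l \<alpha>)" using u(2) \<alpha> by (auto simp: c_def)
      then have "w \<alpha> \<otimes> (u (l \<alpha>) \<otimes> s \<alpha>) = \<one>"
        using s[OF \<alpha>] w(1)[OF \<alpha>] ul by (simp add: M.R.m_assoc[symmetric])
      moreover have us: "u (l \<alpha>) \<otimes> s \<alpha> \<in> carrier R" using ul s(1)[OF \<alpha>] by simp
      ultimately have "(u (l \<alpha>) \<otimes> s \<alpha>) \<otimes> w \<alpha> = \<one> \<and> w \<alpha> \<otimes> (u (l \<alpha>) \<otimes> s \<alpha>) = \<one>"
        using M.R.m_comm[OF us w(1)[OF \<alpha>]] by simp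
      then show ?thesis using us w(1)[OF \<alpha>] unfolding Units_def by blast
    qed
  qed
next
  interpret M: module R M by fact
  assume units: ?units
  show ?surj
  proof (intro ballI impI)
    fix c assume c: "c \<in> A \<rightarrow> carrier R" and sc: "(\<Oplus>\<alpha>\<in>A. s \<alpha> \<otimes> c \<alpha>) = \<zero>"
    define v where "v \<alpha> = inv w \<alpha>" for \<alpha>
    have v: "v \<alpha> \<in> carrier R" "w \<alpha> \<otimes> v \<alpha> = \<one>" if "\<alpha> \<in> A" for \<alpha>
      using units that by (auto simp: v_def)
    define \<pi> where "\<pi> a = (\<Oplus>\<^bsub>M\<^esub>\<alpha>\<in>A. (s \<alpha> \<otimes> a \<alpha>) \<odot>\<^bsub>M\<^esub> l \<alpha>)" for a
    define \<phi> where "\<phi> a = (\<Oplus>\<alpha>\<in>A. (s \<alpha> \<otimes> a \<alpha>) \<otimes> (v \<alpha> \<otimes> c \<alpha>))" for a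
    note cl = s(1) w(1) v(1) l funcset_mem[OF c] Pi_iff
    have \<pi>_closed: "\<pi> a \<in> carrier M" if "a \<in> A \<rightarrow> carrier R" for a
      unfolding \<pi>_def using that by (intro M.M.finsum_closed) (auto simp: cl)
    have \<phi>_closed: "\<phi> a \<in> carrier R" if "a \<in> A \<rightarrow> carrier R" for a
      unfolding \<phi>_def using that by (intro M.R.finsum_closed) (auto simp: cl)
    have \<pi>_add: "\<pi> (\<lambda>\<alpha>. a \<alpha> \<oplus> b \<alpha>) = \<pi> a \<oplus>\<^bsub>M\<^esub> \<pi> b" if "a \<in> A \<rightarrow> carrier R" "b \<in> A \<rightarrow> carrier R" for a b
      unfolding \<pi>_def using that
      by (intro trans[OF M.M.finsum_cong'[OF refl] M.M.finsum_addf]) (auto simp: cl M.R.r_distr M.smult_l_distr)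
    have \<phi>_add: "\<phi> (\<lambda>\<alpha>. a \<alpha> \<oplus> b \<alpha>) = \<phi> a \<oplus> \<phi> b" if "a \<in> A \<rightarrow> carrier R" "b \<in> A \<rightarrow> carrier R" for a b
      unfolding \<phi>_def using that
      by (intro trans[OF M.R.finsum_cong'[OF refl] M.R.finsum_addf]) (auto simp: cl M.R.r_distr M.R.l_distr)
    have \<pi>_smult: "\<pi> (\<lambda>\<alpha>. r \<otimes> a \<alpha>) = r \<odot>\<^bsub>M\<^esub> \<pi> a" if "a \<in> A \<rightarrow> carrier R" "r \<in> carrier R" for a r
      unfolding \<pi>_def using that
      by (subst M.finsum_smult_ldistr)
        (auto simp: cl A M.smult_assoc1[symmetric] M.R.m_lcomm intro!: M.M.finsum_cong')
    have \<phi>_smult: "\<phi> (\<lambda>\<alpha>. r \<otimes> a \<alpha>) = r \<otimes> \<phi> a" if "a \<in> A \<rightarrow> carrier R" "r \<in> carrier R" for a r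
      unfolding \<phi>_def using that
      by (subst M.R.finsum_rdistr)
        (auto simp: cl A M.R.m_assoc M.R.m_lcomm intro!: M.R.finsum_cong')
    have \<phi>_w: "\<phi> w = \<zero>"
    proof -
      have "\<phi> w = (\<Oplus>\<alpha>\<in>A. s \<alpha> \<otimes> c \<alpha>)" unfolding \<phi>_def
      proof (rule M.R.finsum_cong')
        fix \<alpha> assume \<alpha>: "\<alpha> \<in> A"
        have "(s \<alpha> \<otimes> w \<alpha>) \<otimes> (v \<alpha> \<otimes> c \<alpha>) = s \<alpha> \<otimes> ((w \<alpha> \<otimes> v \<alpha>) \<otimes> c \<alpha>)"
          using \<alpha> by (simp add: cl M.R.m_assoc)
        then show "(s \<alpha> \<otimes> w \<alpha>) \<otimes> (v \<alpha> \<otimes> c \<alpha>) = s \<alpha> \<otimes> c \<alpha>" using \<alpha> by (simp add: cl v(2))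
      qed (auto simp: cl)
      then show ?thesis using sc by simp
    qed
    \<comment> \<open>Two preimages of the same element differ by a multiple of \<open>w\<close>, which \<open>\<phi>\<close> annihilates.\<close>
    have well_def: "\<phi> a = \<phi> b" if a: "a \<in> A \<rightarrow> carrier R" and b: "b \<in> A \<rightarrow> carrier R" and e: "\<pi> a = \<pi> b" for a b
    proof -
      \<comment> \<open>The negative of \<open>b\<close>, written as a multiple so that \<open>\<pi>_smult\<close> and \<open>\<phi>_smult\<close> apply.\<close>
      let ?n = "\<lambda>\<alpha>. \<ominus> \<one> \<otimes> b \<alpha>"
      have n: "?n \<in> A \<rightarrow> carrier R" using b by auto
      let ?d = "\<lambda>\<alpha>. a \<alpha> \<oplus> ?n \<alpha>"
      have d: "?d \<in> A \<rightarrow> carrier R" using a n by auto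
      have "\<pi> ?d = \<pi> b \<oplus>\<^bsub>M\<^esub> (\<ominus> \<one>) \<odot>\<^bsub>M\<^esub> \<pi> b" using \<pi>_add[OF a n] \<pi>_smult[OF b] e by simp
      also have "\<dots> = \<zero>\<^bsub>M\<^esub>" using \<pi>_closed[OF b] by (simp add: M.smult_l_minus M.M.r_neg)
      finally obtain r where r: "r \<in> carrier R" "\<forall>\<alpha>\<in>A. ?d \<alpha> = r \<otimes> w \<alpha>"
        using unique[OF d] unfolding \<pi>_def by blast
      have "\<phi> ?d = \<phi> (\<lambda>\<alpha>. r \<otimes> w \<alpha>)" unfolding \<phi>_def
        by (rule M.R.finsum_cong') (use r in \<open>auto simp: cl\<close>)
      also have "\<dots> = \<zero>" using \<phi>_smult[of w r] r(1) w(1) \<phi>_w by auto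
      finally have "\<phi> a \<oplus> \<ominus> \<one> \<otimes> \<phi> b = \<zero>" using \<phi>_add[OF a n] \<phi>_smult[OF b] by simp
      then have "\<phi> a \<oplus> \<ominus> \<phi> b = \<zero>" using \<phi>_closed[OF b] by (simp add: M.R.l_minus)
      then show ?thesis using \<phi>_closed[OF a] \<phi>_closed[OF b]
        by (metis M.R.add.inv_closed M.R.minus_equality M.R.minus_minus)
    qed
    have onto: "\<exists>a\<in>A \<rightarrow> carrier R. \<pi> a = x" if x: "x \<in> carrier M" for x
    proof -
      obtain a where a: "a \<in> A \<rightarrow> carrier R" "x = (\<Oplus>\<^bsub>M\<^esub>\<alpha>\<in>A. a \<alpha> \<odot>\<^bsub>M\<^esub> l \<alpha>)" using gen[OF x] by blast
      \<comment> \<open>The signs are their own inverses.\<close>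
      have "\<pi> (\<lambda>\<alpha>. s \<alpha> \<otimes> a \<alpha>) = x" unfolding \<pi>_def a(2)
        by (rule M.M.finsum_cong') (use a(1) in \<open>auto simp: cl s(2) M.R.m_assoc[symmetric]\<close>)
      moreover have "(\<lambda>\<alpha>. s \<alpha> \<otimes> a \<alpha>) \<in> A \<rightarrow> carrier R" using a(1) by (auto simp: cl)
      ultimately show ?thesis by blast
    qed
    define u where "u = (\<lambda>x\<in>carrier M. \<phi> (SOME a. a \<in> A \<rightarrow> carrier R \<and> \<pi> a = x))"
    have u: "u (\<pi> a) = \<phi> a" if a: "a \<in> A \<rightarrow> carrier R" for a
    proof -
      let ?b = "SOME b. b \<in> A \<rightarrow> carrier R \<and> \<pi> b = \<pi> a"
      have "?b \<in> A \<rightarrow> carrier R \<and> \<pi> ?b = \<pi> a" by (rule someI[of _ a]) (use a in blast)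
      then have "\<phi> ?b = \<phi> a" using a by (intro well_def) simp_all
      then show ?thesis unfolding u_def using \<pi>_closed[OF a] by simp
    qed
    have "u \<in> linear_maps R M (ring_module R)"
    proof (rule linear_mapsI)
      fix x assume "x \<in> carrier M"
      then obtain a where a: "a \<in> A \<rightarrow> carrier R" "\<pi> a = x" using onto by blast
      then show "u x \<in> carrier (ring_module R)"
        using u[OF a(1)] \<phi>_closed[OF a(1)] by (simp add: ring_module_def)
      fix r assume "r \<in> carrier R"
      moreover then have "(\<lambda>\<alpha>. r \<otimes> a \<alpha>) \<in> A \<rightarrow> carrier R" using a(1) by (auto simp: cl)
      ultimately show "u (r \<odot>\<^bsub>M\<^esub> x) = r \<odot>\<^bsub>ring_module R\<^esub> u x"
        using a u[of "\<lambda>\<alpha>. r \<otimes> a \<alpha>"] u[OF a(1)] \<phi>_smult[OF a(1)] \<pi>_smult[OF a(1)]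
        by (simp add: ring_module_def)
    next
      fix x y assume "x \<in> carrier M" "y \<in> carrier M"
      then obtain a b where a: "a \<in> A \<rightarrow> carrier R" "\<pi> a = x" and b: "b \<in> A \<rightarrow> carrier R" "\<pi> b = y"
        using onto by blast
      have "(\<lambda>\<alpha>. a \<alpha> \<oplus> b \<alpha>) \<in> A \<rightarrow> carrier R" using a(1) b(1) by (auto simp: cl)
      then show "u (x \<oplus>\<^bsub>M\<^esub> y) = u x \<oplus>\<^bsub>ring_module R\<^esub> u y"
        using a b u[of "\<lambda>\<alpha>. a \<alpha> \<oplus> b \<alpha>"] u[OF a(1)] u[OF b(1)] \<phi>_add[OF a(1) b(1)] \<pi>_add[OF a(1) b(1)]
        by (simp add: ring_module_def)
    qed (simp add: u_def)
    moreover have "c \<alpha> = w \<alpha> \<otimes> u (l \<alpha>)" if \<alpha>: "\<alpha> \<in> A" for \<alpha>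
    proof -
      let ?e = "\<lambda>\<beta>. if \<beta> = \<alpha> then s \<alpha> else \<zero>"
      have e: "?e \<in> A \<rightarrow> carrier R" using \<alpha> by (auto simp: cl)
      have "\<pi> ?e = (\<Oplus>\<^bsub>M\<^esub>\<beta>\<in>A. if \<beta> = \<alpha> then l \<beta> else \<zero>\<^bsub>M\<^esub>)" unfolding \<pi>_def
        by (rule M.M.finsum_cong') (use \<alpha> in \<open>auto simp: cl s(2)\<close>)
      also have "\<dots> = l \<alpha>" using M.M.add.finprod_singleton_swap[OF \<alpha> A, of l] l by auto
      finally have 1: "\<pi> ?e = l \<alpha>" .
      have "\<phi> ?e = (\<Oplus>\<beta>\<in>A. if \<beta> = \<alpha> then v \<beta> \<otimes> c \<beta> else \<zero>)" unfolding \<phi>_def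
        by (rule M.R.finsum_cong') (use \<alpha> in \<open>auto simp: cl s(2)\<close>)
      also have "\<dots> = v \<alpha> \<otimes> c \<alpha>"
        using M.R.add.finprod_singleton_swap[OF \<alpha> A, of "\<lambda>\<beta>. v \<beta> \<otimes> c \<beta>"] by (auto simp: cl)
      finally have "u (l \<alpha>) = v \<alpha> \<otimes> c \<alpha>" using u[OF e] 1 by simp
      then show ?thesis using \<alpha> by (simp add: cl v(2) M.R.m_assoc[symmetric])
    qed
    ultimately show "\<exists>u\<in>linear_maps R M (ring_module R). \<forall>\<alpha>\<in>A. c \<alpha> = w \<alpha> \<otimes> u (l \<alpha>)" by blast
  qed
qed

section \<open>Contraction in dimension one\<close>

lemma scalar_extension_ext_power: "cring R \<Longrightarrow> scalar_extension R (ext_power p L)"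
  by (simp add: scalar_extension_def scalar_extension_axioms_def ext_power_def additive_subgroup_hull)

lemma wedge_in_ext_power: "length vs = p \<Longrightarrow> set vs \<subseteq> L \<Longrightarrow> wedge vs \<in> ext_power p L"
  unfolding ext_power_def by (rule hull_inc) blast

lemma shuffle_perms_one: "p \<le> 1 \<Longrightarrow> shuffle_perms p 1 = {id}"
  by (auto simp: shuffle_perms_def lessThan_Suc permutes_sing strict_mono_on_def)

text \<open>
  With a single vector there is only the identity shuffle, and it carries the sign \<open>1\<close>. The prescribed
  values thus consist of one term each, and they determine the contraction because the elements
  \<open>wedge [y]\<close> generate the exterior power. So any linear map with these values is the contraction; the
  two lemmas after this one supply it for \<open>p = 0\<close> and \<open>p = 1\<close>.
\<close>

lemma contraction_degree_one:
  fixes L :: "(real ^ 'n) set"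
  assumes R: "cring R" and p: "p \<le> 1"
    and f: "f \<in> linear_maps R (tensor R (ext_power 1 L)) (tensor R (ext_power (1 - p) L))"
    and u: "\<And>vs. length vs = p \<Longrightarrow> set vs \<subseteq> L \<Longrightarrow> u (pure_tensor R (ext_power p L) (wedge vs)) \<in> carrier R"
    and val: "\<And>y. y \<in> L \<Longrightarrow> f (pure_tensor R (ext_power 1 L) (wedge [y])) =
      u (pure_tensor R (ext_power p L) (wedge (take p [y])))
        \<odot>\<^bsub>tensor R (ext_power (1 - p) L)\<^esub> pure_tensor R (ext_power (1 - p) L) (wedge (drop p [y]))"
  shows "contraction R L p 1 u = f"
proof -
  let ?T = "tensor R (ext_power (1 - p) L)"
  interpret S: scalar_extension R "ext_power 1 L" by (rule scalar_extension_ext_power[OF R])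
  interpret T: scalar_extension R "ext_power (1 - p) L" by (rule scalar_extension_ext_power[OF R])
  define P where "P g \<longleftrightarrow> (\<forall>y. length y = 1 \<and> set y \<subseteq> L \<longrightarrow>
          g (pure_tensor R (ext_power 1 L) (wedge y)) =
            finsum ?T
              (\<lambda>a. add_pow ?T ((- 1) ^ (p * (p - 1) div 2) * sign a)
                 (u (pure_tensor R (ext_power p L) (wedge (map (\<lambda>i. y ! a i) [0..<p])))
                  \<odot>\<^bsub>?T\<^esub> pure_tensor R (ext_power (1 - p) L) (wedge (map (\<lambda>i. y ! a i) [p..<1]))))
              (shuffle_perms p 1))" for g
  have val': "finsum ?T
              (\<lambda>a. add_pow ?T ((- 1) ^ (p * (p - 1) div 2) * sign a)
                 (u (pure_tensor R (ext_power p L) (wedge (map (\<lambda>i. [y] ! a i) [0..<p])))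
                  \<odot>\<^bsub>?T\<^esub> pure_tensor R (ext_power (1 - p) L) (wedge (map (\<lambda>i. [y] ! a i) [p..<1]))))
              (shuffle_perms p 1) = f (pure_tensor R (ext_power 1 L) (wedge [y]))" if y: "y \<in> L" for y
  proof -
    have p01: "p = 0 \<or> p = 1" using p by linarith
    have m: "map (\<lambda>i. [y] ! id i) [0..<p] = take p [y]" "map (\<lambda>i. [y] ! id i) [p..<1] = drop p [y]"
      using p01 by auto
    have e: "(- 1) ^ (p * (p - 1) div 2) = (1 :: int)"
      using p01 by auto
    have "u (pure_tensor R (ext_power p L) (wedge (take p [y]))) \<in> carrier R"
      by (rule u) (use p01 y in auto)
    moreover have "pure_tensor R (ext_power (1 - p) L) (wedge (drop p [y])) \<in> carrier ?T"
      by (intro T.pure_closed wedge_in_ext_power) (use p01 y in auto)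
    ultimately have c: "u (pure_tensor R (ext_power p L) (wedge (take p [y])))
        \<odot>\<^bsub>?T\<^esub> pure_tensor R (ext_power (1 - p) L) (wedge (drop p [y])) \<in> carrier ?T"
      by (rule T.T.smult_closed)
    show ?thesis
      unfolding shuffle_perms_one[OF p] val[OF y]
      using T.T.M.finsum_insert[of "{}" id] c by (simp add: m e sign_id del: One_nat_def id_apply)
  qed
  have "contraction R L p 1 u = (THE g. g \<in> linear_maps R (tensor R (ext_power 1 L)) ?T \<and> P g)"
    unfolding contraction_def Let_def P_def by (rule refl)
  also have "\<dots> = f"
  proof (rule the_equality)
    have "P f" unfolding P_def
    proof (intro allI impI)
      fix ys :: "(real ^ 'n) list" assume "length ys = 1 \<and> set ys \<subseteq> L"
      then obtain y where "ys = [y]" "y \<in> L" by (auto simp: length_Suc_conv)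
      then show "f (pure_tensor R (ext_power 1 L) (wedge ys)) =
            finsum ?T
              (\<lambda>a. add_pow ?T ((- 1) ^ (p * (p - 1) div 2) * sign a)
                 (u (pure_tensor R (ext_power p L) (wedge (map (\<lambda>i. ys ! a i) [0..<p])))
                  \<odot>\<^bsub>?T\<^esub> pure_tensor R (ext_power (1 - p) L) (wedge (map (\<lambda>i. ys ! a i) [p..<1]))))
              (shuffle_perms p 1)" using val'[of y] by (simp only:)
    qed
    then show "f \<in> linear_maps R (tensor R (ext_power 1 L)) ?T \<and> P f" using f by blast
    fix g assume g: "g \<in> linear_maps R (tensor R (ext_power 1 L)) ?T \<and> P g"
    show "g = f"
    proof (rule S.linear_maps_eqI[OF T.T.module_axioms conjunct1[OF g] f])
      show "ext_power 1 L = additive_subgroup hull {wedge vs |vs. length vs = 1 \<and> set vs \<subseteq> L}"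
        by (simp only: ext_power_def)
      fix a assume "a \<in> {wedge vs |vs. length vs = 1 \<and> set vs \<subseteq> L}"
      then obtain ys where ys: "a = wedge ys" "length ys = 1 \<and> set ys \<subseteq> L" by blast
      show "g (pure_tensor R (ext_power 1 L) a) = f (pure_tensor R (ext_power 1 L) a)"
        using conjunct2[OF g, unfolded P_def, rule_format, OF ys(2)]
          \<open>P f\<close>[unfolded P_def, rule_format, OF ys(2)] ys(1) by (simp only:)
    qed
  qed
  finally show ?thesis .
qed

lemma contraction_by_scalar:
  assumes R: "cring R" and u: "u (pure_tensor R (ext_power 0 L) (wedge [])) \<in> carrier R"
    and x: "x \<in> carrier (tensor R (ext_power 1 L))"
  shows "contraction R L 0 1 u x =
    u (pure_tensor R (ext_power 0 L) (wedge [])) \<odot>\<^bsub>tensor R (ext_power 1 L)\<^esub> x"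
proof -
  interpret S: scalar_extension R "ext_power 1 L" by (rule scalar_extension_ext_power[OF R])
  let ?c = "u (pure_tensor R (ext_power 0 L) (wedge []))"
  let ?f = "\<lambda>x\<in>carrier (tensor R (ext_power 1 L)). ?c \<odot>\<^bsub>tensor R (ext_power 1 L)\<^esub> x"
  have p: "pure_tensor R (ext_power 1 L) (wedge [y]) \<in> carrier (tensor R (ext_power 1 L))" if "y \<in> L" for y
    by (intro S.pure_closed wedge_in_ext_power) (use that in auto)
  have "contraction R L 0 1 u = ?f"
  proof (rule contraction_degree_one[OF R])
    show "?f \<in> linear_maps R (tensor R (ext_power 1 L)) (tensor R (ext_power (1 - 0) L))"
      unfolding diff_zero
      by (rule restrict_linear_mapsI[OF S.T.module_axioms])
        (use u in \<open>auto simp: S.T.smult_r_distr S.T.smult_assoc1[symmetric] S.m_comm simp del: One_nat_def\<close>)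
  qed (use u p in \<open>auto simp del: One_nat_def\<close>)
  then show ?thesis using x by simp
qed

lemma contraction_by_form:
  assumes R: "cring R" and u: "u \<in> linear_maps R (tensor R (ext_power 1 L)) (ring_module R)"
    and x: "x \<in> carrier (tensor R (ext_power 1 L))"
  shows "contraction R L 1 1 u x =
    u x \<odot>\<^bsub>tensor R (ext_power 0 L)\<^esub> pure_tensor R (ext_power 0 L) (wedge [])"
proof -
  interpret S: scalar_extension R "ext_power 1 L" by (rule scalar_extension_ext_power[OF R])
  interpret T: scalar_extension R "ext_power 0 L" by (rule scalar_extension_ext_power[OF R])
  let ?e = "pure_tensor R (ext_power 0 L) (wedge [])"
  let ?f = "\<lambda>x\<in>carrier (tensor R (ext_power 1 L)). u x \<odot>\<^bsub>tensor R (ext_power 0 L)\<^esub> ?e"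
  have e: "?e \<in> carrier (tensor R (ext_power 0 L))"
    by (intro T.pure_closed wedge_in_ext_power) auto
  have p: "pure_tensor R (ext_power 1 L) (wedge ys) \<in> carrier (tensor R (ext_power 1 L))"
    if "length ys = 1" "set ys \<subseteq> L" for ys
    by (intro S.pure_closed wedge_in_ext_power that)
  have u': "u x \<in> carrier R" if "x \<in> carrier (tensor R (ext_power 1 L))" for x
    using linear_mapsD(1)[OF u that] by (simp add: ring_module_def)
  have "contraction R L 1 1 u = ?f"
  proof (rule contraction_degree_one[OF R])
    show "?f \<in> linear_maps R (tensor R (ext_power 1 L)) (tensor R (ext_power (1 - 1) L))"
      unfolding diff_self_eq_0
      by (rule restrict_linear_mapsI[OF S.T.module_axioms])
        (auto simp: linear_mapsD(2,3)[OF u] ring_module_def u' e T.T.smult_l_distr T.T.smult_assoc1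
          simp del: One_nat_def)
  qed (use p[of "[_]"] in \<open>auto simp: p u' simp del: One_nat_def\<close>)
  then show ?thesis using x by simp
qed

section \<open>Chains, cochains and the cap product of a fan curve\<close>

text \<open>
  The dimension \<open>1\<close> is part of the set of rays; without its rewriting to \<open>Suc 0\<close> that set has one
  normal form.
\<close>

declare One_nat_def [simp del]

locale balanced_curve = fan_curve \<Sigma> \<omega> + cring R
  for R :: "('r, 'k) ring_scheme" and \<Sigma> :: "(real ^ 'n) set set"
    and \<omega> :: "(real ^ 'n) set \<Rightarrow> 'n list \<Rightarrow> real" +
  fixes w :: "(real ^ 'n) set \<Rightarrow> 'r"
  assumes bal: "balanced R \<Sigma> \<omega> w"
begin

abbreviation "F \<equiv> F_lower R \<Sigma>"
abbreviation "V p \<equiv> F_lower R \<Sigma> p {0}"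

text \<open>
  A generator of the coefficient group \<open>F\<^sub>p\<close> on a ray, for \<open>p \<le> 1\<close>. Treating both degrees at once gives a
  single formula for the cap product. The element \<open>gen p \<alpha>\<close> has two incarnations, in the coefficient module of
  the ray and in that of the vertex.
\<close>

definition gen :: "nat \<Rightarrow> (real ^ 'n) set \<Rightarrow> 'n list \<Rightarrow> real" where
  "gen p \<alpha> = (if p = 0 then wedge [] else \<omega> \<alpha>)"

definition ray_gen :: "nat \<Rightarrow> (real ^ 'n) set \<Rightarrow> ('n, 'r) coeff" where
  "ray_gen p \<alpha> = pure_tensor R (FZ \<Sigma> p \<alpha>) (gen p \<alpha>)"

definition vertex_gen :: "nat \<Rightarrow> (real ^ 'n) set \<Rightarrow> ('n, 'r) coeff" where
  "vertex_gen p \<alpha> = pure_tensor R (FZ \<Sigma> p {0}) (gen p \<alpha>)"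

definition orient_sign :: "(real ^ 'n) set \<Rightarrow> 'r" where
  "orient_sign \<alpha> = (if rel_orient \<omega> {0} \<alpha> = 1 then \<one>\<^bsub>R\<^esub> else \<ominus>\<^bsub>R\<^esub> \<one>\<^bsub>R\<^esub>)"

lemma scalar_extension_FZ: "scalar_extension R (FZ \<Sigma> p \<sigma>)"
  by (simp add: scalar_extension_def scalar_extension_axioms_def additive_subgroup_FZ is_cring)

lemma module_F: "module R (F p \<sigma>)"
proof -
  interpret S: scalar_extension R "FZ \<Sigma> p \<sigma>" by (rule scalar_extension_FZ)
  show ?thesis using S.T.module_axioms by (simp add: F_lower_def)
qed

lemma FZ_ray_cyclic:
  assumes "p \<le> 1" "\<alpha> \<in> rays"
  shows "FZ \<Sigma> p \<alpha> = range (\<lambda>k::int. \<lambda>i. of_int k * gen p \<alpha> i)" "gen p \<alpha> \<noteq> 0"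
proof -
  consider "p = 0" | "p = 1" using assms(1) by linarith
  then show "FZ \<Sigma> p \<alpha> = range (\<lambda>k::int. \<lambda>i. of_int k * gen p \<alpha> i)"
  proof cases
    case 1
    then show ?thesis using FZ_0[OF rayD(1)[OF assms(2)]] by (simp add: gen_def)
  next
    case 2
    have "gen 1 \<alpha> = \<omega> \<alpha>" by (simp add: gen_def)
    then show ?thesis unfolding 2 FZ_ray[OF assms(2)] ext_power_ray[OF assms(2)] by (simp only:)
  qed
  show "gen p \<alpha> \<noteq> 0" by (simp add: gen_def wedge_Nil orientation_nonzero[OF assms(2)])
qed

lemma FZ_vertex_hull:
  assumes "p \<le> 1"
  shows "FZ \<Sigma> p {0} = additive_subgroup hull (gen p ` rays)"
proof -
  consider "p = 0" | "p = 1" using assms by linarith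
  then show ?thesis
  proof cases
    case 1
    have "gen 0 ` rays = {wedge []}" using rays_nonempty by (auto simp: gen_def)
    then show ?thesis unfolding 1 FZ_0[OF vertex_in] hull_singleton[symmetric] by (simp only:)
  next
    case 2
    have "gen 1 ` rays = \<omega> ` rays" by (simp add: gen_def)
    then show ?thesis unfolding 2 FZ_vertex by (simp only:)
  qed
qed

lemma gen_in_FZ:
  assumes "p \<le> 1" "\<alpha> \<in> rays"
  shows "gen p \<alpha> \<in> FZ \<Sigma> p \<alpha>" "gen p \<alpha> \<in> FZ \<Sigma> p {0}"
proof -
  show "gen p \<alpha> \<in> FZ \<Sigma> p \<alpha>"
    unfolding FZ_ray_cyclic(1)[OF assms] hull_singleton[symmetric] by (rule hull_inc) simp
  then show "gen p \<alpha> \<in> FZ \<Sigma> p {0}" using FZ_ray_subset_vertex[OF assms(2)] by blast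
qed

lemma ray_gen_closed: "p \<le> 1 \<Longrightarrow> \<alpha> \<in> rays \<Longrightarrow> ray_gen p \<alpha> \<in> carrier (F p \<alpha>)"
  unfolding ray_gen_def F_lower_def
  by (rule scalar_extension.pure_closed[OF scalar_extension_FZ gen_in_FZ(1)])

lemma vertex_gen_closed: "p \<le> 1 \<Longrightarrow> \<alpha> \<in> rays \<Longrightarrow> vertex_gen p \<alpha> \<in> carrier (V p)"
  unfolding vertex_gen_def F_lower_def
  by (rule scalar_extension.pure_closed[OF scalar_extension_FZ gen_in_FZ(2)])

lemma ray_gen_spans:
  "p \<le> 1 \<Longrightarrow> \<alpha> \<in> rays \<Longrightarrow> x \<in> carrier (F p \<alpha>) \<Longrightarrow> \<exists>r\<in>carrier R. x = r \<odot>\<^bsub>F p \<alpha>\<^esub> ray_gen p \<alpha>"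
  unfolding ray_gen_def F_lower_def
  by (rule tensor_cyclic(1)[OF is_cring FZ_ray_cyclic])

lemma ray_gen_free:
  "p \<le> 1 \<Longrightarrow> \<alpha> \<in> rays \<Longrightarrow> r \<in> carrier R \<Longrightarrow> r \<odot>\<^bsub>F p \<alpha>\<^esub> ray_gen p \<alpha> = \<zero>\<^bsub>F p \<alpha>\<^esub> \<Longrightarrow> r = \<zero>\<^bsub>R\<^esub>"
  unfolding ray_gen_def F_lower_def
  by (rule tensor_cyclic(2)[OF is_cring FZ_ray_cyclic])

lemma vertex_gen_free_0:
  assumes "\<alpha> \<in> rays" "r \<in> carrier R" "r \<odot>\<^bsub>V 0\<^esub> vertex_gen 0 \<alpha> = \<zero>\<^bsub>V 0\<^esub>"
  shows "r = \<zero>\<^bsub>R\<^esub>"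
proof -
  have "FZ \<Sigma> 0 {0} = FZ \<Sigma> 0 \<alpha>" unfolding FZ_0[OF vertex_in] FZ_0[OF rayD(1)[OF assms(1)]] by (rule refl)
  then show ?thesis
    using ray_gen_free[of 0 \<alpha> r] assms unfolding ray_gen_def vertex_gen_def F_lower_def by simp
qed

lemma ray_gen_inj:
  assumes "p \<le> 1" "\<alpha> \<in> rays" "r \<in> carrier R" "t \<in> carrier R"
    and "r \<odot>\<^bsub>F p \<alpha>\<^esub> ray_gen p \<alpha> = t \<odot>\<^bsub>F p \<alpha>\<^esub> ray_gen p \<alpha>"
  shows "r = t"
proof -
  interpret M: module R "F p \<alpha>" by (rule module_F)
  note g = ray_gen_closed[OF assms(1,2)]
  have "(r \<oplus>\<^bsub>R\<^esub> \<ominus>\<^bsub>R\<^esub> t) \<odot>\<^bsub>F p \<alpha>\<^esub> ray_gen p \<alpha> = \<zero>\<^bsub>F p \<alpha>\<^esub>"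
    using assms(3-5) g by (simp add: M.smult_l_distr M.smult_l_minus M.M.r_neg)
  then have "r \<oplus>\<^bsub>R\<^esub> \<ominus>\<^bsub>R\<^esub> t = \<zero>\<^bsub>R\<^esub>" using ray_gen_free[OF assms(1,2)] assms(3,4) by simp
  then show ?thesis using assms(3,4) by (metis add.inv_closed minus_equality minus_minus)
qed

lemma iota_linear:
  assumes "\<alpha> \<in> rays"
  shows "iota R \<Sigma> p \<alpha> {0} \<in> linear_maps R (F p \<alpha>) (V p)"
  unfolding iota_def F_lower_def
  by (rule tensor_incl_linear(1)[OF scalar_extension_FZ scalar_extension_FZ FZ_ray_subset_vertex[OF assms]])

lemma iota_ray_gen: "p \<le> 1 \<Longrightarrow> \<alpha> \<in> rays \<Longrightarrow> iota R \<Sigma> p \<alpha> {0} (ray_gen p \<alpha>) = vertex_gen p \<alpha>"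
  unfolding iota_def ray_gen_def vertex_gen_def
  by (rule tensor_incl_linear(2)[OF scalar_extension_FZ scalar_extension_FZ FZ_ray_subset_vertex gen_in_FZ(1)])

lemma iota_self: "x \<in> carrier (F p \<sigma>) \<Longrightarrow> iota R \<Sigma> p \<sigma> \<sigma> x = x"
  unfolding iota_def F_lower_def by (rule tensor_incl_self[OF scalar_extension_FZ])

lemma orient_sign_closed: "orient_sign \<alpha> \<in> carrier R"
  by (simp add: orient_sign_def)

lemma orient_sign_square: "orient_sign \<alpha> \<otimes>\<^bsub>R\<^esub> orient_sign \<alpha> = \<one>\<^bsub>R\<^esub>"
  by (simp add: orient_sign_def l_minus)

lemma add_pow_rel_orient:
  assumes "module R M" "x \<in> carrier M"
  shows "add_pow M (rel_orient \<omega> {0} \<alpha>) x = orient_sign \<alpha> \<odot>\<^bsub>M\<^esub> x"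
proof -
  interpret M: module R M by fact
  have "rel_orient \<omega> {0} \<alpha> = 1 \<or> rel_orient \<omega> {0} \<alpha> = - 1" by (simp add: rel_orient_def)
  then consider "rel_orient \<omega> {0} \<alpha> = 1" | "rel_orient \<omega> {0} \<alpha> = - 1" by blast
  then show ?thesis
  proof cases
    case 1
    then show ?thesis using assms(2) by (simp add: orient_sign_def)
  next
    case 2
    then show ?thesis using assms(2)
      by (simp add: orient_sign_def M.smult_l_minus add_pow_int_lt)
  qed
qed

text \<open>
  The linear combinations of the generators form a submodule, which contains \<open>a \<otimes> 1\<close> for every generator
  \<open>a\<close> of the coefficient group at the vertex.
\<close>

lemma vertex_gen_spans:
  assumes p: "p \<le> 1" and x: "x \<in> carrier (V p)"
  shows "\<exists>a\<in>rays \<rightarrow> carrier R. x = (\<Oplus>\<^bsub>V p\<^esub>\<alpha>\<in>rays. a \<alpha> \<odot>\<^bsub>V p\<^esub> vertex_gen p \<alpha>)"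
proof -
  interpret V: module R "V p" by (rule module_F)
  interpret S: scalar_extension R "FZ \<Sigma> p {0}" by (rule scalar_extension_FZ)
  define comb where "comb a = (\<Oplus>\<^bsub>V p\<^esub>\<alpha>\<in>rays. a \<alpha> \<odot>\<^bsub>V p\<^esub> vertex_gen p \<alpha>)" for a
  note g = vertex_gen_closed[OF p]
  let ?W = "comb ` (rays \<rightarrow> carrier R)"
  have cl: "comb a \<in> carrier (V p)" if "a \<in> rays \<rightarrow> carrier R" for a
    unfolding comb_def using that g by (intro V.M.finsum_closed) auto
  have add: "comb a \<oplus>\<^bsub>V p\<^esub> comb b = comb (\<lambda>\<alpha>. a \<alpha> \<oplus>\<^bsub>R\<^esub> b \<alpha>)"
    if "a \<in> rays \<rightarrow> carrier R" "b \<in> rays \<rightarrow> carrier R" for a b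
    unfolding comb_def using that g
    by (intro trans[OF V.M.finsum_cong'[OF refl] V.M.finsum_addf, symmetric]) (auto simp: Pi_iff V.smult_l_distr)
  have smult: "r \<odot>\<^bsub>V p\<^esub> comb a = comb (\<lambda>\<alpha>. r \<otimes>\<^bsub>R\<^esub> a \<alpha>)" if "a \<in> rays \<rightarrow> carrier R" "r \<in> carrier R" for a r
    unfolding comb_def using that g
    by (intro trans[OF V.finsum_smult_ldistr V.M.finsum_cong'[OF refl]])
      (auto simp: Pi_iff V.smult_assoc1 finite_rays)
  have W: "submodule ?W R (V p)"
  proof (rule V.submoduleI)
    have "comb (\<lambda>_. \<zero>\<^bsub>R\<^esub>) = \<zero>\<^bsub>V p\<^esub>" unfolding comb_def
      by (rule V.M.add.finprod_one_eqI) (simp add: g)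
    then show "\<zero>\<^bsub>V p\<^esub> \<in> ?W" by (intro image_eqI[of _ _ "\<lambda>_. \<zero>\<^bsub>R\<^esub>"]) auto
    fix x assume "x \<in> ?W"
    then obtain a where a: "a \<in> rays \<rightarrow> carrier R" "x = comb a" by blast
    have "\<ominus>\<^bsub>V p\<^esub> x = (\<ominus>\<^bsub>R\<^esub> \<one>\<^bsub>R\<^esub>) \<odot>\<^bsub>V p\<^esub> comb a" using a cl by (simp add: V.smult_l_minus)
    also have "\<dots> = comb (\<lambda>\<alpha>. (\<ominus>\<^bsub>R\<^esub> \<one>\<^bsub>R\<^esub>) \<otimes>\<^bsub>R\<^esub> a \<alpha>)" using smult[OF a(1)] by simp
    finally show "\<ominus>\<^bsub>V p\<^esub> x \<in> ?W" using a(1) by (auto intro!: imageI)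
  next
    fix x y assume "x \<in> ?W" "y \<in> ?W"
    then obtain a b where "a \<in> rays \<rightarrow> carrier R" "x = comb a" "b \<in> rays \<rightarrow> carrier R" "y = comb b" by blast
    then show "x \<oplus>\<^bsub>V p\<^esub> y \<in> ?W" using add[of a b] by (auto intro!: imageI)
  next
    fix r x assume r: "r \<in> carrier R" and "x \<in> ?W"
    then obtain a where "a \<in> rays \<rightarrow> carrier R" "x = comb a" by blast
    then show "r \<odot>\<^bsub>V p\<^esub> x \<in> ?W" using smult[of a r] r by (auto intro!: imageI)
  qed (use cl in auto)
  have "carrier (tensor R (FZ \<Sigma> p {0})) \<subseteq> ?W"
  proof (rule S.tensor_span[OF _ FZ_vertex_hull[OF p]])
    show "submodule ?W R (tensor R (FZ \<Sigma> p {0}))" using W by (simp add: F_lower_def)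
    fix b assume "b \<in> gen p ` rays"
    then obtain \<beta> where \<beta>: "\<beta> \<in> rays" "b = gen p \<beta>" by blast
    let ?e = "\<lambda>\<alpha>. if \<alpha> = \<beta> then \<one>\<^bsub>R\<^esub> else \<zero>\<^bsub>R\<^esub>"
    have "comb ?e = (\<Oplus>\<^bsub>V p\<^esub>\<alpha>\<in>rays. if \<alpha> = \<beta> then vertex_gen p \<alpha> else \<zero>\<^bsub>V p\<^esub>)" unfolding comb_def
      by (rule V.M.finsum_cong') (auto simp: g)
    also have "\<dots> = vertex_gen p \<beta>"
      using V.M.add.finprod_singleton_swap[OF \<beta>(1) finite_rays, of "vertex_gen p"] g by auto
    finally show "S.pure b \<in> ?W" unfolding \<beta>(2) vertex_gen_def by (intro image_eqI[of _ _ ?e]) auto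
  qed
  then show ?thesis using x unfolding comb_def F_lower_def by blast
qed

subsection \<open>Chains\<close>

definition chain :: "nat \<Rightarrow> ((real ^ 'n) set \<Rightarrow> 'r) \<Rightarrow> ('n, 'r) chain" where
  "chain p a = (\<lambda>\<alpha>\<in>rays. a \<alpha> \<odot>\<^bsub>F p \<alpha>\<^esub> ray_gen p \<alpha>)"

text \<open>
  The value at the vertex of the boundary of a 1-chain. It determines the boundary, since the vertex is
  the only cone of dimension \<open>0\<close>.
\<close>

definition bdry :: "nat \<Rightarrow> ('n, 'r) chain \<Rightarrow> ('n, 'r) coeff" where
  "bdry p c = (\<Oplus>\<^bsub>V p\<^esub>\<alpha>\<in>rays. orient_sign \<alpha> \<odot>\<^bsub>V p\<^esub> iota R \<Sigma> p \<alpha> {0} (c \<alpha>))"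

lemma module_chains: "module R (BM_chains R \<Sigma> p q)"
  unfolding BM_chains_def by (rule module_sum_module[OF is_cring module_F])

lemma chains_iff:
  "c \<in> carrier (BM_chains R \<Sigma> p q) \<longleftrightarrow> c \<in> extensional (faces \<Sigma> q) \<and> (\<forall>\<sigma>\<in>faces \<Sigma> q. c \<sigma> \<in> carrier (F p \<sigma>))"
  by (auto simp: BM_chains_def sum_module_def PiE_def)

lemma chains_ops:
  "c \<oplus>\<^bsub>BM_chains R \<Sigma> p q\<^esub> c' = (\<lambda>\<sigma>\<in>faces \<Sigma> q. c \<sigma> \<oplus>\<^bsub>F p \<sigma>\<^esub> c' \<sigma>)"
  "r \<odot>\<^bsub>BM_chains R \<Sigma> p q\<^esub> c = (\<lambda>\<sigma>\<in>faces \<Sigma> q. r \<odot>\<^bsub>F p \<sigma>\<^esub> c \<sigma>)"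
  "\<zero>\<^bsub>BM_chains R \<Sigma> p q\<^esub> = (\<lambda>\<sigma>\<in>faces \<Sigma> q. \<zero>\<^bsub>F p \<sigma>\<^esub>)"
  by (auto simp: BM_chains_def sum_module_def)

lemma chain_closed:
  assumes "p \<le> 1" "a \<in> rays \<rightarrow> carrier R"
  shows "chain p a \<in> carrier (BM_chains R \<Sigma> p 1)"
proof -
  have "a \<alpha> \<odot>\<^bsub>F p \<alpha>\<^esub> ray_gen p \<alpha> \<in> carrier (F p \<alpha>)" if "\<alpha> \<in> rays" for \<alpha>
    by (rule module.smult_closed[OF module_F]) (use assms that ray_gen_closed in auto)
  then show ?thesis unfolding chains_iff chain_def by simp
qed

text \<open>
  The coefficient module of each ray is generated by one element, which gives the coordinates ray by ray.
\<close>

lemma chain_surj: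
  assumes p: "p \<le> 1" and c: "c \<in> carrier (BM_chains R \<Sigma> p 1)"
  shows "\<exists>a\<in>rays \<rightarrow> carrier R. c = chain p a"
proof -
  have "\<forall>\<alpha>\<in>rays. \<exists>r. r \<in> carrier R \<and> c \<alpha> = r \<odot>\<^bsub>F p \<alpha>\<^esub> ray_gen p \<alpha>"
    using c ray_gen_spans[OF p] unfolding chains_iff by blast
  then obtain a where a: "\<forall>\<alpha>\<in>rays. a \<alpha> \<in> carrier R \<and> c \<alpha> = a \<alpha> \<odot>\<^bsub>F p \<alpha>\<^esub> ray_gen p \<alpha>"
    by (rule bchoice[THEN exE])
  have "c = chain p a"
    by (rule extensionalityI[of _ rays]) (use a c in \<open>auto simp: chain_def chains_iff\<close>)
  then show ?thesis using a by blast
qed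

lemma chain_eq_iff:
  assumes "p \<le> 1" "a \<in> rays \<rightarrow> carrier R" "b \<in> rays \<rightarrow> carrier R"
  shows "chain p a = chain p b \<longleftrightarrow> (\<forall>\<alpha>\<in>rays. a \<alpha> = b \<alpha>)"
proof
  assume e: "chain p a = chain p b"
  show "\<forall>\<alpha>\<in>rays. a \<alpha> = b \<alpha>"
  proof
    fix \<alpha> assume \<alpha>: "\<alpha> \<in> rays"
    show "a \<alpha> = b \<alpha>"
      by (rule ray_gen_inj[OF assms(1) \<alpha>]) (use assms \<alpha> fun_cong[OF e, of \<alpha>] in \<open>auto simp: chain_def\<close>)
  qed
qed (auto simp: chain_def intro: restrict_ext)

lemma bdry_summand:
  assumes "\<alpha> \<in> rays" "c \<in> carrier (BM_chains R \<Sigma> p 1)"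
  shows "iota R \<Sigma> p \<alpha> {0} (c \<alpha>) \<in> carrier (V p)"
  using linear_mapsD(1)[OF iota_linear[OF assms(1)]] assms chains_iff by blast

lemma bdry_linear: "(\<lambda>c\<in>carrier (BM_chains R \<Sigma> p 1). bdry p c) \<in> linear_maps R (BM_chains R \<Sigma> p 1) (V p)"
proof (rule restrict_linear_mapsI[OF module_chains])
  interpret V: module R "V p" by (rule module_F)
  note cl = bdry_summand orient_sign_closed
  fix c assume c: "c \<in> carrier (BM_chains R \<Sigma> p 1)"
  show "bdry p c \<in> carrier (V p)" unfolding bdry_def
    by (rule V.M.finsum_closed) (use c in \<open>auto intro: cl V.smult_closed\<close>)
  note i = linear_mapsD[OF iota_linear]
  {
    fix c' assume c': "c' \<in> carrier (BM_chains R \<Sigma> p 1)"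
    have "iota R \<Sigma> p \<alpha> {0} (c \<alpha> \<oplus>\<^bsub>F p \<alpha>\<^esub> c' \<alpha>) = iota R \<Sigma> p \<alpha> {0} (c \<alpha>) \<oplus>\<^bsub>V p\<^esub> iota R \<Sigma> p \<alpha> {0} (c' \<alpha>)"
      if "\<alpha> \<in> rays" for \<alpha>
      using i(2)[OF that] c c' that unfolding chains_iff by blast
    then show "bdry p (c \<oplus>\<^bsub>BM_chains R \<Sigma> p 1\<^esub> c') = bdry p c \<oplus>\<^bsub>V p\<^esub> bdry p c'"
      unfolding bdry_def chains_ops
      by (intro trans[OF V.M.finsum_cong'[OF refl] V.M.finsum_addf])
        (auto intro!: V.smult_closed cl c c' simp: V.smult_r_distr cl c c' simp del: One_nat_def)
  next
    fix r assume r: "r \<in> carrier R"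
    have "iota R \<Sigma> p \<alpha> {0} (r \<odot>\<^bsub>F p \<alpha>\<^esub> c \<alpha>) = r \<odot>\<^bsub>V p\<^esub> iota R \<Sigma> p \<alpha> {0} (c \<alpha>)"
      if "\<alpha> \<in> rays" for \<alpha>
      using i(3)[OF that r] c that unfolding chains_iff by blast
    then show "bdry p (r \<odot>\<^bsub>BM_chains R \<Sigma> p 1\<^esub> c) = r \<odot>\<^bsub>V p\<^esub> bdry p c"
      unfolding bdry_def chains_ops
      by (intro trans[OF V.M.finsum_cong'[OF refl] V.finsum_smult_ldistr[symmetric]])
        (auto intro!: V.smult_closed cl c r finite_rays
          simp: V.smult_assoc1[symmetric] m_comm cl c r simp del: One_nat_def)
  }
qed

lemma bdry_chain:
  assumes "p \<le> 1" "a \<in> rays \<rightarrow> carrier R"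
  shows "bdry p (chain p a) = (\<Oplus>\<^bsub>V p\<^esub>\<alpha>\<in>rays. (orient_sign \<alpha> \<otimes>\<^bsub>R\<^esub> a \<alpha>) \<odot>\<^bsub>V p\<^esub> vertex_gen p \<alpha>)"
  unfolding bdry_def
proof (rule abelian_monoid.finsum_cong')
  interpret V: module R "V p" by (rule module_F)
  show "abelian_monoid (V p)" by (rule V.M.abelian_monoid_axioms)
  fix \<alpha> assume \<alpha>: "\<alpha> \<in> rays"
  have a: "a \<alpha> \<in> carrier R" using assms(2) \<alpha> by blast
  have "iota R \<Sigma> p \<alpha> {0} (chain p a \<alpha>) = a \<alpha> \<odot>\<^bsub>V p\<^esub> vertex_gen p \<alpha>"
    using linear_mapsD(3)[OF iota_linear[OF \<alpha>] a ray_gen_closed[OF assms(1) \<alpha>]] \<alpha>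
    by (simp add: chain_def iota_ray_gen[OF assms(1) \<alpha>])
  then show "orient_sign \<alpha> \<odot>\<^bsub>V p\<^esub> iota R \<Sigma> p \<alpha> {0} (chain p a \<alpha>) =
      (orient_sign \<alpha> \<otimes>\<^bsub>R\<^esub> a \<alpha>) \<odot>\<^bsub>V p\<^esub> vertex_gen p \<alpha>"
    using a vertex_gen_closed[OF assms(1) \<alpha>] orient_sign_closed by (simp add: V.smult_assoc1)
next
  interpret V: module R "V p" by (rule module_F)
  show "(\<lambda>\<alpha>. (orient_sign \<alpha> \<otimes>\<^bsub>R\<^esub> a \<alpha>) \<odot>\<^bsub>V p\<^esub> vertex_gen p \<alpha>) \<in> rays \<rightarrow> carrier (V p)"
    using assms vertex_gen_closed orient_sign_closed by (auto intro!: V.smult_closed)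
qed (rule refl)

lemma BM_boundary_eq:
  assumes "c \<in> carrier (BM_chains R \<Sigma> p 1)"
  shows "BM_boundary R \<Sigma> \<omega> p 0 c = (\<lambda>\<tau>\<in>{{0}}. bdry p c)"
proof -
  interpret V: module R "V p" by (rule module_F)
  have set: "{\<sigma> \<in> faces \<Sigma> (0 + 1). {0} face_of \<sigma>} = rays"
    using vertex_face rayD(1) by auto
  have "(\<Oplus>\<^bsub>V p\<^esub>\<sigma>\<in>rays. add_pow (V p) (rel_orient \<omega> {0} \<sigma>) (iota R \<Sigma> p \<sigma> {0} (c \<sigma>))) = bdry p c"
    unfolding bdry_def
    by (rule V.M.finsum_cong')
      (use bdry_summand[OF _ assms] add_pow_rel_orient[OF module_F] orient_sign_closed in auto)
  then show ?thesis unfolding BM_boundary_def faces_0 by (intro restrict_ext) (use set in auto)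
qed

lemma cycles_1:
  "c \<in> BM_cycles R \<Sigma> \<omega> p 1 \<longleftrightarrow> c \<in> carrier (BM_chains R \<Sigma> p 1) \<and> bdry p c = \<zero>\<^bsub>V p\<^esub>"
proof -
  have "BM_boundary R \<Sigma> \<omega> p 0 c = \<zero>\<^bsub>BM_chains R \<Sigma> p 0\<^esub> \<longleftrightarrow> bdry p c = \<zero>\<^bsub>V p\<^esub>"
    if "c \<in> carrier (BM_chains R \<Sigma> p 1)"
    unfolding BM_boundary_eq[OF that] chains_ops faces_0
  proof
    assume "(\<lambda>\<tau>\<in>{{0}}. bdry p c) = (\<lambda>\<sigma>\<in>{{0}}. \<zero>\<^bsub>F p \<sigma>\<^esub>)"
    from fun_cong[OF this, of "{0}"] show "bdry p c = \<zero>\<^bsub>V p\<^esub>" by simp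
  qed (simp add: restrict_def fun_eq_iff)
  then show ?thesis by (auto simp: BM_cycles_def One_nat_def)
qed

lemma cycles_submodule: "submodule (BM_cycles R \<Sigma> \<omega> p 1) R (BM_chains R \<Sigma> p 1)"
proof -
  have "BM_cycles R \<Sigma> \<omega> p 1 =
    {c \<in> carrier (BM_chains R \<Sigma> p 1). (\<lambda>c\<in>carrier (BM_chains R \<Sigma> p 1). bdry p c) c \<in> {\<zero>\<^bsub>V p\<^esub>}}"
    using cycles_1 by auto
  then show ?thesis
    using preimage_submodule[OF module_chains module_F bdry_linear submodule_zero[OF module_F]] by simp
qed

lemma module_cycles: "module R (BM_cycle_module R \<Sigma> \<omega> p 1)"
  unfolding BM_cycle_module_def by (rule submodule.submodule_is_module[OF cycles_submodule module_chains])

text \<open>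
  There are no cones of dimension \<open>2\<close>.
\<close>

lemma boundaries_1: "BM_boundaries R \<Sigma> \<omega> p 1 = {\<zero>\<^bsub>BM_cycle_module R \<Sigma> \<omega> p 1\<^esub>}"
proof -
  interpret C: module R "BM_chains R \<Sigma> p 2" by (rule module_chains)
  have "BM_boundary R \<Sigma> \<omega> p 1 c = \<zero>\<^bsub>BM_chains R \<Sigma> p 1\<^esub>" for c
  proof -
    have "finsum (F p \<tau>) f {\<sigma> \<in> faces \<Sigma> (1 + 1). \<tau> face_of \<sigma>} = \<zero>\<^bsub>F p \<tau>\<^esub>" for \<tau> f
    proof -
      interpret M: module R "F p \<tau>" by (rule module_F)
      show ?thesis by (simp add: faces_2)
    qed
    then show ?thesis unfolding BM_boundary_def chains_ops by simp
  qed
  moreover have "carrier (BM_chains R \<Sigma> p (1 + 1)) \<noteq> {}"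
    using C.M.zero_closed by auto
  ultimately show ?thesis unfolding BM_boundaries_def BM_cycle_module_def by auto
qed

lemma cycle_module_0: "BM_cycle_module R \<Sigma> \<omega> p 0 = BM_chains R \<Sigma> p 0"
  by (simp add: BM_cycle_module_def BM_cycles_def)

text \<open>Every coefficient at the vertex is a sum of coefficients along rays, so it bounds.\<close>

lemma boundaries_0:
  assumes p: "p \<le> 1"
  shows "BM_boundaries R \<Sigma> \<omega> p 0 = carrier (BM_chains R \<Sigma> p 0)"
proof
  have b: "bdry p c \<in> carrier (V p)" if "c \<in> carrier (BM_chains R \<Sigma> p 1)" for c
    using linear_mapsD(1)[OF bdry_linear that] that by simp
  show "BM_boundaries R \<Sigma> \<omega> p 0 \<subseteq> carrier (BM_chains R \<Sigma> p 0)"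
  proof
    fix x assume "x \<in> BM_boundaries R \<Sigma> \<omega> p 0"
    then obtain c where c: "c \<in> carrier (BM_chains R \<Sigma> p 1)" "x = BM_boundary R \<Sigma> \<omega> p 0 c"
      unfolding BM_boundaries_def by auto
    show "x \<in> carrier (BM_chains R \<Sigma> p 0)"
      unfolding c(2) BM_boundary_eq[OF c(1)] chains_iff faces_0 using b[OF c(1)] by simp
  qed
  show "carrier (BM_chains R \<Sigma> p 0) \<subseteq> BM_boundaries R \<Sigma> \<omega> p 0"
  proof
    interpret V: module R "V p" by (rule module_F)
    fix x assume x: "x \<in> carrier (BM_chains R \<Sigma> p 0)"
    then have "x {0} \<in> carrier (V p)" by (simp add: chains_iff faces_0)
    then obtain a where a: "a \<in> rays \<rightarrow> carrier R"
      "x {0} = (\<Oplus>\<^bsub>V p\<^esub>\<alpha>\<in>rays. a \<alpha> \<odot>\<^bsub>V p\<^esub> vertex_gen p \<alpha>)"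
      using vertex_gen_spans[OF p] by blast
    let ?a = "\<lambda>\<alpha>. orient_sign \<alpha> \<otimes>\<^bsub>R\<^esub> a \<alpha>"
    have a': "?a \<in> rays \<rightarrow> carrier R" using a(1) orient_sign_closed by auto
    have "bdry p (chain p ?a) = x {0}" unfolding bdry_chain[OF p a'] a(2)
    proof (rule V.M.finsum_cong'[OF refl])
      fix \<alpha> assume "\<alpha> \<in> rays"
      then have "a \<alpha> \<in> carrier R" using a(1) by blast
      then have "orient_sign \<alpha> \<otimes>\<^bsub>R\<^esub> (orient_sign \<alpha> \<otimes>\<^bsub>R\<^esub> a \<alpha>) = a \<alpha>"
        using orient_sign_closed orient_sign_square by (simp add: m_assoc[symmetric])
      then show "(orient_sign \<alpha> \<otimes>\<^bsub>R\<^esub> (orient_sign \<alpha> \<otimes>\<^bsub>R\<^esub> a \<alpha>)) \<odot>\<^bsub>V p\<^esub> vertex_gen p \<alpha>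
          = a \<alpha> \<odot>\<^bsub>V p\<^esub> vertex_gen p \<alpha>" by simp
    qed (use a(1) vertex_gen_closed[OF p] in auto)
    then have "BM_boundary R \<Sigma> \<omega> p 0 (chain p ?a) = x"
      unfolding BM_boundary_eq[OF chain_closed[OF p a']]
      using x[unfolded chains_iff faces_0] by (intro extensionalityI[of _ "{{0}}"]) simp_all
    then show "x \<in> BM_boundaries R \<Sigma> \<omega> p 0"
      unfolding BM_boundaries_def using chain_closed[OF p a'] by (intro image_eqI[of _ _ "chain p ?a"]) simp_all
  qed
qed

lemma vertex_gen_0_const: "vertex_gen 0 \<alpha> = vertex_gen 0 \<beta>"
  by (simp add: vertex_gen_def gen_def)

text \<open>
  In degree \<open>0\<close> the coefficient module of the vertex is the same free module of rank one as that of
  every ray; the form is the coordinate with respect to the generator.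
\<close>

lemma vertex_0_coordinate:
  "\<exists>k\<in>linear_maps R (V 0) (ring_module R). \<forall>\<alpha>\<in>rays. k (vertex_gen 0 \<alpha>) = \<one>\<^bsub>R\<^esub>"
proof -
  obtain \<beta> where \<beta>: "\<beta> \<in> rays" using rays_nonempty by blast
  interpret V: module R "V 0" by (rule module_F)
  let ?E = "vertex_gen 0 \<beta>"
  have E: "?E \<in> carrier (V 0)" by (rule vertex_gen_closed[OF _ \<beta>]) simp
  have FZ: "FZ \<Sigma> 0 {0} = FZ \<Sigma> 0 \<beta>" unfolding FZ_0[OF vertex_in] FZ_0[OF rayD(1)[OF \<beta>]] by (rule refl)
  have span: "\<exists>r\<in>carrier R. x = r \<odot>\<^bsub>V 0\<^esub> ?E" if "x \<in> carrier (V 0)" for x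
    using ray_gen_spans[of 0 \<beta> x] \<beta> that unfolding ray_gen_def vertex_gen_def F_lower_def FZ by simp
  have inj: "r = t" if "r \<in> carrier R" "t \<in> carrier R" "r \<odot>\<^bsub>V 0\<^esub> ?E = t \<odot>\<^bsub>V 0\<^esub> ?E" for r t
    using ray_gen_inj[of 0 \<beta> r t] \<beta> that unfolding ray_gen_def vertex_gen_def F_lower_def FZ by simp
  define k where "k = (\<lambda>x\<in>carrier (V 0). THE r. r \<in> carrier R \<and> x = r \<odot>\<^bsub>V 0\<^esub> ?E)"
  have k: "k (r \<odot>\<^bsub>V 0\<^esub> ?E) = r" if r: "r \<in> carrier R" for r
  proof -
    have "(THE t. t \<in> carrier R \<and> r \<odot>\<^bsub>V 0\<^esub> ?E = t \<odot>\<^bsub>V 0\<^esub> ?E) = r"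
      by (rule the_equality) (simp add: r, elim conjE, erule (1) inj[OF r, symmetric])
    then show ?thesis unfolding k_def using E r by simp
  qed
  have "k \<in> linear_maps R (V 0) (ring_module R)"
  proof (rule linear_mapsI)
    fix x assume "x \<in> carrier (V 0)"
    then obtain r where r: "r \<in> carrier R" "x = r \<odot>\<^bsub>V 0\<^esub> ?E" using span by blast
    then show "k x \<in> carrier (ring_module R)" by (simp add: k ring_module_def)
    fix t assume t: "t \<in> carrier R"
    have "t \<odot>\<^bsub>V 0\<^esub> x = (t \<otimes>\<^bsub>R\<^esub> r) \<odot>\<^bsub>V 0\<^esub> ?E" using r t E by (simp add: V.smult_assoc1)
    then show "k (t \<odot>\<^bsub>V 0\<^esub> x) = t \<odot>\<^bsub>ring_module R\<^esub> k x" using r t by (simp add: k ring_module_def)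
  next
    fix x y assume "x \<in> carrier (V 0)" "y \<in> carrier (V 0)"
    then obtain r t where r: "r \<in> carrier R" "x = r \<odot>\<^bsub>V 0\<^esub> ?E" and t: "t \<in> carrier R" "y = t \<odot>\<^bsub>V 0\<^esub> ?E"
      using span by blast
    have "x \<oplus>\<^bsub>V 0\<^esub> y = (r \<oplus>\<^bsub>R\<^esub> t) \<odot>\<^bsub>V 0\<^esub> ?E" using r t E by (simp add: V.smult_l_distr)
    then show "k (x \<oplus>\<^bsub>V 0\<^esub> y) = k x \<oplus>\<^bsub>ring_module R\<^esub> k y" using r t by (simp add: k ring_module_def)
  qed (simp add: k_def)
  moreover have "k (vertex_gen 0 \<alpha>) = \<one>\<^bsub>R\<^esub>" for \<alpha>
    using k[OF one_closed] E vertex_gen_0_const[of \<alpha> \<beta>] by simp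
  ultimately show ?thesis by blast
qed

text \<open>
  All generators \<open>vertex_gen 0 \<alpha>\<close> are equal, so the boundary is the signed sum of the coordinates
  times a free generator.
\<close>

lemma bdry_0_chain:
  assumes a: "a \<in> rays \<rightarrow> carrier R"
  shows "bdry 0 (chain 0 a) = \<zero>\<^bsub>V 0\<^esub> \<longleftrightarrow> (\<Oplus>\<^bsub>R\<^esub>\<alpha>\<in>rays. orient_sign \<alpha> \<otimes>\<^bsub>R\<^esub> a \<alpha>) = \<zero>\<^bsub>R\<^esub>" (is "_ \<longleftrightarrow> ?s = _")
proof -
  obtain \<beta> where \<beta>: "\<beta> \<in> rays" using rays_nonempty by blast
  interpret V: module R "V 0" by (rule module_F)
  have E: "vertex_gen 0 \<beta> \<in> carrier (V 0)" by (rule vertex_gen_closed[OF _ \<beta>]) simp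
  have c: "orient_sign \<alpha> \<otimes>\<^bsub>R\<^esub> a \<alpha> \<in> carrier R" if "\<alpha> \<in> rays" for \<alpha>
    using orient_sign_closed a that by auto
  have R: "module R (ring_module R)" by (rule module_ring_module[OF is_cring])
  have l: "(\<lambda>r\<in>carrier (ring_module R). r \<odot>\<^bsub>V 0\<^esub> vertex_gen 0 \<beta>) \<in> linear_maps R (ring_module R) (V 0)"
    by (rule restrict_linear_mapsI[OF R]) (simp_all add: ring_module_def E V.smult_l_distr V.smult_assoc1)
  have s: "?s \<in> carrier R" using c by (intro finsum_closed) auto
  have "?s \<odot>\<^bsub>V 0\<^esub> vertex_gen 0 \<beta> =
      (\<lambda>r\<in>carrier (ring_module R). r \<odot>\<^bsub>V 0\<^esub> vertex_gen 0 \<beta>)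
        (finsum (ring_module R) (\<lambda>\<alpha>. orient_sign \<alpha> \<otimes>\<^bsub>R\<^esub> a \<alpha>) rays)"
    using s c by (subst finsum_ring_module[OF is_cring]) (auto simp: ring_module_def)
  also have "\<dots> = (\<Oplus>\<^bsub>V 0\<^esub>\<alpha>\<in>rays. (\<lambda>r\<in>carrier (ring_module R). r \<odot>\<^bsub>V 0\<^esub> vertex_gen 0 \<beta>)
        (orient_sign \<alpha> \<otimes>\<^bsub>R\<^esub> a \<alpha>))"
    by (rule linear_maps_finsum[OF R module_F l]) (simp add: c ring_module_def)
  also have "\<dots> = bdry 0 (chain 0 a)"
    unfolding bdry_chain[OF zero_le_one a]
  proof (rule V.M.finsum_cong'[OF refl])
    fix \<alpha> assume \<alpha>: "\<alpha> \<in> rays"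
    show "(\<lambda>r\<in>carrier (ring_module R). r \<odot>\<^bsub>V 0\<^esub> vertex_gen 0 \<beta>) (orient_sign \<alpha> \<otimes>\<^bsub>R\<^esub> a \<alpha>) =
        (orient_sign \<alpha> \<otimes>\<^bsub>R\<^esub> a \<alpha>) \<odot>\<^bsub>V 0\<^esub> vertex_gen 0 \<alpha>"
      unfolding vertex_gen_0_const[of \<alpha> \<beta>] using c[OF \<alpha>] by (simp add: ring_module_def)
  qed (use c vertex_gen_closed[OF zero_le_one] in auto)
  finally have e: "bdry 0 (chain 0 a) = ?s \<odot>\<^bsub>V 0\<^esub> vertex_gen 0 \<beta>" ..
  show ?thesis
  proof
    assume "bdry 0 (chain 0 a) = \<zero>\<^bsub>V 0\<^esub>"
    then show "?s = \<zero>\<^bsub>R\<^esub>" using vertex_gen_free_0[OF \<beta> s] e by simp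
  next
    assume "?s = \<zero>\<^bsub>R\<^esub>"
    then show "bdry 0 (chain 0 a) = \<zero>\<^bsub>V 0\<^esub>" unfolding e using E by simp
  qed
qed

subsection \<open>The fundamental chain\<close>

lemma weights:
  assumes "\<alpha> \<in> rays"
  shows "w \<alpha> \<in> carrier R" and "b \<in> carrier R \<Longrightarrow> w \<alpha> \<otimes>\<^bsub>R\<^esub> b = \<zero>\<^bsub>R\<^esub> \<Longrightarrow> b = \<zero>\<^bsub>R\<^esub>"
proof -
  have "w \<alpha> \<in> carrier R \<and> (\<forall>b\<in>carrier R. w \<alpha> \<otimes>\<^bsub>R\<^esub> b = \<zero>\<^bsub>R\<^esub> \<longrightarrow> b = \<zero>\<^bsub>R\<^esub>)"
    using conjunct1[OF bal[unfolded balanced_def weight_function_def dim_one]] assms by (rule bspec)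
  then show "w \<alpha> \<in> carrier R" and "b \<in> carrier R \<Longrightarrow> w \<alpha> \<otimes>\<^bsub>R\<^esub> b = \<zero>\<^bsub>R\<^esub> \<Longrightarrow> b = \<zero>\<^bsub>R\<^esub>"
    by simp_all
qed

lemma w_closed: "w \<in> rays \<rightarrow> carrier R"
  by (rule funcsetI) (rule weights(1))

lemma weight_cancel:
  assumes "\<alpha> \<in> rays" "b \<in> carrier R" "c \<in> carrier R" "w \<alpha> \<otimes>\<^bsub>R\<^esub> b = w \<alpha> \<otimes>\<^bsub>R\<^esub> c"
  shows "b = c"
proof -
  have "w \<alpha> \<otimes>\<^bsub>R\<^esub> (b \<oplus>\<^bsub>R\<^esub> \<ominus>\<^bsub>R\<^esub> c) = \<zero>\<^bsub>R\<^esub>"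
    using assms weights(1)[OF assms(1)] by (simp add: r_distr r_minus r_neg)
  then have "b \<oplus>\<^bsub>R\<^esub> \<ominus>\<^bsub>R\<^esub> c = \<zero>\<^bsub>R\<^esub>" using weights(2)[OF assms(1)] assms by simp
  then show ?thesis using assms(2,3) by (metis add.inv_closed minus_equality minus_minus)
qed

lemma Lam_eq: "Lam R \<Sigma> \<omega> \<alpha> = ray_gen 1 \<alpha>"
  by (simp add: Lam_def ray_gen_def gen_def dim_one)

lemma fund_chain_eq: "fund_chain R \<Sigma> \<omega> w = chain 1 w"
  unfolding fund_chain_def chain_def dim_one Lam_eq by (rule refl)

lemma fund_cycle: "chain 1 w \<in> BM_cycles R \<Sigma> \<omega> 1 1"
  using bal unfolding balanced_def dim_one fund_chain_eq by blast

lemma balancing: "(\<Oplus>\<^bsub>V 1\<^esub>\<alpha>\<in>rays. (orient_sign \<alpha> \<otimes>\<^bsub>R\<^esub> w \<alpha>) \<odot>\<^bsub>V 1\<^esub> vertex_gen 1 \<alpha>) = \<zero>\<^bsub>V 1\<^esub>"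
  using fund_cycle unfolding cycles_1 bdry_chain[OF order_refl w_closed] by blast

lemma chain_add:
  assumes "p \<le> 1" "a \<in> rays \<rightarrow> carrier R" "b \<in> rays \<rightarrow> carrier R"
  shows "chain p (\<lambda>\<alpha>. a \<alpha> \<oplus>\<^bsub>R\<^esub> b \<alpha>) = chain p a \<oplus>\<^bsub>BM_chains R \<Sigma> p 1\<^esub> chain p b"
  unfolding chains_ops
proof (unfold chain_def, rule restrict_ext)
  fix \<alpha> assume \<alpha>: "\<alpha> \<in> rays"
  interpret M: module R "F p \<alpha>" by (rule module_F)
  show "(a \<alpha> \<oplus>\<^bsub>R\<^esub> b \<alpha>) \<odot>\<^bsub>F p \<alpha>\<^esub> ray_gen p \<alpha> =
    (\<lambda>\<alpha>\<in>rays. a \<alpha> \<odot>\<^bsub>F p \<alpha>\<^esub> ray_gen p \<alpha>) \<alpha> \<oplus>\<^bsub>F p \<alpha>\<^esub> (\<lambda>\<alpha>\<in>rays. b \<alpha> \<odot>\<^bsub>F p \<alpha>\<^esub> ray_gen p \<alpha>) \<alpha>"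
    using funcset_mem[OF assms(2) \<alpha>] funcset_mem[OF assms(3) \<alpha>] ray_gen_closed[OF assms(1) \<alpha>] \<alpha>
    by (simp add: M.smult_l_distr)
qed

lemma chain_smult:
  assumes "p \<le> 1" "a \<in> rays \<rightarrow> carrier R" "r \<in> carrier R"
  shows "chain p (\<lambda>\<alpha>. r \<otimes>\<^bsub>R\<^esub> a \<alpha>) = r \<odot>\<^bsub>BM_chains R \<Sigma> p 1\<^esub> chain p a"
  unfolding chains_ops
proof (unfold chain_def, rule restrict_ext)
  fix \<alpha> assume \<alpha>: "\<alpha> \<in> rays"
  interpret M: module R "F p \<alpha>" by (rule module_F)
  show "(r \<otimes>\<^bsub>R\<^esub> a \<alpha>) \<odot>\<^bsub>F p \<alpha>\<^esub> ray_gen p \<alpha> =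
    r \<odot>\<^bsub>F p \<alpha>\<^esub> (\<lambda>\<alpha>\<in>rays. a \<alpha> \<odot>\<^bsub>F p \<alpha>\<^esub> ray_gen p \<alpha>) \<alpha>"
    using funcset_mem[OF assms(2) \<alpha>] assms(3) ray_gen_closed[OF assms(1) \<alpha>] \<alpha>
    by (simp add: M.smult_assoc1)
qed

subsection \<open>Cochains and the cap product\<close>

abbreviation "forms p \<equiv> linear_maps R (V p) (ring_module R)"

lemma form_closed: "f \<in> forms p \<Longrightarrow> x \<in> carrier (V p) \<Longrightarrow> f x \<in> carrier R"
  using linear_mapsD(1)[of f R "V p" "ring_module R" x] by (simp add: ring_module_def)

lemma module_cochains: "module R (cochains R \<Sigma> p q)"
  unfolding cochains_def F_upper_def
  by (rule module_sum_module[OF is_cring module_dual_module[OF module_F]])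

lemma cochains_0_iff:
  "u \<in> carrier (cochains R \<Sigma> p 0) \<longleftrightarrow> u \<in> extensional {{0}} \<and> u {0} \<in> forms p"
  by (auto simp: cochains_def sum_module_def PiE_def compact_faces_0 F_upper_def dual_module_def)

lemma cochains_0_ops:
  "x \<in> carrier (V p) \<Longrightarrow> (u \<oplus>\<^bsub>cochains R \<Sigma> p 0\<^esub> u') {0} x = u {0} x \<oplus>\<^bsub>R\<^esub> u' {0} x"
  "x \<in> carrier (V p) \<Longrightarrow> (r \<odot>\<^bsub>cochains R \<Sigma> p 0\<^esub> u) {0} x = r \<otimes>\<^bsub>R\<^esub> u {0} x"
  by (simp_all add: cochains_def sum_module_def compact_faces_0 F_upper_def dual_module_def)

text \<open>
  The vertex is the only compact cone, so there are no cochains in positive degree and every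
  cochain is a cocycle.
\<close>

lemma cocycle_module_eq: "cocycle_module R \<Sigma> \<omega> p q = cochains R \<Sigma> p q"
proof -
  have "compact_faces \<Sigma> (q + 1) = {}" by (rule compact_faces_pos) simp
  then have "cocycles R \<Sigma> \<omega> p q = carrier (cochains R \<Sigma> p q)"
    unfolding cocycles_def coboundary_def cochains_def sum_module_def by (simp add: restrict_def)
  then show ?thesis unfolding cocycle_module_def by simp
qed

lemma coboundaries_eq: "q \<le> 1 \<Longrightarrow> coboundaries R \<Sigma> \<omega> p q = {\<zero>\<^bsub>cochains R \<Sigma> p q\<^esub>}"
proof -
  assume "q \<le> 1"
  then consider "q = 0" | "q = 1" by linarith
  then show ?thesis
  proof cases
    case 1
    then show ?thesis by (simp add: coboundaries_def)
  next
    case 2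
    interpret C: module R "cochains R \<Sigma> p 0" by (rule module_cochains)
    have ne: "carrier (cochains R \<Sigma> p 0) \<noteq> {}" using C.M.zero_closed by blast
    have e: "compact_faces \<Sigma> 1 = {}" by (rule compact_faces_pos) simp
    have z: "coboundary R \<Sigma> \<omega> p 0 u = \<zero>\<^bsub>cochains R \<Sigma> p 1\<^esub>" for u
      by (simp add: coboundary_def cochains_def sum_module_def e restrict_def)
    have "coboundaries R \<Sigma> \<omega> p 1 = coboundary R \<Sigma> \<omega> p 0 ` carrier (cochains R \<Sigma> p 0)"
      by (simp add: coboundaries_def One_nat_def)
    then show ?thesis unfolding 2 using ne by (auto simp: z)
  qed
qed

lemma rho_linear:
  assumes \<alpha>: "\<alpha> \<in> rays" and f: "f \<in> forms p"
  shows "rho R \<Sigma> p {0} \<alpha> f \<in> linear_maps R (F p \<alpha>) (ring_module R)"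
  unfolding rho_def
  by (rule restrict_linear_mapsI[OF module_F])
    (simp_all add: linear_mapsD(1-3)[OF iota_linear[OF \<alpha>]] linear_mapsD(1-3)[OF f])

lemma rho_ray_gen:
  assumes "p \<le> 1" "\<alpha> \<in> rays"
  shows "rho R \<Sigma> p {0} \<alpha> f (ray_gen p \<alpha>) = f (vertex_gen p \<alpha>)"
  by (simp add: rho_def ray_gen_closed[OF assms] iota_ray_gen[OF assms])

lemma contraction_fundamental:
  assumes p: "p \<le> 1" and \<alpha>: "\<alpha> \<in> rays" and f: "f \<in> forms p"
  shows "contraction R (LZ \<alpha>) p 1 (rho R \<Sigma> p {0} \<alpha> f) (Lam R \<Sigma> \<omega> \<alpha>) =
    f (vertex_gen p \<alpha>) \<odot>\<^bsub>F (1 - p) \<alpha>\<^esub> ray_gen (1 - p) \<alpha>"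
proof -
  have x: "ray_gen 1 \<alpha> \<in> carrier (tensor R (ext_power 1 (LZ \<alpha>)))"
    using ray_gen_closed[OF order_refl \<alpha>] unfolding F_lower_def FZ_ray[OF \<alpha>] .
  have F: "F p \<alpha> = tensor R (ext_power p (LZ \<alpha>))" for p
    unfolding F_lower_def FZ_ray[OF \<alpha>] by (rule refl)
  have E: "pure_tensor R (ext_power 0 (LZ \<alpha>)) (wedge []) = ray_gen 0 \<alpha>"
    unfolding ray_gen_def FZ_ray[OF \<alpha>] by (simp add: gen_def)
  have v: "f (vertex_gen p \<alpha>) \<in> carrier R" by (rule form_closed[OF f vertex_gen_closed[OF p \<alpha>]])
  consider "p = 0" | "p = 1" using p by linarith
  then show ?thesis
  proof cases
    case 1
    have r: "rho R \<Sigma> 0 {0} \<alpha> f (ray_gen 0 \<alpha>) = f (vertex_gen 0 \<alpha>)" by (rule rho_ray_gen[OF _ \<alpha>]) simp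
    have "contraction R (LZ \<alpha>) 0 1 (rho R \<Sigma> 0 {0} \<alpha> f) (ray_gen 1 \<alpha>) =
        rho R \<Sigma> 0 {0} \<alpha> f (pure_tensor R (ext_power 0 (LZ \<alpha>)) (wedge []))
          \<odot>\<^bsub>tensor R (ext_power 1 (LZ \<alpha>))\<^esub> ray_gen 1 \<alpha>"
      by (rule contraction_by_scalar[OF is_cring _ x]) (use v r 1 in \<open>simp add: E\<close>)
    then show ?thesis unfolding 1 Lam_eq E r F diff_zero .
  next
    case 2
    have "contraction R (LZ \<alpha>) 1 1 (rho R \<Sigma> 1 {0} \<alpha> f) (ray_gen 1 \<alpha>) =
        rho R \<Sigma> 1 {0} \<alpha> f (ray_gen 1 \<alpha>) \<odot>\<^bsub>tensor R (ext_power 0 (LZ \<alpha>))\<^esub>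
          pure_tensor R (ext_power 0 (LZ \<alpha>)) (wedge [])"
      by (rule contraction_by_form[OF is_cring _ x]) (use rho_linear[OF \<alpha> f] 2 F in simp)
    then show ?thesis unfolding 2 Lam_eq E rho_ray_gen[OF order_refl \<alpha>] F diff_self_eq_0 .
  qed
qed

text \<open>
  The only pair of a compact cone and a ray that contributes to the value at \<open>\<tau>\<close> is the
  vertex together with \<open>\<tau>\<close> itself.
\<close>

lemma cap_0:
  assumes p: "p \<le> 1" and f: "u {0} \<in> forms p"
  shows "cap R \<Sigma> \<omega> w p 0 u = chain (1 - p) (\<lambda>\<alpha>. w \<alpha> \<otimes>\<^bsub>R\<^esub> u {0} (vertex_gen p \<alpha>))"
  unfolding cap_def Let_def dim_one diff_zero chain_def
proof (rule restrict_ext)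
  fix \<tau> assume \<tau>: "\<tau> \<in> rays"
  interpret M: module R "F (1 - p) \<tau>" by (rule module_F)
  have p': "1 - p \<le> 1" by simp
  note g = ray_gen_closed[OF p' \<tau>]
  have v: "u {0} (vertex_gen p \<tau>) \<in> carrier R" by (rule form_closed[OF f vertex_gen_closed[OF p \<tau>]])
  have "\<tau> face_of \<alpha> \<longleftrightarrow> \<alpha> = \<tau>" if "\<alpha> \<in> rays" for \<alpha>
    using ray_maximal[OF \<tau>] rayD(1)[OF that] by blast
  then have S: "{(\<gamma>, \<alpha>). \<gamma> \<in> compact_faces \<Sigma> 0 \<and> \<alpha> \<in> rays \<and> \<gamma> face_of \<alpha> \<and> \<tau> face_of \<alpha>} = {({0}, \<tau>)}"
    using \<tau> vertex_face[OF rayD(1)[OF \<tau>]] by (auto simp: compact_faces_0)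
  have val: "w \<tau> \<odot>\<^bsub>F (1 - p) \<tau>\<^esub> iota R \<Sigma> (1 - p) \<tau> \<tau>
      (contraction R (LZ \<tau>) p 1 (rho R \<Sigma> p {0} \<tau> (u {0})) (Lam R \<Sigma> \<omega> \<tau>)) =
      (w \<tau> \<otimes>\<^bsub>R\<^esub> u {0} (vertex_gen p \<tau>)) \<odot>\<^bsub>F (1 - p) \<tau>\<^esub> ray_gen (1 - p) \<tau>"
    unfolding contraction_fundamental[OF p \<tau> f]
    using g v weights(1)[OF \<tau>] by (simp add: iota_self M.smult_assoc1)
  have cl: "(w \<tau> \<otimes>\<^bsub>R\<^esub> u {0} (vertex_gen p \<tau>)) \<odot>\<^bsub>F (1 - p) \<tau>\<^esub> ray_gen (1 - p) \<tau> \<in> carrier (F (1 - p) \<tau>)"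
    using g v weights(1)[OF \<tau>] by simp
  show "finsum (F (1 - p) \<tau>) (\<lambda>(\<gamma>, \<alpha>). w \<alpha> \<odot>\<^bsub>F (1 - p) \<tau>\<^esub> iota R \<Sigma> (1 - p) \<alpha> \<tau>
            (contraction R (LZ \<alpha>) p 1 (rho R \<Sigma> p \<gamma> \<alpha> (u \<gamma>)) (Lam R \<Sigma> \<omega> \<alpha>)))
         {(\<gamma>, \<alpha>). \<gamma> \<in> compact_faces \<Sigma> 0 \<and> \<alpha> \<in> rays \<and> \<gamma> face_of \<alpha> \<and> \<tau> face_of \<alpha>}
     = (w \<tau> \<otimes>\<^bsub>R\<^esub> u {0} (vertex_gen p \<tau>)) \<odot>\<^bsub>F (1 - p) \<tau>\<^esub> ray_gen (1 - p) \<tau>"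
    unfolding S using cl by (simp add: val)
qed

section \<open>Poincare duality\<close>

lemma cap_weights_closed:
  assumes "p \<le> 1" "f \<in> forms p"
  shows "(\<lambda>\<alpha>. w \<alpha> \<otimes>\<^bsub>R\<^esub> f (vertex_gen p \<alpha>)) \<in> rays \<rightarrow> carrier R"
  using weights(1) form_closed[OF assms(2) vertex_gen_closed[OF assms(1)]] by simp

text \<open>
  For \<open>p = 0\<close> this boundary is a multiple of the left-hand side of the balancing relation; for \<open>p = 1\<close> it
  vanishes because its coefficient is the form \<open>f\<close> applied to that left-hand side.
\<close>

lemma cap_is_cycle:
  assumes p: "p \<le> 1" and f: "f \<in> forms p"
  shows "bdry (1 - p) (chain (1 - p) (\<lambda>\<alpha>. w \<alpha> \<otimes>\<^bsub>R\<^esub> f (vertex_gen p \<alpha>))) = \<zero>\<^bsub>V (1 - p)\<^esub>"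
proof -
  note a = cap_weights_closed[OF p f]
  consider "p = 0" | "p = 1" using p by linarith
  then show ?thesis
  proof cases
    case 1
    interpret V: module R "V 1" by (rule module_F)
    obtain \<beta> where \<beta>: "\<beta> \<in> rays" using rays_nonempty by blast
    let ?r = "f (vertex_gen 0 \<beta>)"
    have r: "?r \<in> carrier R" using form_closed[OF f vertex_gen_closed[OF p \<beta>]] 1 by simp
    have "bdry 1 (chain 1 (\<lambda>\<alpha>. w \<alpha> \<otimes>\<^bsub>R\<^esub> f (vertex_gen 0 \<alpha>))) =
        (\<Oplus>\<^bsub>V 1\<^esub>\<alpha>\<in>rays. (orient_sign \<alpha> \<otimes>\<^bsub>R\<^esub> (w \<alpha> \<otimes>\<^bsub>R\<^esub> f (vertex_gen 0 \<alpha>))) \<odot>\<^bsub>V 1\<^esub> vertex_gen 1 \<alpha>)"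
      using bdry_chain[OF order_refl a] unfolding 1 .
    also have "\<dots> = (\<Oplus>\<^bsub>V 1\<^esub>\<alpha>\<in>rays. ?r \<odot>\<^bsub>V 1\<^esub> ((orient_sign \<alpha> \<otimes>\<^bsub>R\<^esub> w \<alpha>) \<odot>\<^bsub>V 1\<^esub> vertex_gen 1 \<alpha>))"
    proof (rule V.M.finsum_cong'[OF refl])
      fix \<alpha> assume \<alpha>: "\<alpha> \<in> rays"
      have "orient_sign \<alpha> \<otimes>\<^bsub>R\<^esub> (w \<alpha> \<otimes>\<^bsub>R\<^esub> ?r) = ?r \<otimes>\<^bsub>R\<^esub> (orient_sign \<alpha> \<otimes>\<^bsub>R\<^esub> w \<alpha>)"
        using r weights(1)[OF \<alpha>] orient_sign_closed by (simp add: m_ac)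
      then show "(orient_sign \<alpha> \<otimes>\<^bsub>R\<^esub> (w \<alpha> \<otimes>\<^bsub>R\<^esub> f (vertex_gen 0 \<alpha>))) \<odot>\<^bsub>V 1\<^esub> vertex_gen 1 \<alpha> =
          ?r \<odot>\<^bsub>V 1\<^esub> ((orient_sign \<alpha> \<otimes>\<^bsub>R\<^esub> w \<alpha>) \<odot>\<^bsub>V 1\<^esub> vertex_gen 1 \<alpha>)"
        unfolding vertex_gen_0_const[of \<alpha> \<beta>]
        using r weights(1)[OF \<alpha>] orient_sign_closed vertex_gen_closed[OF order_refl \<alpha>]
        by (simp add: V.smult_assoc1)
    qed (use r weights(1) orient_sign_closed vertex_gen_closed[OF order_refl] in auto)
    also have "\<dots> = ?r \<odot>\<^bsub>V 1\<^esub> (\<Oplus>\<^bsub>V 1\<^esub>\<alpha>\<in>rays. (orient_sign \<alpha> \<otimes>\<^bsub>R\<^esub> w \<alpha>) \<odot>\<^bsub>V 1\<^esub> vertex_gen 1 \<alpha>)"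
      by (rule V.finsum_smult_ldistr[symmetric, OF finite_rays r])
        (use weights(1) orient_sign_closed vertex_gen_closed[OF order_refl] in auto)
    also have "\<dots> = \<zero>\<^bsub>V 1\<^esub>" unfolding balancing using r by simp
    finally show ?thesis unfolding 1 diff_zero .
  next
    case 2
    interpret V: module R "V 1" by (rule module_F)
    interpret R: module R "ring_module R" by (rule module_ring_module[OF is_cring])
    note f = f[unfolded 2] and a = a[unfolded 2]
    have sw: "orient_sign \<alpha> \<otimes>\<^bsub>R\<^esub> w \<alpha> \<in> carrier R" if "\<alpha> \<in> rays" for \<alpha>
      using weights(1)[OF that] orient_sign_closed by simp
    have v: "f (vertex_gen 1 \<alpha>) \<in> carrier R" if "\<alpha> \<in> rays" for \<alpha>
      by (rule form_closed[OF f vertex_gen_closed[OF order_refl that]])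
    have "(\<Oplus>\<^bsub>R\<^esub>\<alpha>\<in>rays. orient_sign \<alpha> \<otimes>\<^bsub>R\<^esub> (w \<alpha> \<otimes>\<^bsub>R\<^esub> f (vertex_gen 1 \<alpha>))) =
        (\<Oplus>\<^bsub>R\<^esub>\<alpha>\<in>rays. (orient_sign \<alpha> \<otimes>\<^bsub>R\<^esub> w \<alpha>) \<otimes>\<^bsub>R\<^esub> f (vertex_gen 1 \<alpha>))"
      by (rule finsum_cong'[OF refl]) (use weights(1) orient_sign_closed v in \<open>auto simp: m_assoc\<close>)
    also have "\<dots> = f \<zero>\<^bsub>V 1\<^esub>"
      using form_finsum[where I = rays and c = "\<lambda>\<alpha>. orient_sign \<alpha> \<otimes>\<^bsub>R\<^esub> w \<alpha>" and x = "vertex_gen 1",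
          OF module_F f sw vertex_gen_closed[OF order_refl]]
      unfolding balancing by (rule sym)
    also have "\<dots> = \<zero>\<^bsub>R\<^esub>"
      using linear_maps_zero[OF module_F R.module_axioms f] by (simp add: ring_module_def)
    finally show ?thesis unfolding 2 diff_self_eq_0 bdry_0_chain[OF a] .
  qed
qed

lemma form_eqI:
  assumes p: "p \<le> 1" and f: "f \<in> forms p" and g: "g \<in> forms p"
    and e: "\<And>\<alpha>. \<alpha> \<in> rays \<Longrightarrow> f (vertex_gen p \<alpha>) = g (vertex_gen p \<alpha>)"
  shows "f = g"
proof -
  interpret S: scalar_extension R "FZ \<Sigma> p {0}" by (rule scalar_extension_FZ)
  show ?thesis
  proof (rule S.linear_maps_eqI[OF module_ring_module[OF is_cring] _ _ FZ_vertex_hull[OF p]])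
    fix a assume "a \<in> gen p ` rays"
    then obtain \<alpha> where \<alpha>: "\<alpha> \<in> rays" "a = gen p \<alpha>" by blast
    show "f (S.pure a) = g (S.pure a)" using e[OF \<alpha>(1)] unfolding \<alpha>(2) vertex_gen_def .
  qed (use f g in \<open>simp_all add: F_lower_def\<close>)
qed

text \<open>
  The cap product is linear and maps into the cycles. It is injective, since a form is determined by its
  values on the generators and the weights can be cancelled. What remains is surjectivity, expressed
  here in coordinates.
\<close>

lemma cap_map_iso_iff:
  assumes p: "p \<le> 1"
  shows "cap_map R \<Sigma> \<omega> w p 0 \<in> module_isos R (cohomology R \<Sigma> \<omega> p 0) (BM_homology R \<Sigma> \<omega> (1 - p) 1) \<longleftrightarrow>
    (\<forall>a\<in>rays \<rightarrow> carrier R. bdry (1 - p) (chain (1 - p) a) = \<zero>\<^bsub>V (1 - p)\<^esub> \<longrightarrow>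
      (\<exists>f\<in>forms p. \<forall>\<alpha>\<in>rays. a \<alpha> = w \<alpha> \<otimes>\<^bsub>R\<^esub> f (vertex_gen p \<alpha>)))" (is "_ \<longleftrightarrow> ?surj")
proof -
  let ?C = "cochains R \<Sigma> p 0" and ?Z = "BM_cycle_module R \<Sigma> \<omega> (1 - p) 1" and ?cap = "cap R \<Sigma> \<omega> w p 0"
  let ?a = "\<lambda>u :: ('n, 'r) cochain. \<lambda>\<alpha>. w \<alpha> \<otimes>\<^bsub>R\<^esub> u {0} (vertex_gen p \<alpha>)"
  have p': "1 - p \<le> 1" by simp
  have u: "u {0} \<in> forms p" if "u \<in> carrier ?C" for u using that cochains_0_iff by blast
  have cap: "?cap u = chain (1 - p) (?a u)" if "u \<in> carrier ?C" for u
    by (rule cap_0[of p u, OF p u[OF that]])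
  have a: "?a u \<in> rays \<rightarrow> carrier R" if "u \<in> carrier ?C" for u
    by (rule cap_weights_closed[OF p u[OF that]])
  have v: "u {0} (vertex_gen p \<alpha>) \<in> carrier R" if "u \<in> carrier ?C" "\<alpha> \<in> rays" for u \<alpha>
    by (rule form_closed[OF u[OF that(1)] vertex_gen_closed[OF p that(2)]])
  have carrier_Z: "carrier ?Z = BM_cycles R \<Sigma> \<omega> (1 - p) 1" by (simp add: BM_cycle_module_def)
  have cong: "chain q b = chain q c" if "\<And>\<alpha>. \<alpha> \<in> rays \<Longrightarrow> b \<alpha> = c \<alpha>" for q b c
    unfolding chain_def by (rule restrict_ext) (simp add: that)
  interpret C: module R ?C by (rule module_cochains)
  have closed: "?cap x \<in> carrier ?Z" if "x \<in> carrier ?C" for x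
    unfolding carrier_Z cycles_1 cap[OF that]
    using chain_closed[OF p' a[OF that]] cap_is_cycle[OF p u[OF that]] by blast
  have add: "?cap (x \<oplus>\<^bsub>?C\<^esub> y) = ?cap x \<oplus>\<^bsub>?Z\<^esub> ?cap y" if x: "x \<in> carrier ?C" and y: "y \<in> carrier ?C" for x y
  proof -
    have "?cap (x \<oplus>\<^bsub>?C\<^esub> y) = chain (1 - p) (\<lambda>\<alpha>. ?a x \<alpha> \<oplus>\<^bsub>R\<^esub> ?a y \<alpha>)"
      unfolding cap[OF C.M.a_closed[OF x y]]
    proof (rule cong)
      fix \<alpha> assume \<alpha>: "\<alpha> \<in> rays"
      show "?a (x \<oplus>\<^bsub>?C\<^esub> y) \<alpha> = ?a x \<alpha> \<oplus>\<^bsub>R\<^esub> ?a y \<alpha>"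
        unfolding cochains_0_ops(1)[OF vertex_gen_closed[OF p \<alpha>]]
        by (rule r_distr[OF v[OF x \<alpha>] v[OF y \<alpha>] weights(1)[OF \<alpha>]])
    qed
    also have "\<dots> = ?cap x \<oplus>\<^bsub>?Z\<^esub> ?cap y"
      unfolding chain_add[OF p' a[OF x] a[OF y]] cap[OF x] cap[OF y] by (simp add: BM_cycle_module_def)
    finally show ?thesis .
  qed
  have smult: "?cap (r \<odot>\<^bsub>?C\<^esub> x) = r \<odot>\<^bsub>?Z\<^esub> ?cap x" if r: "r \<in> carrier R" and x: "x \<in> carrier ?C" for r x
  proof -
    have "?cap (r \<odot>\<^bsub>?C\<^esub> x) = chain (1 - p) (\<lambda>\<alpha>. r \<otimes>\<^bsub>R\<^esub> ?a x \<alpha>)"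
      unfolding cap[OF C.smult_closed[OF r x]]
    proof (rule cong)
      fix \<alpha> assume \<alpha>: "\<alpha> \<in> rays"
      show "?a (r \<odot>\<^bsub>?C\<^esub> x) \<alpha> = r \<otimes>\<^bsub>R\<^esub> ?a x \<alpha>"
        unfolding cochains_0_ops(2)[OF vertex_gen_closed[OF p \<alpha>]]
        by (rule m_lcomm[OF weights(1)[OF \<alpha>] r v[OF x \<alpha>]])
    qed
    also have "\<dots> = r \<odot>\<^bsub>?Z\<^esub> ?cap x"
      unfolding chain_smult[OF p' a[OF x] r] cap[OF x] by (simp add: BM_cycle_module_def)
    finally show ?thesis .
  qed
  have "cap_map R \<Sigma> \<omega> w p 0 \<in> module_isos R (cohomology R \<Sigma> \<omega> p 0) (BM_homology R \<Sigma> \<omega> (1 - p) 1)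
      \<longleftrightarrow> bij_betw ?cap (carrier ?C) (carrier ?Z)"
    unfolding cap_map_def Let_def dim_one diff_zero cohomology_def BM_homology_def cocycle_module_eq
      coboundaries_eq[OF zero_le_one] boundaries_1
    by (intro induced_map_zero_iso_iff module_cochains module_cycles closed add smult)
  also have "\<dots> \<longleftrightarrow> ?surj"
  proof
    assume b: "bij_betw ?cap (carrier ?C) (carrier ?Z)"
    show ?surj
    proof (intro ballI impI)
      fix b assume b': "b \<in> rays \<rightarrow> carrier R" and z: "bdry (1 - p) (chain (1 - p) b) = \<zero>\<^bsub>V (1 - p)\<^esub>"
      have "chain (1 - p) b \<in> carrier ?Z" unfolding carrier_Z cycles_1 using chain_closed[OF p' b'] z by blast
      then obtain x where x: "x \<in> carrier ?C" "?cap x = chain (1 - p) b"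
        using b unfolding bij_betw_def by (metis (no_types, lifting) imageE)
      then have "\<forall>\<alpha>\<in>rays. ?a x \<alpha> = b \<alpha>" using chain_eq_iff[OF p' a[OF x(1)] b'] cap[OF x(1)] by simp
      then show "\<exists>f\<in>forms p. \<forall>\<alpha>\<in>rays. b \<alpha> = w \<alpha> \<otimes>\<^bsub>R\<^esub> f (vertex_gen p \<alpha>)"
        by (intro bexI[of _ "x {0}"]) (simp_all add: u[OF x(1)])
    qed
  next
    assume surj: ?surj
    have "inj_on ?cap (carrier ?C)"
    proof (rule inj_onI)
      fix x y assume x: "x \<in> carrier ?C" and y: "y \<in> carrier ?C" and "?cap x = ?cap y"
      then have e: "\<forall>\<alpha>\<in>rays. ?a x \<alpha> = ?a y \<alpha>"
        using chain_eq_iff[OF p' a[OF x] a[OF y]] cap[OF x] cap[OF y] by simp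
      have "x {0} = y {0}"
      proof (rule form_eqI[OF p u[OF x] u[OF y]])
        fix \<alpha> assume \<alpha>: "\<alpha> \<in> rays"
        show "x {0} (vertex_gen p \<alpha>) = y {0} (vertex_gen p \<alpha>)"
          by (rule weight_cancel[OF \<alpha> v[OF x \<alpha>] v[OF y \<alpha>] bspec[OF e \<alpha>]])
      qed
      then show "x = y" using x y unfolding cochains_0_iff by (intro extensionalityI[of _ "{{0}}"]) simp_all
    qed
    moreover have "?cap ` carrier ?C = carrier ?Z"
    proof
      show "?cap ` carrier ?C \<subseteq> carrier ?Z" using closed by blast
      show "carrier ?Z \<subseteq> ?cap ` carrier ?C"
      proof
        fix z assume "z \<in> carrier ?Z"
        then have z: "z \<in> carrier (BM_chains R \<Sigma> (1 - p) 1)" "bdry (1 - p) z = \<zero>\<^bsub>V (1 - p)\<^esub>"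
          unfolding carrier_Z cycles_1 by blast+
        obtain b where b: "b \<in> rays \<rightarrow> carrier R" "z = chain (1 - p) b" using chain_surj[OF p' z(1)] by blast
        then obtain f where f: "f \<in> forms p" "\<forall>\<alpha>\<in>rays. b \<alpha> = w \<alpha> \<otimes>\<^bsub>R\<^esub> f (vertex_gen p \<alpha>)"
          using surj z(2) by blast
        let ?u = "\<lambda>\<sigma>\<in>{{0}}. f"
        have uC: "?u \<in> carrier ?C" unfolding cochains_0_iff using f(1) by simp
        have "?cap ?u = z" unfolding cap[OF uC] b(2) by (rule cong) (simp add: f(2))
        then show "z \<in> ?cap ` carrier ?C" using uC by blast
      qed
    qed
    ultimately show "bij_betw ?cap (carrier ?C) (carrier ?Z)" unfolding bij_betw_def by blast
  qed
  finally show ?thesis .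
qed

text \<open>
  Both modules are trivial: there are no compact rays, and every 0-chain is a boundary.
\<close>

lemma cap_map_top_iso:
  assumes p: "p \<le> 1"
  shows "cap_map R \<Sigma> \<omega> w p 1 \<in> module_isos R (cohomology R \<Sigma> \<omega> p 1) (BM_homology R \<Sigma> \<omega> (1 - p) 0)"
proof -
  let ?C = "cochains R \<Sigma> p 1" and ?D = "BM_chains R \<Sigma> (1 - p) 0" and ?cap = "cap R \<Sigma> \<omega> w p 1"
  have p': "1 - p \<le> 1" by simp
  interpret C: quotient R ?C "{\<zero>\<^bsub>?C\<^esub>}"
    using module_cochains submodule_zero[OF module_cochains] by (simp add: quotient_def quotient_axioms_def)
  interpret D: quotient R ?D "carrier ?D"
    using module_chains module.carrier_is_submodule[OF module_chains] by (simp add: quotient_def quotient_axioms_def)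
  have e: "compact_faces \<Sigma> 1 = {}" by (rule compact_faces_pos) simp
  have z: "?cap u = \<zero>\<^bsub>?D\<^esub>" for u
    unfolding cap_def Let_def dim_one chains_ops diff_self_eq_0
  proof (rule restrict_ext)
    fix \<tau>
    interpret M: module R "F (1 - p) \<tau>" by (rule module_F)
    show "finsum (F (1 - p) \<tau>) (\<lambda>(\<gamma>, \<alpha>). w \<alpha> \<odot>\<^bsub>F (1 - p) \<tau>\<^esub> iota R \<Sigma> (1 - p) \<alpha> \<tau>
            (contraction R (LZ \<alpha>) p 1 (rho R \<Sigma> p \<gamma> \<alpha> (u \<gamma>)) (Lam R \<Sigma> \<omega> \<alpha>)))
         {(\<gamma>, \<alpha>). \<gamma> \<in> compact_faces \<Sigma> 1 \<and> \<alpha> \<in> rays \<and> \<gamma> face_of \<alpha> \<and> \<tau> face_of \<alpha>} = \<zero>\<^bsub>F (1 - p) \<tau>\<^esub>"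
      by (simp add: e)
  qed
  have lin: "induced_map ?C {\<zero>\<^bsub>?C\<^esub>} ?D (carrier ?D) ?cap
      \<in> linear_maps R (quot_module ?C {\<zero>\<^bsub>?C\<^esub>}) (quot_module ?D (carrier ?D))"
    by (rule C.induced_map_linear[OF D.quotient_axioms]) (simp_all add: z)
  have "carrier ?C = {\<lambda>_. undefined}" by (simp add: cochains_def sum_module_def e)
  then have qC: "carrier (quot_module ?C {\<zero>\<^bsub>?C\<^esub>}) = {{\<zero>\<^bsub>?C\<^esub>} +>\<^bsub>?C\<^esub> (\<lambda>_. undefined)}"
    unfolding C.carrier_quot by simp
  have "carrier ?D +>\<^bsub>?D\<^esub> x = carrier ?D" if "x \<in> carrier ?D" for x
    using D.M.a_coset_join2[OF that D.ab.a_subgroup that] .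
  then have "(\<lambda>x. carrier ?D +>\<^bsub>?D\<^esub> x) ` carrier ?D = (\<lambda>x. carrier ?D) ` carrier ?D" by (rule image_cong[OF refl])
  also have "\<dots> = {carrier ?D}" using D.M.zero_closed by (intro image_constant)
  finally have qD: "carrier (quot_module ?D (carrier ?D)) = {carrier ?D}" unfolding D.carrier_quot .
  show ?thesis
    unfolding cap_map_def Let_def dim_one diff_self_eq_0 cohomology_def BM_homology_def cocycle_module_eq
      cycle_module_0 coboundaries_eq[OF order_refl] boundaries_0[OF p']
    by (rule linear_map_singletons_iso[OF lin qC qD])
qed

text \<open>
  The isomorphism with \<open>R\<close> is the inverse of \<open>r \<mapsto> r [\<Sigma>, w]\<close>. This map is injective because the weights
  are not zero-divisors and there is at least one ray, so that \<open>r\<close> can be recovered from \<open>r w\<close>; it is onto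
  as soon as the multiples of the fundamental class exhaust the homology.
\<close>

lemma uniquely_balanced_iff:
  "uniquely_balanced R \<Sigma> \<omega> w \<longleftrightarrow>
    (\<forall>a\<in>rays \<rightarrow> carrier R. bdry 1 (chain 1 a) = \<zero>\<^bsub>V 1\<^esub> \<longrightarrow>
      (\<exists>r\<in>carrier R. \<forall>\<alpha>\<in>rays. a \<alpha> = r \<otimes>\<^bsub>R\<^esub> w \<alpha>))" (is "_ \<longleftrightarrow> ?multiples")
proof -
  let ?Z = "BM_cycle_module R \<Sigma> \<omega> 1 1"
  let ?H = "BM_homology R \<Sigma> \<omega> 1 1"
  interpret Z: quotient R ?Z "{\<zero>\<^bsub>?Z\<^esub>}"
    using module_cycles submodule_zero[OF module_cycles] by (simp add: quotient_def quotient_axioms_def)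
  have H: "?H = quot_module ?Z {\<zero>\<^bsub>?Z\<^esub>}" unfolding BM_homology_def boundaries_1 by (rule refl)
  interpret H: module R ?H unfolding H by (rule Z.module_quot)
  have carrier_Z: "carrier ?Z = BM_cycles R \<Sigma> \<omega> 1 1" by (simp add: BM_cycle_module_def)
  have cos: "{\<zero>\<^bsub>?Z\<^esub>} +>\<^bsub>?Z\<^esub> x = {x}" if "x \<in> carrier ?Z" for x
    using that by (simp add: a_r_coset_def')
  have w: "chain 1 w \<in> carrier ?Z" unfolding carrier_Z by (rule fund_cycle)
  let ?c = "fund_class R \<Sigma> \<omega> w"
  have c: "?c = {\<zero>\<^bsub>?Z\<^esub>} +>\<^bsub>?Z\<^esub> chain 1 w"
    unfolding fund_class_def Let_def dim_one fund_chain_eq boundaries_1 by (rule refl)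
  have rw: "(\<lambda>\<alpha>. r \<otimes>\<^bsub>R\<^esub> w \<alpha>) \<in> rays \<rightarrow> carrier R" if "r \<in> carrier R" for r
    using that weights(1) by simp
  have smult: "r \<odot>\<^bsub>?H\<^esub> ?c = {chain 1 (\<lambda>\<alpha>. r \<otimes>\<^bsub>R\<^esub> w \<alpha>)}" if r: "r \<in> carrier R" for r
  proof -
    have "r \<odot>\<^bsub>?H\<^esub> ?c = {r \<odot>\<^bsub>?Z\<^esub> chain 1 w}"
      unfolding H c Z.smult_quot[OF r w] by (rule cos[OF Z.smult_closed[OF r w]])
    then show ?thesis unfolding chain_smult[OF order_refl w_closed r] by (simp add: BM_cycle_module_def)
  qed
  have carrier_H: "carrier ?H = (\<lambda>x. {x}) ` BM_cycles R \<Sigma> \<omega> 1 1"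
    unfolding H Z.carrier_quot carrier_Z[symmetric] by (rule image_cong[OF refl cos])
  have c_in: "?c \<in> carrier ?H" unfolding carrier_H c cos[OF w] by (rule imageI[OF fund_cycle])
  have gen: "carrier ?H = {r \<odot>\<^bsub>?H\<^esub> ?c |r. r \<in> carrier R} \<longleftrightarrow> ?multiples"
  proof
    assume g: "carrier ?H = {r \<odot>\<^bsub>?H\<^esub> ?c |r. r \<in> carrier R}"
    show ?multiples
    proof (intro ballI impI)
      fix a assume a: "a \<in> rays \<rightarrow> carrier R" and z: "bdry 1 (chain 1 a) = \<zero>\<^bsub>V 1\<^esub>"
      have "{chain 1 a} \<in> carrier ?H" unfolding carrier_H
        by (rule imageI) (use cycles_1 chain_closed[OF order_refl a] z in blast)
      then obtain r where r: "r \<in> carrier R" "{chain 1 a} = r \<odot>\<^bsub>?H\<^esub> ?c" unfolding g by blast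
      then have "chain 1 a = chain 1 (\<lambda>\<alpha>. r \<otimes>\<^bsub>R\<^esub> w \<alpha>)" unfolding smult[OF r(1)] by blast
      then show "\<exists>r\<in>carrier R. \<forall>\<alpha>\<in>rays. a \<alpha> = r \<otimes>\<^bsub>R\<^esub> w \<alpha>"
        using chain_eq_iff[OF order_refl a rw[OF r(1)]] r(1) by blast
    qed
  next
    assume m: ?multiples
    have "x \<in> {r \<odot>\<^bsub>?H\<^esub> ?c |r. r \<in> carrier R}" if x: "x \<in> carrier ?H" for x
    proof -
      obtain z where z: "x = {z}" "z \<in> BM_cycles R \<Sigma> \<omega> 1 1" using x unfolding carrier_H by (rule imageE)
      then have z': "z \<in> carrier (BM_chains R \<Sigma> 1 1)" "bdry 1 z = \<zero>\<^bsub>V 1\<^esub>" using cycles_1 by blast+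
      obtain a where a: "a \<in> rays \<rightarrow> carrier R" "z = chain 1 a" using chain_surj[OF order_refl z'(1)] by blast
      then obtain r where r: "r \<in> carrier R" "\<forall>\<alpha>\<in>rays. a \<alpha> = r \<otimes>\<^bsub>R\<^esub> w \<alpha>" using m z'(2) by blast
      have "x = r \<odot>\<^bsub>?H\<^esub> ?c" unfolding z(1) smult[OF r(1)] a(2)
        using chain_eq_iff[OF order_refl a(1) rw[OF r(1)]] r(2) by simp
      then show ?thesis using r(1) by blast
    qed
    then show "carrier ?H = {r \<odot>\<^bsub>?H\<^esub> ?c |r. r \<in> carrier R}" using c_in by auto
  qed
  have R: "module R (ring_module R)" by (rule module_ring_module[OF is_cring])
  let ?f = "\<lambda>r\<in>carrier (ring_module R). r \<odot>\<^bsub>?H\<^esub> ?c"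
  have iso: "module_isos R ?H (ring_module R) \<noteq> {}" if g: "carrier ?H = {r \<odot>\<^bsub>?H\<^esub> ?c |r. r \<in> carrier R}"
  proof -
    have lin: "?f \<in> linear_maps R (ring_module R) ?H"
      by (rule restrict_linear_mapsI[OF R])
        (simp_all add: ring_module_def c_in H.smult_l_distr H.smult_assoc1)
    obtain \<beta> where \<beta>: "\<beta> \<in> rays" using rays_nonempty by blast
    have "r = t" if r: "r \<in> carrier R" and t: "t \<in> carrier R" and e: "r \<odot>\<^bsub>?H\<^esub> ?c = t \<odot>\<^bsub>?H\<^esub> ?c" for r t
    proof -
      have "chain 1 (\<lambda>\<alpha>. r \<otimes>\<^bsub>R\<^esub> w \<alpha>) = chain 1 (\<lambda>\<alpha>. t \<otimes>\<^bsub>R\<^esub> w \<alpha>)"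
        using e unfolding smult[OF r] smult[OF t] by blast
      then have "r \<otimes>\<^bsub>R\<^esub> w \<beta> = t \<otimes>\<^bsub>R\<^esub> w \<beta>" using chain_eq_iff[OF order_refl rw[OF r] rw[OF t]] \<beta> by blast
      then show ?thesis using weight_cancel[OF \<beta> r t] m_comm[OF r weights(1)[OF \<beta>]] m_comm[OF t weights(1)[OF \<beta>]] by simp
    qed
    then have "inj_on ?f (carrier (ring_module R))" by (auto simp: inj_on_def ring_module_def)
    moreover have "?f ` carrier (ring_module R) = carrier ?H" unfolding g by (auto simp: ring_module_def)
    ultimately have "?f \<in> module_isos R (ring_module R) ?H" using lin by (simp add: module_isos_def bij_betw_def)
    from module_isos_inverse[OF R this] show ?thesis by blast
  qed
  show ?thesis unfolding uniquely_balanced_def Let_def dim_one using bal gen iso by blast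
qed

text \<open>
  A form on a free module of rank one is determined by its value \<open>r\<close> on the generator, and \<open>r\<close> is arbitrary.
\<close>

lemma form_on_vertex_0:
  "(\<exists>f\<in>forms 0. \<forall>\<alpha>\<in>rays. a \<alpha> = w \<alpha> \<otimes>\<^bsub>R\<^esub> f (vertex_gen 0 \<alpha>)) \<longleftrightarrow>
    (\<exists>r\<in>carrier R. \<forall>\<alpha>\<in>rays. a \<alpha> = r \<otimes>\<^bsub>R\<^esub> w \<alpha>)"
proof
  assume "\<exists>f\<in>forms 0. \<forall>\<alpha>\<in>rays. a \<alpha> = w \<alpha> \<otimes>\<^bsub>R\<^esub> f (vertex_gen 0 \<alpha>)"
  then obtain f where f: "f \<in> forms 0" "\<forall>\<alpha>\<in>rays. a \<alpha> = w \<alpha> \<otimes>\<^bsub>R\<^esub> f (vertex_gen 0 \<alpha>)" by blast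
  obtain \<beta> where \<beta>: "\<beta> \<in> rays" using rays_nonempty by blast
  have r: "f (vertex_gen 0 \<beta>) \<in> carrier R" by (rule form_closed[OF f(1) vertex_gen_closed[OF zero_le_one \<beta>]])
  have "a \<alpha> = f (vertex_gen 0 \<beta>) \<otimes>\<^bsub>R\<^esub> w \<alpha>" if "\<alpha> \<in> rays" for \<alpha>
    using bspec[OF f(2) that] unfolding vertex_gen_0_const[of \<alpha> \<beta>] m_comm[OF r weights(1)[OF that]] .
  then show "\<exists>r\<in>carrier R. \<forall>\<alpha>\<in>rays. a \<alpha> = r \<otimes>\<^bsub>R\<^esub> w \<alpha>" using r by blast
next
  assume "\<exists>r\<in>carrier R. \<forall>\<alpha>\<in>rays. a \<alpha> = r \<otimes>\<^bsub>R\<^esub> w \<alpha>"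
  then obtain r where r: "r \<in> carrier R" "\<forall>\<alpha>\<in>rays. a \<alpha> = r \<otimes>\<^bsub>R\<^esub> w \<alpha>" by blast
  obtain k where k: "k \<in> forms 0" "\<forall>\<alpha>\<in>rays. k (vertex_gen 0 \<alpha>) = \<one>\<^bsub>R\<^esub>" using vertex_0_coordinate by blast
  let ?f = "r \<odot>\<^bsub>dual_module R (V 0)\<^esub> k"
  have f: "?f \<in> forms 0"
    using module.smult_closed[OF module_dual_module[OF module_F] r(1), of k 0 "{0}"] k(1)
    by (simp add: dual_module_def)
  have "a \<alpha> = w \<alpha> \<otimes>\<^bsub>R\<^esub> ?f (vertex_gen 0 \<alpha>)" if "\<alpha> \<in> rays" for \<alpha>
    using bspec[OF r(2) that] bspec[OF k(2) that] vertex_gen_closed[OF zero_le_one that] r(1)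
      m_comm[OF r(1) weights(1)[OF that]]
    by (simp add: dual_module_def)
  then show "\<exists>f\<in>forms 0. \<forall>\<alpha>\<in>rays. a \<alpha> = w \<alpha> \<otimes>\<^bsub>R\<^esub> f (vertex_gen 0 \<alpha>)" using f by blast
qed

lemma cap_map_unit_iso_iff:
  "cap_map R \<Sigma> \<omega> w 0 0 \<in> module_isos R (cohomology R \<Sigma> \<omega> 0 0) (BM_homology R \<Sigma> \<omega> 1 1) \<longleftrightarrow>
    uniquely_balanced R \<Sigma> \<omega> w"
  using cap_map_iso_iff[OF zero_le_one]
  unfolding uniquely_balanced_iff form_on_vertex_0 diff_zero .

lemma cap_map_forms_iso_iff:
  assumes u: "uniquely_balanced R \<Sigma> \<omega> w"
  shows "cap_map R \<Sigma> \<omega> w 1 0 \<in> module_isos R (cohomology R \<Sigma> \<omega> 1 0) (BM_homology R \<Sigma> \<omega> 0 1) \<longleftrightarrow>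
    (\<forall>\<alpha>\<in>rays. w \<alpha> \<in> Units R)"
proof -
  have "(\<forall>c\<in>rays \<rightarrow> carrier R. (\<Oplus>\<^bsub>R\<^esub>\<alpha>\<in>rays. orient_sign \<alpha> \<otimes>\<^bsub>R\<^esub> c \<alpha>) = \<zero>\<^bsub>R\<^esub> \<longrightarrow>
      (\<exists>u\<in>forms 1. \<forall>\<alpha>\<in>rays. c \<alpha> = w \<alpha> \<otimes>\<^bsub>R\<^esub> u (vertex_gen 1 \<alpha>)))
    \<longleftrightarrow> (\<forall>\<alpha>\<in>rays. w \<alpha> \<in> Units R)"
  proof (rule dual_surjective_iff_weights_units[OF module_F finite_rays, of orient_sign "vertex_gen 1" 1 "{0}"])
    fix a assume a: "a \<in> rays \<rightarrow> carrier R"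
      and "(\<Oplus>\<^bsub>V 1\<^esub>\<alpha>\<in>rays. (orient_sign \<alpha> \<otimes>\<^bsub>R\<^esub> a \<alpha>) \<odot>\<^bsub>V 1\<^esub> vertex_gen 1 \<alpha>) = \<zero>\<^bsub>V 1\<^esub>"
    then have "bdry 1 (chain 1 a) = \<zero>\<^bsub>V 1\<^esub>" unfolding bdry_chain[OF order_refl a] by blast
    then show "\<exists>r\<in>carrier R. \<forall>\<alpha>\<in>rays. a \<alpha> = r \<otimes>\<^bsub>R\<^esub> w \<alpha>"
      using u[unfolded uniquely_balanced_iff] a by blast
  next
    fix \<alpha> r assume s: "rays = {\<alpha>}" and r: "r \<in> carrier R" "r \<odot>\<^bsub>V 1\<^esub> vertex_gen 1 \<alpha> = \<zero>\<^bsub>V 1\<^esub>"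
    have "\<alpha> \<in> rays" using s by blast
    then show "r = \<zero>\<^bsub>R\<^esub>"
      using ray_gen_free[OF order_refl _ r(1), of \<alpha>] r(2)
      unfolding ray_gen_def vertex_gen_def F_lower_def FZ_vertex_single_ray[OF s] by blast
  qed (rule orient_sign_closed orient_sign_square vertex_gen_closed[OF order_refl]
      vertex_gen_spans[OF order_refl] weights balancing; assumption?)+
  moreover have "(bdry 0 (chain 0 a) = \<zero>\<^bsub>V 0\<^esub> \<longrightarrow> P) \<longleftrightarrow>
      ((\<Oplus>\<^bsub>R\<^esub>\<alpha>\<in>rays. orient_sign \<alpha> \<otimes>\<^bsub>R\<^esub> a \<alpha>) = \<zero>\<^bsub>R\<^esub> \<longrightarrow> P)" if "a \<in> rays \<rightarrow> carrier R" for a P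
    using bdry_0_chain[OF that] by simp
  ultimately show ?thesis
    using cap_map_iso_iff[OF order_refl] unfolding diff_self_eq_0 by (simp cong: ball_cong)
qed

lemma TPD_iff:
  "TPD R \<Sigma> \<omega> w \<longleftrightarrow> uniquely_balanced R \<Sigma> \<omega> w \<and> (\<forall>\<alpha>\<in>rays. w \<alpha> \<in> Units R)"
proof -
  have le: "(\<forall>p\<le>1. P p) \<longleftrightarrow> P 0 \<and> P 1" for P :: "nat \<Rightarrow> bool"
    by (auto simp: le_Suc_eq One_nat_def)
  have "TPD R \<Sigma> \<omega> w \<longleftrightarrow>
    cap_map R \<Sigma> \<omega> w 0 0 \<in> module_isos R (cohomology R \<Sigma> \<omega> 0 0) (BM_homology R \<Sigma> \<omega> 1 1) \<and>
    cap_map R \<Sigma> \<omega> w 1 0 \<in> module_isos R (cohomology R \<Sigma> \<omega> 1 0) (BM_homology R \<Sigma> \<omega> 0 1)"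
    using cap_map_top_iso[OF zero_le_one] cap_map_top_iso[OF order_refl]
    unfolding TPD_def Let_def dim_one le diff_zero diff_self_eq_0 by blast
  then show ?thesis using cap_map_unit_iso_iff cap_map_forms_iso_iff by blast
qed

end

theorem theorem4p8:
  fixes R :: "('r, 'k) ring_scheme"
    and \<Sigma> :: "(real ^ 'n) set set"
    and \<omega> :: "(real ^ 'n) set \<Rightarrow> 'n list \<Rightarrow> real"
    and w :: "(real ^ 'n) set \<Rightarrow> 'r"
  assumes "cring R"
    and "pure_fan \<Sigma>" and "fan_dim \<Sigma> = 1"
    and "orientation \<Sigma> \<omega>"
    and "balanced R \<Sigma> \<omega> w"
  shows "TPD R \<Sigma> \<omega> w \<longleftrightarrow>
    uniquely_balanced R \<Sigma> \<omega> w \<and> (\<forall>\<alpha>\<in>faces \<Sigma> 1. w \<alpha> \<in> Units R)"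
proof -
  interpret balanced_curve R \<Sigma> \<omega> w
    using assms
    by (simp add: balanced_curve_def fan_curve_def balanced_curve_axioms_def)
  show ?thesis by (rule TPD_iff)
qed

end
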